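(* Every solvable Lie algebra $\mathfrak{g}$ of dimension $\le 8$ over a field of characteristic zero has a zero reduced Koszul map $\bar\eta:H_3(\mathfrak{g})\to\mathrm{Kill}(\mathfrak{g})$.
   Context: Tensor, exterior and symmetric powers are over the ground field. $H_*(\mathfrak{g})$ is the homology of the Chevalley–Eilenberg complex $\Lambda^*\mathfrak{g}$ with $\partial_n(x_1\wedge\dots\wedge x_n)=\sum_{i<j}(-1)^{i+j}[x_i,x_j]\wedge x_1\wedge\dots\wedge\hat{x_i}\wedge\dots\wedge\hat{x_j}\wedge\dots\wedge x_n$, and $Z_3(\mathfrak{g})=\ker\partial_3$. Writing $x\odot y$ for the product in the symmetric square $S^2\mathfrak{g}$, the Killing module $\mathrm{Kill}(\mathfrak{g})$ is the cokernel of $\mathfrak{g}^{\otimes 3}\to S^2\mathfrak{g}$, $x\otimes y\otimes z\mapsto [x,y]\odot z-x\odot[y,z]$. The Koszul map $\eta:\Lambda^3\mathfrak{g}\to\mathrm{Kill}(\mathfrak{g})$ sends $x\wedge y\wedge z$ to the class of $x\odot[y,z]$; it vanishes on 3-boundaries, and the reduced Koszul map $\bar\eta$ is induced by restricting $\eta$ to $Z_3(\mathfrak{g})$. *)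

theory Defs
  imports Complex_Main "HOL-Library.Poly_Mapping" "HOL-Library.Set_Algebras"
begin

text \<open>
  Quotients are spaces of cosets: the class of \<open>u\<close> modulo \<open>W\<close> is \<open>u +o W\<close>, classes are
  added by the Minkowski sum of sets, and the zero of \<open>U / W\<close> is \<open>W = 0 +o W\<close>.  Since the sum
  of sets is available at every level, a quotient of a quotient is formed in the same way.
\<close>

definition quotient_space :: "'v::plus set \<Rightarrow> 'v set \<Rightarrow> 'v set set" where
  "quotient_space U W = (\<lambda>u. u +o W) ` U"

text \<open>
  The map that a map \<open>f\<close>, defined on representatives and constant on each coset, induces on
  cosets.
\<close>

definition induced_map :: "('v \<Rightarrow> 'q) \<Rightarrow> 'v set \<Rightarrow> 'q" where
  "induced_map f c = the_elem (f ` c)"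

text \<open>
  The type \<open>'w \<Rightarrow>\<^sub>0 'k\<close> is the vector space over \<open>'k\<close> with basis \<open>'w\<close>.
\<close>

definition free_scale :: "'k::field \<Rightarrow> ('w \<Rightarrow>\<^sub>0 'k) \<Rightarrow> ('w \<Rightarrow>\<^sub>0 'k)" where
  "free_scale c = Poly_Mapping.map (\<lambda>a. c * a)"

lemma lookup_free_scale [simp]: "Poly_Mapping.lookup (free_scale c p) w = c * Poly_Mapping.lookup p w"
  by (simp add: free_scale_def Poly_Mapping.map.rep_eq when_def)

global_interpretation free: vector_space "free_scale :: 'k::field \<Rightarrow> ('w \<Rightarrow>\<^sub>0 'k) \<Rightarrow> _"
  by standard (auto intro!: poly_mapping_eqI simp: lookup_add algebra_simps)

definition word :: "'w \<Rightarrow> ('w \<Rightarrow>\<^sub>0 'k::field)" where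
  "word w = Poly_Mapping.single w 1"

definition linear_extension ::
    "('w \<Rightarrow> ('v \<Rightarrow>\<^sub>0 'k)) \<Rightarrow> ('w \<Rightarrow>\<^sub>0 'k::field) \<Rightarrow> ('v \<Rightarrow>\<^sub>0 'k)" where
  "linear_extension f p = (\<Sum>w\<in>Poly_Mapping.keys p. free_scale (Poly_Mapping.lookup p w) (f w))"

definition free_words :: "nat \<Rightarrow> ('a list \<Rightarrow>\<^sub>0 'k::field) set" where
  "free_words n = {p. \<forall>w\<in>Poly_Mapping.keys p. length w = n}"

locale lie_algebra = vector_space scale
  for scale :: "'k::field \<Rightarrow> 'a::ab_group_add \<Rightarrow> 'a" (infixr \<open>*s\<close> 75) +
  fixes bracket :: "'a \<Rightarrow> 'a \<Rightarrow> 'a"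
  assumes bracket_add_left: "bracket (x + y) z = bracket x z + bracket y z"
    and bracket_add_right: "bracket x (y + z) = bracket x y + bracket x z"
    and bracket_scale_left: "bracket (c *s x) y = c *s bracket x y"
    and bracket_scale_right: "bracket x (c *s y) = c *s bracket x y"
    and bracket_self: "bracket x x = 0"
    and jacobi: "bracket x (bracket y z) + bracket y (bracket z x) + bracket z (bracket x y) = 0"
begin

primrec derived_series :: "nat \<Rightarrow> 'a set" where
  "derived_series 0 = UNIV"
| "derived_series (Suc n) =
     span {bracket x y | x y. x \<in> derived_series n \<and> y \<in> derived_series n}"

definition solvable :: bool where
  "solvable \<longleftrightarrow> (\<exists>n. derived_series n = {0})"

text \<open>
  The \<open>n\<close>-th tensor, exterior and (for \<open>n = 2\<close>) symmetric powers are the quotients of the free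
  vector space on the words of length \<open>n\<close> by the subspaces of relations below.
\<close>

definition multilinearity :: "nat \<Rightarrow> ('a list \<Rightarrow>\<^sub>0 'k) set" where
  "multilinearity n =
     {word (w[i := x + y]) - word (w[i := x]) - word (w[i := y]) | w i x y.
        length w = n \<and> i < n} \<union>
     {word (w[i := c *s x]) - free_scale c (word (w[i := x])) | w i c x.
        length w = n \<and> i < n}"

definition tensor_relations :: "nat \<Rightarrow> ('a list \<Rightarrow>\<^sub>0 'k) set" where
  "tensor_relations n = free.span (multilinearity n)"

definition exterior_relations :: "nat \<Rightarrow> ('a list \<Rightarrow>\<^sub>0 'k) set" where
  "exterior_relations n = free.span (multilinearity n \<union>
     {word w | w. length w = n \<and> (\<exists>i j. i < j \<and> j < n \<and> w ! i = w ! j)})"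

definition symmetric_relations :: "('a list \<Rightarrow>\<^sub>0 'k) set" where
  "symmetric_relations = free.span (multilinearity 2 \<union> {word [x, y] - word [y, x] | x y. True})"

definition tensor_power :: "nat \<Rightarrow> ('a list \<Rightarrow>\<^sub>0 'k) set set" where
  "tensor_power n = quotient_space (free_words n) (tensor_relations n)"

definition exterior_power :: "nat \<Rightarrow> ('a list \<Rightarrow>\<^sub>0 'k) set set" where
  "exterior_power n = quotient_space (free_words n) (exterior_relations n)"

definition symmetric_square :: "('a list \<Rightarrow>\<^sub>0 'k) set set" where
  "symmetric_square = quotient_space (free_words 2) symmetric_relations"

text \<open>
  Positions in a list count from \<open>0\<close>; the shift from positions counted from \<open>1\<close> leaves the
  sign \<open>(-1) ^ (i + j)\<close> unchanged.
\<close>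

definition word_boundary :: "'a list \<Rightarrow> ('a list \<Rightarrow>\<^sub>0 'k)" where
  "word_boundary w =
     (\<Sum>(i, j) \<in> {(i, j). i < j \<and> j < length w}.
        free_scale ((- 1) ^ (i + j)) (word (bracket (w ! i) (w ! j) # nths w (- {i, j}))))"

definition boundary :: "nat \<Rightarrow> ('a list \<Rightarrow>\<^sub>0 'k) set \<Rightarrow> ('a list \<Rightarrow>\<^sub>0 'k) set" where
  "boundary n =
     induced_map (\<lambda>p. linear_extension word_boundary p +o exterior_relations (n - 1))"

definition cycles :: "nat \<Rightarrow> ('a list \<Rightarrow>\<^sub>0 'k) set set" where
  "cycles n = {c \<in> exterior_power n. boundary n c = exterior_relations (n - 1)}"

definition boundaries :: "nat \<Rightarrow> ('a list \<Rightarrow>\<^sub>0 'k) set set" where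
  "boundaries n = boundary (n + 1) ` exterior_power (n + 1)"

definition homology :: "nat \<Rightarrow> ('a list \<Rightarrow>\<^sub>0 'k) set set set" where
  "homology n = quotient_space (cycles n) (boundaries n)"

text \<open>
  The map from the third tensor power to the symmetric square sending \<open>x \<otimes> y \<otimes> z\<close> to
  \<open>[x, y] \<odot> z - x \<odot> [y, z]\<close>.
\<close>

definition associator_map :: "('a list \<Rightarrow>\<^sub>0 'k) set \<Rightarrow> ('a list \<Rightarrow>\<^sub>0 'k) set" where
  "associator_map = induced_map (\<lambda>p. linear_extension
     (\<lambda>w. word [bracket (w ! 0) (w ! 1), w ! 2] - word [w ! 0, bracket (w ! 1) (w ! 2)]) p
       +o symmetric_relations)"

definition killing_relations :: "('a list \<Rightarrow>\<^sub>0 'k) set set" where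
  "killing_relations = associator_map ` tensor_power 3"

definition killing_module :: "('a list \<Rightarrow>\<^sub>0 'k) set set set" where
  "killing_module = quotient_space symmetric_square killing_relations"

definition killing_zero :: "('a list \<Rightarrow>\<^sub>0 'k) set set" where
  "killing_zero = symmetric_relations +o killing_relations"

text \<open>The class of \<open>x \<odot> [y, z]\<close> is the value on \<open>x \<and> y \<and> z\<close>.\<close>

definition koszul_map :: "('a list \<Rightarrow>\<^sub>0 'k) set \<Rightarrow> ('a list \<Rightarrow>\<^sub>0 'k) set set" where
  "koszul_map = induced_map (\<lambda>p. (linear_extension
     (\<lambda>w. word [w ! 0, bracket (w ! 1) (w ! 2)]) p +o symmetric_relations) +o killing_relations)"

definition reduced_koszul_map :: "('a list \<Rightarrow>\<^sub>0 'k) set set \<Rightarrow> ('a list \<Rightarrow>\<^sub>0 'k) set set" where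
  "reduced_koszul_map = induced_map koszul_map"

end

end

(*
  Linear functionals on the free vector space that kill the relations of the Killing module are the
  invariant symmetric bilinear forms B, so the claim is that for each of them the three-form
  omega(x, y, w) = B([x, y], w) is the coboundary of a two-form. Modulo the radical of B the algebra
  is quadratic. Being solvable, it has a central isotropic vector z; in z^perp / z, of dimension at
  most six, there is again a central isotropic vector y, which can be chosen so that B(y, -) divides
  omega on z^perp. Let t and s be dual to z and y, and let U, of dimension at most four, be the
  orthogonal complement of these four vectors.
  If y is central, t and s act on U by commuting skew maps: either they are proportional and omega
  has a closed divisor, or the only obstruction is the component of [t, s] in the coinvariants of U,
  which a grading removes.
  Otherwise a Pfaffian argument gives omega = y ^ a ^ b on z^perp, and the rank of B on the span of
  a and b decides: rank two forces y to be central after all, while in ranks one and zero z^perp / z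
  is a graded nilpotent algebra, whose grading exhibits omega as a coboundary.
*)

theory Submission
  imports Defs
begin

section \<open>Invariant forms and coboundaries\<close>

text \<open>Vectors v are read as functionals \<open>B v\<close>; below, u ^ v is a product of such
  functionals and d the coboundary. Origin of the gradings: if D is a derivation with
  \<open>B (D x) y + B x (D y) = 2 * B x y\<close>, then D - 1 is skew, and invariance shows that
  \<omega> is the coboundary of the two-form \<open>B (D x - x) y\<close>. Hence dual vectors have
  weights of sum 2, and the primitive is a combination of products of dual pairs such as t ^ z. D
  itself is never built: the combination is written down, and the terms by which the bracket misses
  the grading are shown to be exact one by one. The dimension bound enters through what hyperbolic
  planes leave over: rank two after three of them, rank four after two. In rank four, commuting skew
  maps that kill an anisotropic vector are proportional, and one Pfaffian decides whether a two-form
  is decomposable. No quotient by the radical is formed: subspaces contain it, ranks are counted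
  above it, and orthogonal frames may contain zero vectors, which covers smaller dimensions without
  separate cases.\<close>

context lie_algebra
begin

lemma bracket_zero_left [simp]: "bracket 0 x = 0"
  using bracket_scale_left[of 0 0 x] by simp

lemma bracket_zero_right [simp]: "bracket x 0 = 0"
  using bracket_scale_right[of x 0 0] by simp

lemma bracket_swap: "bracket y x = - bracket x y"
proof -
  have "bracket x y + bracket y x = bracket (x + y) (x + y)"
    unfolding bracket_add_left bracket_add_right by (simp add: bracket_self)
  then show ?thesis by (simp add: bracket_self add_eq_0_iff)
qed

end

locale quadratic_lie_algebra =
  lie_algebra scale bracket + finite_dimensional_vector_space scale Basis
  for scale :: "'k::field_char_0 \<Rightarrow> 'a::ab_group_add \<Rightarrow> 'a" (infixr \<open>*s\<close> 75)
    and bracket :: "'a \<Rightarrow> 'a \<Rightarrow> 'a" and Basis :: "'a set" +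
  fixes B :: "'a \<Rightarrow> 'a \<Rightarrow> 'k"
  assumes B_add_left: "B (x + y) w = B x w + B y w"
    and B_scale_left: "B (c *s x) w = c * B x w"
    and B_sym: "B x y = B y x"
    and B_inv: "B (bracket x y) w = B x (bracket y w)"
begin

lemma B_add_right: "B w (x + y) = B w x + B w y"
  by (subst (1 2 3) B_sym) (rule B_add_left)

lemma B_scale_right: "B w (c *s x) = c * B w x"
  by (subst (1 2) B_sym) (rule B_scale_left)

lemma B_zero_left [simp]: "B 0 x = 0"
  using B_scale_left[of 0 0 x] by simp

lemma B_zero_right [simp]: "B x 0 = 0"
  by (subst B_sym) (rule B_zero_left)

lemma B_minus_left: "B (- x) y = - B x y"
  using B_scale_left[of "-1" x y] by simp

lemma B_minus_right: "B y (- x) = - B y x"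
  by (subst (1 2) B_sym) (rule B_minus_left)

lemma B_diff_left: "B (x - y) w = B x w - B y w"
  by (simp only: diff_conv_add_uminus B_add_left B_minus_left)

lemma B_diff_right: "B w (x - y) = B w x - B w y"
  by (subst (1 2 3) B_sym) (rule B_diff_left)

lemmas B_linear = B_add_left B_add_right B_scale_left B_scale_right B_minus_left B_minus_right
  B_diff_left B_diff_right

definition \<omega> :: "'a \<Rightarrow> 'a \<Rightarrow> 'a \<Rightarrow> 'k" where
  "\<omega> x y w = B (bracket x y) w"

lemma \<omega>_swap12: "\<omega> y x w = - \<omega> x y w"
  unfolding \<omega>_def using bracket_swap[of x y] by (simp add: B_minus_left)

lemma \<omega>_rot: "\<omega> y w x = \<omega> x y w"
  unfolding \<omega>_def using B_inv B_sym by metis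

lemma \<omega>_swap23: "\<omega> x w y = - \<omega> x y w"
  using \<omega>_rot \<omega>_swap12 by metis

lemma \<omega>_same [simp]: "\<omega> x x y = 0" "\<omega> x y x = 0" "\<omega> y x x = 0"
proof -
  show *: "\<omega> x x y = 0" for x y by (simp add: \<omega>_def bracket_self)
  show "\<omega> x y x = 0" using *[of x y] \<omega>_rot by metis
  show "\<omega> y x x = 0" using *[of x y] \<omega>_rot by metis
qed

lemma \<omega>_zero [simp]: "\<omega> 0 x y = 0" "\<omega> x 0 y = 0" "\<omega> x y 0 = 0"
  by (simp_all add: \<omega>_def)

lemma \<omega>_add: "\<omega> (x + x') y w = \<omega> x y w + \<omega> x' y w" "\<omega> x (y + y') w = \<omega> x y w + \<omega> x y' w"
  "\<omega> x y (w + w') = \<omega> x y w + \<omega> x y w'"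
  by (simp_all add: \<omega>_def bracket_add_left bracket_add_right B_linear)

lemma \<omega>_scale: "\<omega> (c *s x) y w = c * \<omega> x y w" "\<omega> x (c *s y) w = c * \<omega> x y w"
  "\<omega> x y (c *s w) = c * \<omega> x y w"
  by (simp_all add: \<omega>_def bracket_scale_left bracket_scale_right B_linear)

lemma \<omega>_minus: "\<omega> (- x) y w = - \<omega> x y w" "\<omega> x (- y) w = - \<omega> x y w" "\<omega> x y (- w) = - \<omega> x y w"
  using \<omega>_scale[where c = "-1"] by simp_all

lemma \<omega>_diff: "\<omega> (x - x') y w = \<omega> x y w - \<omega> x' y w" "\<omega> x (y - y') w = \<omega> x y w - \<omega> x y' w"
  "\<omega> x y (w - w') = \<omega> x y w - \<omega> x y w'"
  by (simp_all only: diff_conv_add_uminus \<omega>_add \<omega>_minus)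

lemmas \<omega>_linear = \<omega>_add \<omega>_scale \<omega>_minus \<omega>_diff

text \<open>Bracketing with t is a derivation by Jacobi and skew for \<open>B\<close>, so it
  preserves \<omega>. With arguments chosen to make most terms vanish, this is the main source of
  relations between structure constants below.\<close>

lemma \<omega>_derivation: "\<omega> (bracket t x) y w + \<omega> x (bracket t y) w + \<omega> x y (bracket t w) = 0"
proof -
  have 1: "\<omega> x y (bracket t w) = - B (bracket t (bracket x y)) w"
    unfolding \<omega>_def by (metis B_inv B_minus_left bracket_swap)
  have "bracket x (bracket y t) = - bracket x (bracket t y)"
    using bracket_swap[of y t] bracket_scale_right[of x "-1" "bracket t y"] by simp
  moreover have "bracket y (bracket t x) = - bracket (bracket t x) y" by (rule bracket_swap)
  ultimately have "bracket t (bracket x y) = bracket (bracket t x) y + bracket x (bracket t y)"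
    using jacobi[of t x y] by (simp add: algebra_simps)
  then have "B (bracket t (bracket x y)) w = \<omega> (bracket t x) y w + \<omega> x (bracket t y) w" by (simp only: \<omega>_def B_add_left)
  then show ?thesis unfolding 1 by simp
qed

text \<open>Being the Chevalley-Eilenberg coboundary of a two-form \<alpha>, up to sign convention.
  Antisymmetry is equivalent to alternation in characteristic zero, and it transfers linearity to
  the second argument.\<close>

definition exact_form :: "('a \<Rightarrow> 'a \<Rightarrow> 'a \<Rightarrow> 'k) \<Rightarrow> bool" where
  "exact_form F \<longleftrightarrow> (\<exists>\<alpha>. (\<forall>x x' y. \<alpha> (x + x') y = \<alpha> x y + \<alpha> x' y) \<and> (\<forall>c x y. \<alpha> (c *s x) y = c * \<alpha> x y)
     \<and> (\<forall>x y. \<alpha> y x = - \<alpha> x y)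
     \<and> (\<forall>x y w. F x y w = \<alpha> (bracket x y) w + \<alpha> (bracket y w) x + \<alpha> (bracket w x) y))"

text \<open>The coboundary of u ^ v, since the coboundary of the one-form \<open>B u\<close> sends
  x, y to \<open>\<omega> x y u\<close>.\<close>

definition wedge_coboundary :: "'a \<Rightarrow> 'a \<Rightarrow> 'a \<Rightarrow> 'a \<Rightarrow> 'a \<Rightarrow> 'k" where
  "wedge_coboundary u v x y w = \<omega> x y u * B v w + \<omega> y w u * B v x + \<omega> w x u * B v y
     - (\<omega> x y v * B u w + \<omega> y w v * B u x + \<omega> w x v * B u y)"

text \<open>The product u ^ v ^ p, as a 3 by 3 determinant.\<close>

definition wedge3 :: "'a \<Rightarrow> 'a \<Rightarrow> 'a \<Rightarrow> 'a \<Rightarrow> 'a \<Rightarrow> 'a \<Rightarrow> 'k" where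
  "wedge3 u v p x y w = B u x * (B v y * B p w - B v w * B p y)
     - B u y * (B v x * B p w - B v w * B p x) + B u w * (B v x * B p y - B v y * B p x)"

lemma exact_form_G: "exact_form (wedge_coboundary u v)"
  unfolding exact_form_def
  by (rule exI[of _ "\<lambda>x y. B u x * B v y - B v x * B u y"])
    (auto simp: B_linear wedge_coboundary_def \<omega>_def B_sym algebra_simps)

lemma exact_form_add: "exact_form (\<lambda>x y w. F x y w + F' x y w)" if F: "exact_form F" and F': "exact_form F'"
proof -
  from F obtain a where a: "\<And>x x' y. a (x + x') y = a x y + a x' y" "\<And>c x y. a (c *s x) y = c * a x y"
     "\<And>x y. a y x = - a x y"
     "\<And>x y w. F x y w = a (bracket x y) w + a (bracket y w) x + a (bracket w x) y"
    unfolding exact_form_def by blast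
  from F' obtain b where b: "\<And>x x' y. b (x + x') y = b x y + b x' y" "\<And>c x y. b (c *s x) y = c * b x y"
     "\<And>x y. b y x = - b x y"
     "\<And>x y w. F' x y w = b (bracket x y) w + b (bracket y w) x + b (bracket w x) y"
    unfolding exact_form_def by blast
  show ?thesis unfolding exact_form_def
  proof (intro exI[of _ "\<lambda>x y. a x y + b x y"] conjI allI)
    show "a y x + b y x = - (a x y + b x y)" for x y using a(3)[of y x] b(3)[of y x] by simp
  qed (simp_all only: a(1,2,4) b(1,2,4) distrib_left ac_simps)
qed

lemma exact_form_scale: "exact_form (\<lambda>x y w. c * F x y w)" if F: "exact_form F"
proof -
  from F obtain a where a: "\<And>x x' y. a (x + x') y = a x y + a x' y" "\<And>c x y. a (c *s x) y = c * a x y"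
     "\<And>x y. a y x = - a x y"
     "\<And>x y w. F x y w = a (bracket x y) w + a (bracket y w) x + a (bracket w x) y"
    unfolding exact_form_def by blast
  show ?thesis unfolding exact_form_def
  proof (intro exI[of _ "\<lambda>x y. c * a x y"] conjI allI)
    show "c * a y x = - (c * a x y)" for x y using a(3)[of y x] by simp
  qed (simp_all only: a(1,2,4) distrib_left ac_simps)
qed

lemma exact_form_zero: "exact_form (\<lambda>x y w. 0)"
  using exact_form_scale[OF exact_form_G, of 0] by simp

lemma exact_form_cong: "exact_form F \<Longrightarrow> (\<And>x y w. F' x y w = F x y w) \<Longrightarrow> exact_form F'"
  by (simp only: exact_form_def)

lemma exact_form_cancel:
  assumes "c \<noteq> 0" "exact_form (\<lambda>x y w. c * F x y w)" shows "exact_form F"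
  by (rule exact_form_cong[OF exact_form_scale[OF assms(2), of "inverse c"]]) (use assms(1) in simp)

text \<open>Since z is central, \<open>B z\<close> is a closed one-form. A three-form vanishing on
  its kernel is \<open>B z\<close> times its contraction with \<open>t'\<close>, and this product is
  d(\<open>t'\<close> ^ z).\<close>

lemma exact_form_divisible_by_closed:
  assumes z: "\<And>x y. \<omega> z x y = 0" and t: "B z t \<noteq> 0"
    and ker: "\<And>x y w. B z x = 0 \<Longrightarrow> B z y = 0 \<Longrightarrow> B z w = 0 \<Longrightarrow> \<omega> x y w = 0"
  shows "exact_form \<omega>"
proof -
  define t' where "t' = inverse (B z t) *s t"
  have zt: "B z t' = 1" using t by (simp add: t'_def B_linear)
  define p where "p x = x - B z x *s t'" for x
  have "B z (p x) = 0" for x using zt by (simp add: p_def B_linear)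
  then have 0: "\<omega> (p x) (p y) (p w) = 0" for x y w using ker by blast
  have z': "\<omega> x y z = 0" for x y using z \<omega>_rot[of x y z] by simp
  have t1: "\<omega> t' x y = \<omega> x y t'" "\<omega> x t' y = - \<omega> x y t'" for x y
    by (rule \<omega>_rot[symmetric], rule \<omega>_swap23)
  have "\<omega> x y w = wedge_coboundary t' z x y w" for x y w
  proof -
    have "\<omega> w x t' = - \<omega> x w t'" by (rule \<omega>_swap12)
    then show ?thesis
      using 0[of x y w] by (simp add: p_def \<omega>_linear wedge_coboundary_def z' t1 algebra_simps)
  qed
  then show ?thesis
    using exact_form_cong[OF exact_form_G] by blast
qed

end

section \<open>Nondegeneracy modulo the radical\<close>

lemma (in vector_space) separating_functional:
  assumes "p \<notin> span S"
  obtains \<phi> where "\<And>x y. \<phi> (x + y) = \<phi> x + \<phi> y" "\<And>c x. \<phi> (scale c x) = c * \<phi> x"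
    "\<And>x. x \<in> span S \<Longrightarrow> \<phi> x = 0" "\<phi> p = 1"
proof -
  interpret P: vector_space_pair scale "(*) :: 'a \<Rightarrow> 'a \<Rightarrow> 'a"
    by unfold_locales (auto simp: algebra_simps)
  obtain C where C: "C \<subseteq> S" "independent C" "S \<subseteq> span C" using maximal_independent_subset by blast
  have sp: "span C = span S" using C by (meson span_mono span_minimal subspace_span subset_antisym)
  have "independent (insert p C)" using C(2) assms sp by (intro independent_insertI) auto
  then obtain \<phi> where \<phi>: "Vector_Spaces.linear scale (*) \<phi>" "\<forall>x\<in>insert p C. \<phi> x = (if x = p then 1 else 0)"
    using P.linear_independent_extend[of "insert p C" "\<lambda>x. if x = p then 1 else 0"] by blast
  interpret L: Vector_Spaces.linear scale "(*)" \<phi> by (rule \<phi>(1))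
  have "p \<notin> C" using assms sp span_base by blast
  then have "\<phi> x = 0" if "x \<in> C" for x using \<phi>(2) that by auto
  then have "\<phi> x = 0" if "x \<in> span S" for x
    using L.eq_0_on_span[of C x] that sp by blast
  with \<phi>(2) show ?thesis by (intro that[of \<phi>]) (auto simp: L.add L.scale)
qed

context quadratic_lie_algebra
begin

definition radical :: "'a set" where
  "radical = {x. \<forall>y. B x y = 0}"

text \<open>Stands for nondegeneracy of the image of X modulo \<open>radical\<close>. Keeping the
  radical inside X avoids a quotient type; decompositions are then obtained up to an error in
  \<open>radical\<close>.\<close>

definition nondegenerate :: "'a set \<Rightarrow> bool" where
  "nondegenerate X \<longleftrightarrow> subspace X \<and> radical \<subseteq> X \<and> (\<forall>x\<in>X. (\<forall>y\<in>X. B x y = 0) \<longrightarrow> x \<in> radical)"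

text \<open>Bounds the dimension of X modulo \<open>radical\<close>. Only an upper bound is tracked,
  so that zero vectors can fill up a frame that is too short.\<close>

definition rank_le :: "nat \<Rightarrow> 'a set \<Rightarrow> bool" where
  "rank_le k X \<longleftrightarrow> nondegenerate X \<and> dim X \<le> k + dim radical"

lemma radical_iff: "x \<in> radical \<longleftrightarrow> (\<forall>y. B x y = 0)"
  by (simp add: radical_def)

lemma B_radical: "x \<in> radical \<Longrightarrow> B x y = 0" "x \<in> radical \<Longrightarrow> B y x = 0"
  using B_sym[of x y] by (auto simp: radical_def)

lemma \<omega>_radical: "r \<in> radical \<Longrightarrow> \<omega> r x y = 0" "r \<in> radical \<Longrightarrow> \<omega> x r y = 0" "r \<in> radical \<Longrightarrow> \<omega> x y r = 0"
proof -
  assume r: "r \<in> radical"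
  show *: "\<omega> x y r = 0" for x y by (simp add: \<omega>_def B_radical r)
  show "\<omega> r x y = 0" using *[of x y] \<omega>_rot[of x y r] by simp
  show "\<omega> x r y = 0" using *[of y x] \<omega>_rot[of x r y] by simp
qed

lemma subspace_radical: "subspace radical"
  by (auto simp: subspace_def radical_def B_linear)

lemma dim_less:
  assumes "subspace S" "subspace T" "S \<subset> T" shows "dim S < dim T"
proof -
  have "span S = S" "span T = T" using assms by (simp_all only: span_eq_iff)
  then show ?thesis using dim_psubset assms(3) by metis
qed

lemma subspace_perp: "subspace X \<Longrightarrow> subspace {x \<in> X. B a x = 0}"
  by (auto simp: subspace_def B_linear)

lemma nondegenerate_UNIV: "nondegenerate UNIV"
  by (simp add: nondegenerate_def radical_def)

lemma nondegenerateD: "nondegenerate X \<Longrightarrow> x \<in> X \<Longrightarrow> x \<notin> radical \<Longrightarrow> \<exists>y\<in>X. B x y \<noteq> 0"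
  unfolding nondegenerate_def by blast

lemma nondegenerate_perp1:
  assumes X: "nondegenerate X" and c: "c \<in> X" "B c c \<noteq> 0"
  shows "nondegenerate {x \<in> X. B c x = 0}" "dim {x \<in> X. B c x = 0} + 1 \<le> dim X"
    "\<And>x. x \<in> X \<Longrightarrow> x - (B c x / B c c) *s c \<in> {x \<in> X. B c x = 0}"
proof -
  have sX: "subspace X" and RX: "radical \<subseteq> X" using X by (auto simp: nondegenerate_def)
  show p: "x - (B c x / B c c) *s c \<in> {x \<in> X. B c x = 0}" if "x \<in> X" for x
    using that c sX by (auto simp: B_linear subspace_diff subspace_scale)
  show "nondegenerate {x \<in> X. B c x = 0}"
    unfolding nondegenerate_def
  proof (intro conjI ballI impI)
    show "subspace {x \<in> X. B c x = 0}" by (rule subspace_perp[OF sX])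
    show "radical \<subseteq> {x \<in> X. B c x = 0}" using RX by (auto simp: B_radical)
    fix x assume x: "x \<in> {x \<in> X. B c x = 0}" and 0: "\<forall>y\<in>{x \<in> X. B c x = 0}. B x y = 0"
    have "B x y = 0" if "y \<in> X" for y
      using 0 p[OF that] x by (fastforce simp: B_linear B_sym[of x c])
    then show "x \<in> radical" using X x by (auto simp: nondegenerate_def)
  qed
  have "{x \<in> X. B c x = 0} \<subset> X" using c by auto
  then have "dim {x \<in> X. B c x = 0} < dim X" by (intro dim_less subspace_perp sX)
  then show "dim {x \<in> X. B c x = 0} + 1 \<le> dim X" by simp
qed

text \<open>The isotropic vectors a and s span a hyperbolic plane, which splits off orthogonally.
  The dimension drops by 2 because s separates X from \<open>?Z\<close> and a separates
  \<open>?Z\<close> from \<open>?Y\<close>.\<close>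

lemma nondegenerate_perp2:
  assumes X: "nondegenerate X" and a: "a \<in> X" "B a a = 0" and s: "s \<in> X" "B a s = 1" "B s s = 0"
  shows "nondegenerate {x \<in> X. B a x = 0 \<and> B s x = 0}" "dim {x \<in> X. B a x = 0 \<and> B s x = 0} + 2 \<le> dim X"
    "\<And>x. x \<in> X \<Longrightarrow> x - B a x *s s - B s x *s a \<in> {x \<in> X. B a x = 0 \<and> B s x = 0}"
proof -
  let ?Y = "{x \<in> X. B a x = 0 \<and> B s x = 0}"
  let ?Z = "{x \<in> X. B a x = 0}"
  have sX: "subspace X" and RX: "radical \<subseteq> X" using X by (auto simp: nondegenerate_def)
  have sa: "B s a = 1" using s(2) B_sym by metis
  show p: "x - B a x *s s - B s x *s a \<in> ?Y" if "x \<in> X" for x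
    using that a s sX sa by (auto simp: B_linear subspace_diff subspace_scale)
  have sY: "subspace ?Y" using sX by (auto simp: subspace_def B_linear)
  show "nondegenerate ?Y"
    unfolding nondegenerate_def
  proof (intro conjI ballI impI)
    show "subspace ?Y" by (rule sY)
    show "radical \<subseteq> ?Y" using RX by (auto simp: B_radical)
    fix x assume x: "x \<in> ?Y" and 0: "\<forall>y\<in>?Y. B x y = 0"
    have "B x y = 0" if "y \<in> X" for y
      using bspec[OF 0 p[OF that]] x by (simp add: B_linear B_sym[of x a] B_sym[of x s])
    then show "x \<in> radical" using X x by (auto simp: nondegenerate_def)
  qed
  have "a \<in> ?Z - ?Y" using a sa by auto
  then have "?Y \<subset> ?Z" by blast
  then have 1: "dim ?Y < dim ?Z" by (intro dim_less subspace_perp sX sY)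
  have "s \<in> X - ?Z" using s by auto
  then have "?Z \<subset> X" by blast
  then have 2: "dim ?Z < dim X" by (intro dim_less subspace_perp sX)
  show "dim ?Y + 2 \<le> dim X" using 1 2 by linarith
qed

lemma rank_le_perp2:
  assumes "rank_le (Suc (Suc k)) X" "a \<in> X" "B a a = 0" "s \<in> X" "B a s = 1" "B s s = 0"
  shows "rank_le k {x \<in> X. B a x = 0 \<and> B s x = 0}"
  using nondegenerate_perp2[of X a s] assms by (simp add: rank_le_def)

lemma dual_exists:
  assumes "nondegenerate X" "a \<in> X" "a \<notin> radical" "B a a = 0"
  obtains s where "s \<in> X" "B a s = 1" "B s s = 0"
proof -
  obtain y where y: "y \<in> X" "B a y \<noteq> 0" using nondegenerateD assms by blast
  define s0 where "s0 = inverse (B a y) *s y"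
  \<comment> \<open>As a is isotropic and pairs to 1 with \<open>s0\<close>, this multiple of a
    cancels \<open>B s0 s0\<close> without changing \<open>B a s0\<close>.\<close>
  define s where "s = s0 - (B s0 s0 / 2) *s a"
  have sX: "subspace X" using assms by (simp add: nondegenerate_def)
  have s0: "B a s0 = 1" using y by (simp add: s0_def B_linear)
  have "s \<in> X" using sX y assms by (simp add: s_def s0_def subspace_diff subspace_scale)
  moreover have "B a s = 1" using s0 assms by (simp add: s_def B_linear)
  moreover have "B s s = 0" using s0 assms B_sym[of s0 a] by (simp add: s_def B_linear)
  ultimately show ?thesis using that by blast
qed

lemma rank_le_0: "rank_le 0 X \<Longrightarrow> X = radical"
  using subspace_dim_equal[of radical X] subspace_radical by (auto simp: rank_le_def nondegenerate_def)

lemma isotropic_imp_zero: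
  assumes "subspace X" "\<And>x. x \<in> X \<Longrightarrow> B x x = 0" "x \<in> X" "y \<in> X" shows "B x y = 0"
proof -
  have "B (x + y) (x + y) = 0" using assms by (simp add: subspace_add)
  then show ?thesis using assms B_sym[of y x] by (simp add: B_linear)
qed

text \<open>The vector \<open>c\<close> may be zero, in which case division by zero makes the last clause read \<open>x \<in> X\<close>.\<close>

lemma rank_le_Suc:
  assumes "rank_le (Suc k) X"
  obtains c where "c \<in> X" "c = 0 \<or> B c c \<noteq> 0" "rank_le k {x \<in> X. B c x = 0}"
    "\<And>x. x \<in> X \<Longrightarrow> x - (B c x / B c c) *s c \<in> {x \<in> X. B c x = 0}"
proof (cases "\<exists>c\<in>X. B c c \<noteq> 0")
  case True
  then obtain c where "c \<in> X" "B c c \<noteq> 0" by blast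
  then show ?thesis using nondegenerate_perp1[of X c] assms that[of c] by (simp add: rank_le_def)
next
  case False
  then have 0: "B x y = 0" if "x \<in> X" "y \<in> X" for x y
    using isotropic_imp_zero[of X] assms that by (auto simp: rank_le_def nondegenerate_def)
  then have "X \<subseteq> radical" using assms by (auto simp: rank_le_def nondegenerate_def)
  then have "dim X \<le> dim radical" by (rule dim_subset)
  then show ?thesis using assms by (intro that[of 0]) (auto simp: rank_le_def nondegenerate_def subspace_0)
qed

text \<open>Riesz representation on a subspace where \<open>B\<close> may degenerate: \<phi> only
  has to kill the radical of the restriction. The induction splits off an anisotropic vector; if
  there is none, polarization makes \<open>B\<close> zero on X, and then \<phi> is zero on X
  too.\<close>

lemma represent_functional:
  assumes "subspace X" "\<And>x y. \<phi> (x + y) = \<phi> x + \<phi> y" "\<And>c x. \<phi> (c *s x) = c * \<phi> x"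
    "\<And>x. x \<in> X \<Longrightarrow> (\<And>y. y \<in> X \<Longrightarrow> B x y = 0) \<Longrightarrow> \<phi> x = 0"
  shows "\<exists>d\<in>X. \<forall>x\<in>X. B d x = \<phi> x"
  using assms(1,4)
proof (induction "dim X" arbitrary: X rule: less_induct)
  case less
  show ?case
  proof (cases "\<exists>c\<in>X. B c c \<noteq> 0")
    case True
    then obtain c where c: "c \<in> X" "B c c \<noteq> 0" by blast
    let ?Y = "{x \<in> X. B c x = 0}"
    have sY: "subspace ?Y" by (rule subspace_perp[OF less.prems(1)])
    have p: "x - (B c x / B c c) *s c \<in> ?Y" if "x \<in> X" for x
      using that c less.prems(1) by (auto simp: B_linear subspace_diff subspace_scale)
    have "?Y \<subset> X" using c by auto
    then have "dim ?Y < dim X" by (intro dim_less sY less.prems(1))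
    moreover have "\<phi> x = 0" if x: "x \<in> ?Y" "\<And>y. y \<in> ?Y \<Longrightarrow> B x y = 0" for x
    proof (rule less.prems(2))
      fix y assume "y \<in> X"
      then show "B x y = 0" using x(2)[OF p[of y]] x(1) by (simp add: B_linear B_sym[of x c])
    qed (use x in auto)
    ultimately obtain d where d: "d \<in> ?Y" "\<And>x. x \<in> ?Y \<Longrightarrow> B d x = \<phi> x"
      using less.hyps[OF _ sY] by blast
    define e where "e = d + (\<phi> c / B c c) *s c"
    have "e \<in> X" using c d less.prems(1) by (auto simp: e_def subspace_add subspace_scale)
    moreover have "B e x = \<phi> x" if "x \<in> X" for x
    proof -
      have "\<phi> x = \<phi> (x - (B c x / B c c) *s c) + \<phi> ((B c x / B c c) *s c)"
        by (simp flip: assms(2))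
      also have "\<dots> = B d (x - (B c x / B c c) *s c) + (B c x / B c c) * \<phi> c"
        using d(2)[OF p[OF that]] by (simp add: assms(3))
      also have "\<dots> = B e x" using c d(1) B_sym[of d c] by (simp add: e_def B_linear)
      finally show ?thesis by simp
    qed
    ultimately show ?thesis by blast
  next
    case False
    then have "B x y = 0" if "x \<in> X" "y \<in> X" for x y
      using isotropic_imp_zero[of X] less.prems(1) that by blast
    then show ?thesis using less.prems subspace_0 by (intro bexI[of _ 0]) auto
  qed
qed

section \<open>Central isotropic vectors from solvability\<close>

lemma bracket_mem_derived_series:
  assumes "x \<in> derived_series n" "y \<in> derived_series n"
  shows "bracket x y \<in> derived_series (Suc n)"
  using assms by (auto intro!: span_base)

lemma subspace_derived_series: "subspace (derived_series n)"
  by (cases n) (auto simp: subspace_UNIV)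

text \<open>
  A subalgebra \<open>K\<close> whose radical \<open>N\<close> lies in the kernel of the restricted three-form gives the
  quadratic Lie algebra \<open>K / N\<close>.  Unless it is abelian, its center meets its derived algebra:
  otherwise the derived algebra would be perfect.
\<close>

lemma central_isotropic_exists:
  assumes "solvable" and sK: "subspace K"
    and brK: "\<And>x y. x \<in> K \<Longrightarrow> y \<in> K \<Longrightarrow> bracket x y \<in> K"
    and rad: "\<And>r x y. r \<in> K \<Longrightarrow> (\<And>k. k \<in> K \<Longrightarrow> B r k = 0) \<Longrightarrow> x \<in> K \<Longrightarrow> y \<in> K \<Longrightarrow> \<omega> r x y = 0"
    and nz: "\<exists>x\<in>K. \<exists>y\<in>K. \<exists>w\<in>K. \<omega> x y w \<noteq> 0"
  obtains y k where "y \<in> K" "k \<in> K" "B y k \<noteq> 0" "B y y = 0" "\<And>a b. a \<in> K \<Longrightarrow> b \<in> K \<Longrightarrow> \<omega> y a b = 0"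
proof -
  define N where "N = {r \<in> K. \<forall>k\<in>K. B r k = 0}"
  define D where "D = span {bracket x y | x y. x \<in> K \<and> y \<in> K}"
  have sN: "subspace N" using sK by (auto simp: N_def subspace_def B_linear)
  have DK: "D \<subseteq> K" unfolding D_def using brK sK by (intro span_minimal) auto
  have sD: "subspace D" by (simp add: D_def)
  have D_perp: "\<omega> a b x = 0" if x: "\<And>d. d \<in> D \<Longrightarrow> B d x = 0" and "a \<in> K" "b \<in> K" for a b x
    unfolding \<omega>_def by (rule x) (use that in \<open>auto simp: D_def intro!: span_base\<close>)
  have NK: "bracket r k \<in> N" if "r \<in> N" "k \<in> K" for r k
    using that brK rad unfolding N_def \<omega>_def by (auto)
  have KN: "bracket k r \<in> N" if "r \<in> N" "k \<in> K" for r k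
    using NK[OF that] bracket_swap[of k r] sN by (simp add: subspace_neg)
  show ?thesis
  proof (rule ccontr)
    assume "\<not> thesis"
    then have no: "\<And>y k. y \<in> K \<Longrightarrow> (\<And>a b. a \<in> K \<Longrightarrow> b \<in> K \<Longrightarrow> \<omega> y a b = 0) \<Longrightarrow> B y y = 0 \<Longrightarrow> k \<in> K
      \<Longrightarrow> B y k = 0" using that by metis
    \<comment> \<open>A vector of D orthogonal to D is central by \<open>D_perp\<close> and
      isotropic because it lies in D itself, so \<open>no\<close> puts it into N. Thus
      \<open>B\<close> is nondegenerate on D modulo N.\<close>
    have CD: "c \<in> N" if "c \<in> D" "\<And>d. d \<in> D \<Longrightarrow> B d c = 0" for c
    proof -
      have "\<omega> c a b = 0" if ab: "a \<in> K" "b \<in> K" for a b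
        using D_perp[of c a b] ab that \<omega>_rot[of a b c] \<open>\<And>d. d \<in> D \<Longrightarrow> B d c = 0\<close> by simp
      then show ?thesis using no[of c] that DK by (auto simp: N_def)
    qed
    \<comment> \<open>Hence each k in K differs from some d in D by a vector orthogonal to D, that
      is, central modulo N.\<close>
    have split: "\<exists>d\<in>D. \<forall>e\<in>D. B d e = B k e" if "k \<in> K" for k
    proof (rule represent_functional[OF sD])
      fix x assume "x \<in> D" "\<And>y. y \<in> D \<Longrightarrow> B x y = 0"
      then have "x \<in> N" using CD[of x] B_sym by metis
      then show "B k x = 0" using that B_sym[of k x] by (simp add: N_def)
    qed (auto simp: B_linear)
    \<comment> \<open>Brackets of K are therefore brackets of D modulo N, so a bound of D by X + N
      improves to one by brackets of X plus N. Iterated along the derived series this puts D into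
      N.\<close>
    have step: "D \<subseteq> {d + r | d r. d \<in> X' \<and> r \<in> N}"
      if X: "D \<subseteq> {d + r | d r. d \<in> X \<and> r \<in> N}" and sX': "subspace X'"
        and XX': "\<And>x y. x \<in> X \<Longrightarrow> y \<in> X \<Longrightarrow> bracket x y \<in> X'" for X X'
      unfolding D_def
    proof (rule span_minimal)
      show "subspace {d + r | d r. d \<in> X' \<and> r \<in> N}" by (rule subspace_sums[OF sX' sN])
      have DD: "bracket d e \<in> {d + r | d r. d \<in> X' \<and> r \<in> N}" if de: "d \<in> D" "e \<in> D" for d e
      proof -
        obtain x r where x: "d = x + r" "x \<in> X" "r \<in> N" using X de by blast
        obtain y q where y: "e = y + q" "y \<in> X" "q \<in> N" using X de by blast
        have NinK: "n \<in> K" if "n \<in> N" for n using that by (simp add: N_def)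
        have "x = d - r" using x by simp
        moreover have "d - r \<in> K" using de DK NinK[OF x(3)] sK by (intro subspace_diff) auto
        ultimately have xK: "x \<in> K" by simp
        have "bracket d e = bracket x y + (bracket x q + bracket r e)"
          by (simp add: x(1) y(1) bracket_add_left bracket_add_right algebra_simps)
        moreover have "bracket x q + bracket r e \<in> N"
          using KN[OF y(3) xK] NK[OF x(3)] de DK sN by (auto intro: subspace_add)
        moreover have "bracket x y \<in> X'" by (rule XX'[OF x(2) y(2)])
        ultimately show ?thesis by (intro CollectI exI conjI)
      qed
      show "{bracket x y | x y. x \<in> K \<and> y \<in> K} \<subseteq> {d + r | d r. d \<in> X' \<and> r \<in> N}"
      proof safe
        fix x y assume xy: "x \<in> K" "y \<in> K"
        obtain d where d: "d \<in> D" "\<And>e. e \<in> D \<Longrightarrow> B d e = B x e" using split[OF xy(1)] by blast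
        obtain d' where d': "d' \<in> D" "\<And>e. e \<in> D \<Longrightarrow> B d' e = B y e" using split[OF xy(2)] by blast
        have c0: "bracket c k \<in> N" if "c \<in> K" "k \<in> K" and c: "\<And>e. e \<in> D \<Longrightarrow> B e c = 0" for c k
        proof -
          have "\<omega> c k b = 0" if "b \<in> K" for b
            using D_perp[OF c, of k b] that \<open>k \<in> K\<close> \<omega>_rot[of k b c] by simp
          then show ?thesis using that brK by (auto simp: N_def \<omega>_def)
        qed
        have 1: "bracket (x - d) y \<in> N"
        proof (rule c0)
          show "x - d \<in> K" using xy(1) d(1) DK sK by (auto intro: subspace_diff)
          show "B e (x - d) = 0" if "e \<in> D" for e
            using d(2)[OF that] B_sym[of e d] B_sym[of e x] by (simp add: B_diff_right)
        qed (rule xy(2))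
        have 2: "bracket (y - d') d \<in> N"
        proof (rule c0)
          show "y - d' \<in> K" using xy(2) d'(1) DK sK by (auto intro: subspace_diff)
          show "B e (y - d') = 0" if "e \<in> D" for e
            using d'(2)[OF that] B_sym[of e d'] B_sym[of e y] by (simp add: B_diff_right)
          show "d \<in> K" using d(1) DK by blast
        qed
        have "bracket (x - d) y = bracket x y - bracket d y"
          using bracket_add_left[of "x - d" d y] by (simp add: algebra_simps)
        moreover have "bracket d y = bracket d (y - d') + bracket d d'"
          using bracket_add_right[of d "y - d'" d'] by simp
        moreover have "bracket d (y - d') = - bracket (y - d') d" by (rule bracket_swap)
        ultimately have eq: "bracket x y = bracket d d' + (bracket (x - d) y - bracket (y - d') d)"
          by (simp add: algebra_simps)
        obtain u r where ur: "bracket d d' = u + r" "u \<in> X'" "r \<in> N" using DD[OF d(1) d'(1)] by blast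
        have "bracket x y = u + (r + (bracket (x - d) y - bracket (y - d') d))"
          using eq ur(1) by (simp add: algebra_simps)
        moreover have "r + (bracket (x - d) y - bracket (y - d') d) \<in> N"
          using 1 2 ur(3) sN by (auto intro: subspace_add subspace_diff)
        ultimately show "\<exists>d r. bracket x y = d + r \<and> d \<in> X' \<and> r \<in> N"
          using ur(2) by (intro exI conjI)
      qed
    qed
    have all: "D \<subseteq> {d + r | d r. d \<in> derived_series n \<and> r \<in> N}" for n
    proof (induction n)
      case 0
      show ?case
      proof
        fix d assume "d \<in> D"
        show "d \<in> {d + r | d r. d \<in> derived_series 0 \<and> r \<in> N}"
          by (intro CollectI exI[of _ d] exI[of _ 0]) (simp add: subspace_0[OF sN])
      qed
    next
      case (Suc n)
      show ?case
        by (rule step[OF Suc subspace_derived_series]) (rule bracket_mem_derived_series)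
    qed
    obtain n where "derived_series n = {0}" using assms(1) unfolding solvable_def by blast
    then have "D \<subseteq> {d + r | d r. d \<in> {0} \<and> r \<in> N}" using all[of n] by simp
    then have "D \<subseteq> N" by auto
    then have "\<omega> x y w = 0" if "x \<in> K" "y \<in> K" "w \<in> K" for x y w
    proof -
      have "bracket x y \<in> D" unfolding D_def by (rule span_base) (use that in blast)
      then show ?thesis using \<open>D \<subseteq> N\<close> that(3) by (auto simp: N_def \<omega>_def)
    qed
    then show False using nz by blast
  qed
qed

lemma B_bracket: "B v (bracket a b) = \<omega> a b v"
  unfolding \<omega>_def by (rule B_sym)

lemma \<omega>_vanish_rot:
  assumes "\<And>a b. P a \<Longrightarrow> P b \<Longrightarrow> \<omega> y a b = 0" "P a" "P b"
  shows "\<omega> y a b = 0" "\<omega> a y b = 0" "\<omega> a b y = 0"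
proof -
  show "\<omega> y a b = 0" by (rule assms(1)[OF assms(2,3)])
  show "\<omega> a b y = 0" using assms(1)[OF assms(2,3)] \<omega>_rot[of a b y] by simp
  show "\<omega> a y b = 0" using assms(1)[OF assms(3,2)] \<omega>_rot[of a y b] \<omega>_rot[of y b a] by simp
qed

text \<open>
  In the quotient of \<open>z\<^sup>\<perp>\<close> by \<open>z\<close>, of dimension at most six, the central vector \<open>y1\<close> may leave a
  nonabelian quotient \<open>y1\<^sup>\<perp> / y1\<close>; this is then four-dimensional with three-form
  \<open>c * (y2 \<and> p \<and> q)\<close>.  Invariance of this form under the action of \<open>s\<close> makes \<open>y2\<close> central too,
  and a combination of \<open>y1\<close> and \<open>y2\<close> divides the form.
\<close>

lemma dividing_vector_exists:
  assumes solv: "solvable"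
    and fz: "\<And>a b. \<omega> z a b = 0" and zz: "B z z = 0" and zt: "B z t = 1" and tt: "B t t = 0"
    and rkH: "rank_le 6 {x. B z x = 0 \<and> B t x = 0}"
    and nz: "\<exists>a b c. B z a = 0 \<and> B z b = 0 \<and> B z c = 0 \<and> \<omega> a b c \<noteq> 0"
  shows "\<exists>y. B z y = 0 \<and> B t y = 0 \<and> y \<notin> radical \<and> B y y = 0 \<and>
    (\<forall>a b. B z a = 0 \<longrightarrow> B z b = 0 \<longrightarrow> \<omega> y a b = 0) \<and>
    (\<forall>a b c. B z a = 0 \<longrightarrow> B z b = 0 \<longrightarrow> B z c = 0 \<longrightarrow> B y a = 0 \<longrightarrow> B y b = 0 \<longrightarrow> B y c = 0 \<longrightarrow>
      \<omega> a b c = 0)"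
proof -
  let ?H = "{x. B z x = 0 \<and> B t x = 0}"
  have tz: "B t z = 1" using zt B_sym by metis
  have fz: "\<omega> z a b = 0" "\<omega> a z b = 0" "\<omega> a b z = 0" for a b
    by (rule \<omega>_vanish_rot[where P = "\<lambda>_. True", OF fz TrueI TrueI])+
  let ?K1 = "{x. B z x = 0}"
  have sub: "subspace ?K1" using subspace_perp[OF subspace_UNIV] by simp
  have br: "bracket x y \<in> ?K1" for x y by (simp add: B_bracket fz)
  have nz': "\<exists>x\<in>?K1. \<exists>y\<in>?K1. \<exists>w\<in>?K1. \<omega> x y w \<noteq> 0" using nz by auto
  \<comment> \<open>The radical of the complement of z is spanned by z and \<open>radical\<close>,
    and \<omega> vanishes on both.\<close>
  have rad: "\<omega> r x y = 0" if r: "r \<in> ?K1" "\<And>k. k \<in> ?K1 \<Longrightarrow> B r k = 0" for r x y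
  proof -
    define r' where "r' = r - B t r *s z"
    have "B r' w = 0" for w
      using r(1) r(2)[of "w - B z w *s t"] zz zt B_sym[of r t] by (simp add: r'_def B_linear algebra_simps)
    then have "\<omega> r' x y = 0" using \<omega>_radical(1) radical_iff by blast
    then show "\<omega> r x y = 0" by (simp add: r'_def \<omega>_linear fz)
  qed
  obtain y0 k where y0': "y0 \<in> ?K1" "k \<in> ?K1" "B y0 k \<noteq> 0" "B y0 y0 = 0"
    "\<And>a b. a \<in> ?K1 \<Longrightarrow> b \<in> ?K1 \<Longrightarrow> \<omega> y0 a b = 0"
  proof (rule central_isotropic_exists[OF solv sub br rad nz'])
    fix y k assume "y \<in> ?K1" "k \<in> ?K1" "B y k \<noteq> 0" "B y y = 0"
      "\<And>a b. a \<in> ?K1 \<Longrightarrow> b \<in> ?K1 \<Longrightarrow> \<omega> y a b = 0"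
    then show thesis by (rule that)
  qed
  note y0 = y0'[unfolded mem_Collect_eq]
  \<comment> \<open>Dropping the z-component moves \<open>y0\<close> into \<open>?H\<close>; neither
    its products with \<open>?K1\<close> nor its values under \<omega> change.\<close>
  define y1 where "y1 = y0 - B t y0 *s z"
  have y1: "B z y1 = 0" "B y1 z = 0" "B t y1 = 0" "B y1 t = 0" "B y1 y1 = 0" "B y1 k \<noteq> 0"
    using y0(1-4) tz zt zz B_sym[of y0 z] B_sym[of y0 t] by (simp_all add: y1_def B_linear)
  have fy1: "\<omega> y1 a b = 0" "\<omega> a y1 b = 0" "\<omega> a b y1 = 0" if "B z a = 0" "B z b = 0" for a b
    using \<omega>_vanish_rot[where P = "\<lambda>a. B z a = 0" and y = y1, OF _ that] y0(5)
    by (simp_all add: y1_def \<omega>_linear fz)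
  have y1R: "y1 \<notin> radical" using y1(6) B_radical by blast
  have ndH: "nondegenerate ?H" using rkH by (simp add: rank_le_def)
  have y1H: "y1 \<in> ?H" using y1 by simp
  obtain s where s: "s \<in> ?H" "B y1 s = 1" "B s s = 0"
    by (rule dual_exists[OF ndH y1H y1R y1(5)])
  have s': "B z s = 0" "B s z = 0" "B t s = 0" "B s t = 0" "B s y1 = 1"
    using s B_sym[of s z] B_sym[of s t] B_sym[of s y1] by simp_all
  let ?H2 = "{x \<in> ?H. B y1 x = 0 \<and> B s x = 0}"
  have "rank_le (Suc (Suc 4)) ?H" using rkH by (simp add: eval_nat_numeral)
  then have rkH2: "rank_le 4 ?H2" using rank_le_perp2[of 4 ?H y1 s] y1 s by simp
  have dec1: "x - B z x *s t - B t x *s z - B y1 x *s s - B s x *s y1 \<in> ?H2" for x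
    using zz zt tt tz y1 s s' by (simp add: B_linear)
  show ?thesis
  proof (cases "\<exists>a b c. B z a = 0 \<and> B z b = 0 \<and> B z c = 0 \<and> B y1 a = 0 \<and> B y1 b = 0 \<and> B y1 c = 0 \<and> \<omega> a b c \<noteq> 0")
    case False
    then show ?thesis using y1 y1R fy1 by (intro exI[of _ y1]) blast
  next
    case nz2: True
    let ?K2 = "{x. B z x = 0 \<and> B y1 x = 0}"
    have sub2: "subspace ?K2" by (auto simp: subspace_def B_linear)
    have br2: "bracket x y \<in> ?K2" if "x \<in> ?K2" "y \<in> ?K2" for x y using that by (simp add: B_bracket fz fy1)
    have nz2': "\<exists>x\<in>?K2. \<exists>y\<in>?K2. \<exists>w\<in>?K2. \<omega> x y w \<noteq> 0" using nz2 by auto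
    have rad2: "\<omega> r x y = 0"
      if r: "r \<in> ?K2" "\<And>k. k \<in> ?K2 \<Longrightarrow> B r k = 0" and xy: "x \<in> ?K2" "y \<in> ?K2" for r x y
    proof -
      define r' where "r' = r - B t r *s z - B s r *s y1"
      have "B r' w = 0" for w
        using r(1) r(2)[of "w - B z w *s t - B t w *s z - B y1 w *s s - B s w *s y1"]
          dec1[of w] zz zt y1 s s' B_sym[of r t] B_sym[of r s] B_sym[of r z] B_sym[of r y1]
        by (simp add: r'_def B_linear algebra_simps)
      then have "\<omega> r' x y = 0" using \<omega>_radical(1) radical_iff by blast
      then show "\<omega> r x y = 0" using xy by (simp add: r'_def \<omega>_linear fz fy1)
    qed
    obtain y3 k2 where y3': "y3 \<in> ?K2" "k2 \<in> ?K2" "B y3 k2 \<noteq> 0" "B y3 y3 = 0"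
      "\<And>a b. a \<in> ?K2 \<Longrightarrow> b \<in> ?K2 \<Longrightarrow> \<omega> y3 a b = 0"
    proof (rule central_isotropic_exists[OF solv sub2 br2 rad2 nz2'])
      fix y k assume "y \<in> ?K2" "k \<in> ?K2" "B y k \<noteq> 0" "B y y = 0"
        "\<And>a b. a \<in> ?K2 \<Longrightarrow> b \<in> ?K2 \<Longrightarrow> \<omega> y a b = 0"
      then show thesis by (rule that)
    qed
    note y3 = y3'[unfolded mem_Collect_eq]
    define y2 where "y2 = y3 - B t y3 *s z - B s y3 *s y1"
    have y2: "B z y2 = 0" "B t y2 = 0" "B y1 y2 = 0" "B s y2 = 0" "B y2 y2 = 0" "B y2 k2 \<noteq> 0"
      using y3(1-4) tz zt zz y1 s s' B_sym[of y3 z] B_sym[of y3 y1] by (simp_all add: y2_def B_linear)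
    have fy2: "\<omega> y2 a b = 0" "\<omega> a y2 b = 0" "\<omega> a b y2 = 0"
      if "B z a = 0" "B z b = 0" "B y1 a = 0" "B y1 b = 0" for a b
      using \<omega>_vanish_rot[where P = "\<lambda>a. B z a = 0 \<and> B y1 a = 0" and y = y2 and a = a and b = b] y3(5) that
      by (simp_all add: y2_def \<omega>_linear fz fy1)
    have y2R: "y2 \<notin> radical" using y2(6) B_radical by blast
    have ndH2: "nondegenerate ?H2" using rkH2 by (simp add: rank_le_def)
    have y2H: "y2 \<in> ?H2" using y2 by simp
    obtain s2 where s2: "s2 \<in> ?H2" "B y2 s2 = 1" "B s2 s2 = 0"
      by (rule dual_exists[OF ndH2 y2H y2R y2(5)])
    \<comment> \<open>Rank at most two remains; p and q will be an orthogonal basis modulo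
      \<open>radical\<close>, possibly with zero vectors.\<close>
    let ?P = "{x \<in> ?H2. B y2 x = 0 \<and> B s2 x = 0}"
    have "rank_le (Suc (Suc 2)) ?H2" using rkH2 by (simp add: eval_nat_numeral)
    then have "rank_le 2 ?P" using rank_le_perp2[of 2 ?H2 y2 s2] y2H y2 s2 by simp
    then have "rank_le (Suc 1) ?P" by (simp add: eval_nat_numeral)
    then obtain p where p: "p \<in> ?P" "rank_le 1 {x \<in> ?P. B p x = 0}"
      "\<And>x. x \<in> ?P \<Longrightarrow> x - (B p x / B p p) *s p \<in> {x \<in> ?P. B p x = 0}" using rank_le_Suc by blast
    have "rank_le (Suc 0) {x \<in> ?P. B p x = 0}" using p(2) by simp
    then obtain q where q: "q \<in> {x \<in> ?P. B p x = 0}" "rank_le 0 {x \<in> {x \<in> ?P. B p x = 0}. B q x = 0}"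
      "\<And>x. x \<in> {x \<in> ?P. B p x = 0} \<Longrightarrow> x - (B q x / B q q) *s q \<in> {x \<in> {x \<in> ?P. B p x = 0}. B q x = 0}"
      using rank_le_Suc by blast
    have Bv: "B z z = 0" "B z t = 1" "B z y1 = 0" "B z s = 0" "B z y2 = 0" "B z s2 = 0" "B z p = 0" "B z q = 0"
      "B t z = 1" "B t t = 0" "B t y1 = 0" "B t s = 0" "B t y2 = 0" "B t s2 = 0" "B t p = 0" "B t q = 0"
      "B y1 z = 0" "B y1 t = 0" "B y1 y1 = 0" "B y1 s = 1" "B y1 y2 = 0" "B y1 s2 = 0" "B y1 p = 0" "B y1 q = 0"
      "B s z = 0" "B s t = 0" "B s y1 = 1" "B s s = 0" "B s y2 = 0" "B s s2 = 0" "B s p = 0" "B s q = 0"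
      "B y2 z = 0" "B y2 t = 0" "B y2 y1 = 0" "B y2 s = 0" "B y2 y2 = 0" "B y2 s2 = 1" "B y2 p = 0" "B y2 q = 0"
      "B s2 z = 0" "B s2 t = 0" "B s2 y1 = 0" "B s2 s = 0" "B s2 y2 = 1" "B s2 s2 = 0" "B s2 p = 0" "B s2 q = 0"
      "B p q = 0" "B q p = 0"
      using zz zt tt tz y1 s s' y2 s2 p(1) q(1) B_sym[of y2 z] B_sym[of y2 t] B_sym[of y2 y1] B_sym[of y2 s] B_sym[of s2 z] B_sym[of s2 t] B_sym[of s2 y1] B_sym[of s2 s] B_sym[of s2 y2] B_sym[of q p] by auto
    have BB: "B p z = 0" "B p t = 0" "B p y1 = 0" "B p s = 0" "B p y2 = 0" "B p s2 = 0" "B q z = 0" "B q t = 0" "B q y1 = 0" "B q s = 0" "B q y2 = 0" "B q s2 = 0"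
      using p(1) q(1) B_sym[of p z] B_sym[of p t] B_sym[of p y1] B_sym[of p s] B_sym[of p y2] B_sym[of p s2] B_sym[of q z] B_sym[of q t] B_sym[of q y1] B_sym[of q s] B_sym[of q y2] B_sym[of q s2] by auto
    have dec: "x - B z x *s t - B t x *s z - B y1 x *s s - B s x *s y1 - B y2 x *s s2 - B s2 x *s y2
        - (B p x / B p p) *s p - (B q x / B q q) *s q \<in> radical" for x
    proof -
      let ?x2 = "x - B z x *s t - B t x *s z - B y1 x *s s - B s x *s y1"
      let ?x3 = "?x2 - B y2 x *s s2 - B s2 x *s y2"
      have "?x3 \<in> ?P" by (simp add: B_linear Bv)
      then have "?x3 - (B p x / B p p) *s p \<in> {x \<in> ?P. B p x = 0}"
        using p(3)[of ?x3] p(1) Bv BB by (simp add: B_linear)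
      from q(3)[OF this]
      have "?x3 - (B p x / B p p) *s p - (B q x / B q q) *s q \<in> {x \<in> {x \<in> ?P. B p x = 0}. B q x = 0}"
        using q(1) Bv BB by (simp add: B_linear)
      then show ?thesis using rank_le_0[OF q(2)] by blast
    qed
    have ex: "\<omega> a b x = B z x * \<omega> a b t + B y1 x * \<omega> a b s + B s x * \<omega> a b y1 + B y2 x * \<omega> a b s2 + B s2 x * \<omega> a b y2
        + B p x / B p p * \<omega> a b p + B q x / B q q * \<omega> a b q" for a b x
      using \<omega>_radical(3)[OF dec[of x], of a b] by (simp add: \<omega>_linear fz algebra_simps)
    define c where "c = \<omega> s2 p q"
    have fc: "\<omega> s2 p q = c" "\<omega> p q s2 = c" "\<omega> q s2 p = c" "\<omega> p s2 q = - c" "\<omega> q p s2 = - c" "\<omega> s2 q p = - c"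
      using \<omega>_rot[of p q s2] \<omega>_rot[of q s2 p] \<omega>_swap12[of p s2 q] \<omega>_swap12[of q p s2] \<omega>_swap23[of s2 q p]
      by (simp_all add: c_def)
    have e: "\<omega> a b x = B y2 x * \<omega> a b s2 + B p x / B p p * \<omega> a b p + B q x / B q q * \<omega> a b q"
      if "B z a = 0" "B z b = 0" "B z x = 0" "B y1 a = 0" "B y1 b = 0" "B y1 x = 0" for a b x
      using ex[of a b x] that by (simp add: fy1 fy2)
    \<comment> \<open>On \<open>?K2\<close> the components along t and s vanish, and those along z,
      \<open>y1\<close> and \<open>y2\<close> contribute nothing to \<omega>. Only the functionals
      of \<open>y2\<close>, p and q survive, and three of them leave a single coefficient.\<close>
    have fK2: "\<omega> a b x = c * (B y2 a * (B p b * B q x - B p x * B q b) - B y2 b * (B p a * B q x - B p x * B q a)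
        + B y2 x * (B p a * B q b - B p b * B q a)) / (B p p * B q q)"
      if "B z a = 0" "B z b = 0" "B z x = 0" "B y1 a = 0" "B y1 b = 0" "B y1 x = 0" for a b x
    proof -
      have e2: "\<omega> a b v = B y2 b * \<omega> v a s2 + B p b / B p p * \<omega> v a p + B q b / B q q * \<omega> v a q"
        if "B z v = 0" "B y1 v = 0" for v using e[of v a b] \<omega>_rot[of a b v] that \<open>B z a = 0\<close> \<open>B z b = 0\<close>
          \<open>B y1 a = 0\<close> \<open>B y1 b = 0\<close> by simp
      have e3: "\<omega> v a w = B y2 a * \<omega> w v s2 + B p a / B p p * \<omega> w v p + B q a / B q q * \<omega> w v q"
        if "B z v = 0" "B y1 v = 0" "B z w = 0" "B y1 w = 0" for v w
        using e[of w v a] \<omega>_rot[of v a w] that \<open>B z a = 0\<close> \<open>B y1 a = 0\<close> by simp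
      show ?thesis using that Bv
        by (simp add: e[of a b x] e2[of s2] e2[of p] e2[of q] e3[of s2] e3[of p] e3[of q] fc)
          (cases "B p p = 0"; cases "B q q = 0"; simp add: field_simps)
    qed
    have c0: "c \<noteq> 0" using nz2 fK2 by auto
    \<comment> \<open>Division by zero yields 0, so by \<open>fK2\<close> an isotropic p or q would
      make c vanish.\<close>
    have pp: "B p p \<noteq> 0" "B q q \<noteq> 0"
    proof -
      have "\<omega> p q s2 = 0" if "B p p = 0 \<or> B q q = 0" using fK2[of p q s2] that Bv by auto
      then show "B p p \<noteq> 0" "B q q \<noteq> 0" using fc c0 by auto
    qed
    have der: "\<omega> (bracket s a) b x + \<omega> a (bracket s b) x + \<omega> a b (bracket s x) = 0" for a b x
      by (rule \<omega>_derivation)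
    have exs: "\<omega> a b (bracket s v) = \<omega> s v y1 * \<omega> a b s + \<omega> s v s * \<omega> a b y1 + \<omega> s v y2 * \<omega> a b s2 + \<omega> s v s2 * \<omega> a b y2
        + \<omega> s v p / B p p * \<omega> a b p + \<omega> s v q / B q q * \<omega> a b q" for a b v
      using ex[of a b "bracket s v"] by (simp add: B_bracket fz)
    have der': "\<omega> b x (bracket s a) + \<omega> x a (bracket s b) + \<omega> a b (bracket s x) = 0" for a b x
      using der[of a b x] \<omega>_rot[of b x "bracket s a"] \<omega>_rot[of x a "bracket s b"] \<omega>_rot[of "bracket s b" x a] 
      by simp
    \<comment> \<open>The action of s is skew, so its diagonal entries at p and q drop out of
      \<open>der'\<close> and the coefficient of \<open>y2\<close> along itself must vanish. The
      triples containing \<open>y2\<close> kill its components along p and q.\<close>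
    have sy2: "\<omega> y2 s s2 = 0" "\<omega> y2 s p = 0" "\<omega> y2 s q = 0"
    proof -
      have "\<omega> s s2 y2 = 0"
        using der'[of s2 p q] Bv c0 pp by (simp add: exs fy1 fy2 fc)
      then show "\<omega> y2 s s2 = 0" using \<omega>_rot[of s s2 y2] by simp
      have "\<omega> s y2 p = 0"
        using der'[of s2 q y2] Bv c0 pp by (simp add: exs fy1 fy2 fc)
      then show "\<omega> y2 s p = 0" using \<omega>_swap12[of y2 s p] by simp
      have "\<omega> s y2 q = 0"
        using der'[of s2 p y2] Bv c0 pp by (simp add: exs fy1 fy2 fc)
      then show "\<omega> y2 s q = 0" using \<omega>_swap12[of y2 s q] by simp
    qed
    have fy2': "\<omega> y2 a b = 0" if "B z a = 0" "B z b = 0" for a b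
    proof -
      have 1: "\<omega> y2 v a = B y1 a * \<omega> y2 v s"
        if "B z v = 0" "B y1 v = 0" for v using ex[of y2 v a] that \<open>B z a = 0\<close> Bv by (simp add: fy1 fy2)
      have 2: "\<omega> y2 s a = 0" if "B z a = 0" for a
        using ex[of y2 s a] that Bv sy2 by (simp add: fy1)
      have 3: "\<omega> y2 a v = 0" if "B z v = 0" "B y1 v = 0" for v
        using 1[OF that] 2[of v] that \<omega>_swap23[of y2 a v] \<omega>_swap23[of y2 v s] by simp
      have 4: "\<omega> y2 a s = 0" using 2[of a] \<open>B z a = 0\<close> \<omega>_swap23[of y2 a s] by simp
      show ?thesis using ex[of y2 a b] 3 4 that Bv by (simp add: fy1)
    qed
    have fy2: "\<omega> y2 a b = 0" "\<omega> a y2 b = 0" "\<omega> a b y2 = 0" if "B z a = 0" "B z b = 0" for a b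
      using fy2'[OF that] fy2'[OF that(2,1)] \<omega>_rot[of a b y2] \<omega>_rot[of a y2 b] \<omega>_rot[of b a y2] by simp_all
    \<comment> \<open>The ratio of the coefficients of \<open>y1\<close> ^ p ^ q and
      \<open>y2\<close> ^ p ^ q. Every other term on the complement of z contains \<open>y1\<close>
      ^ \<open>y2\<close>, which vanishes on the kernel of \<open>B y'\<close>.\<close>
    define \<kappa> where "\<kappa> = \<omega> s p q / c"
    define y' where "y' = y2 + \<kappa> *s y1"
    have By': "B y' x = B y2 x + \<kappa> * B y1 x" for x by (simp add: y'_def B_linear)
    have "\<omega> a b x = 0" if K: "B z a = 0" "B z b = 0" "B z x = 0" "B y' a = 0" "B y' b = 0" "B y' x = 0" for a b x
    proof -
      \<comment> \<open>Replaces s by a vector in the kernel of \<open>B y'\<close>.\<close>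
      define s3 where "s3 = s - \<kappa> *s s2"
      have s3: "\<omega> s3 p q = 0" "\<omega> p q s3 = 0" "\<omega> q s3 p = 0" "\<omega> p s3 q = 0" "\<omega> q p s3 = 0" "\<omega> s3 q p = 0" 
      proof -
        show *: "\<omega> s3 p q = 0" using c0 by (simp add: s3_def \<omega>_linear \<kappa>_def fc)
        show "\<omega> p q s3 = 0" "\<omega> q s3 p = 0" "\<omega> p s3 q = 0" "\<omega> q p s3 = 0" "\<omega> s3 q p = 0"
          using * \<omega>_rot[of p q s3] \<omega>_rot[of q s3 p] \<omega>_swap12[of p s3 q] \<omega>_swap12[of q p s3] \<omega>_swap23[of s3 q p]
          by simp_all
      qed
      have s3z: "B z s3 = 0" by (simp add: s3_def B_linear Bv)
      have g: "\<omega> a b x = B y1 x * \<omega> a b s3 + B p x / B p p * \<omega> a b p + B q x / B q q * \<omega> a b q"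
        if "B z a = 0" "B z b = 0" "B z x = 0" "B y' x = 0" for a b x
      proof -
        have "B y2 x = - (\<kappa> * B y1 x)"
          using that(4) unfolding By' by (simp only: eq_neg_iff_add_eq_0)
        then show ?thesis
          using ex[of a b x] that(1-3) by (simp add: fy1 fy2 s3_def \<omega>_linear algebra_simps)
      qed
      have g2: "\<omega> a b v = B y1 b * \<omega> v a s3 + B p b / B p p * \<omega> v a p + B q b / B q q * \<omega> v a q"
        if "B z v = 0" for v using g[of v a b] \<omega>_rot[of a b v] that K by simp
      have g3: "\<omega> v a w = B y1 a * \<omega> w v s3 + B p a / B p p * \<omega> w v p + B q a / B q q * \<omega> w v q"
        if "B z v = 0" "B z w = 0" for v w
        using g[of w v a] \<omega>_rot[of v a w] that K by simp
      show ?thesis using K Bv s3z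
        by (simp add: g[of a b x] g2[of s3] g2[of p] g2[of q] g3[of s3] g3[of p] g3[of q] s3)
    qed
    moreover have "y' \<notin> radical"
    proof
      assume "y' \<in> radical"
      then have "B y' s2 = 0" by (rule B_radical)
      then show False unfolding By' using Bv by simp
    qed
    moreover have "B z y' = 0" "B t y' = 0" "B y' y' = 0"
      unfolding By' using Bv by (simp_all add: y'_def B_linear)
    moreover have "\<omega> y' a b = 0" if "B z a = 0" "B z b = 0" for a b
      using fy1(1)[OF that] fy2(1)[OF that] by (simp add: y'_def \<omega>_linear)
    ultimately show ?thesis by blast
  qed
qed

end

section \<open>Two commuting central directions\<close>

lemma (in quadratic_lie_algebra) exact_form_combine:
  "exact_form F \<Longrightarrow> exact_form F' \<Longrightarrow> exact_form (\<lambda>x y w. c * F x y w + d * F' x y w)"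
  by (intro exact_form_add exact_form_scale)

text \<open>The hypotheses are the vanishing 2 by 2 minors of a matrix with two rows. Any nonzero
  entry of the second row, with the entry above it, gives the coefficients of a dependence.\<close>

lemma proportional_triples:
  fixes a b c a' b' c' :: "'f::field"
  assumes "a * b' = b * a'" "a * c' = c * a'" "b * c' = c * b'"
  shows "\<exists>k1 k2. (k1 \<noteq> 0 \<or> k2 \<noteq> 0) \<and> k1 * a + k2 * a' = 0 \<and> k1 * b + k2 * b' = 0 \<and> k1 * c + k2 * c' = 0"
proof -
  have e: "x' * y + - x * y' = 0" "y' * x + - y * x' = 0" if "x * y' = y * x'" for x y x' y' :: 'f
    using that by (simp_all add: mult.commute[of x' y] mult.commute[of y' x])
  note e = e[OF assms(1)] e[OF assms(2)] e[OF assms(3)]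
  have e0: "x' * x + - x * x' = 0" for x x' :: 'f by simp
  consider "a' \<noteq> 0" | "b' \<noteq> 0" | "c' \<noteq> 0" | "a' = 0 \<and> b' = 0 \<and> c' = 0" by blast
  then show ?thesis
  proof cases
    case 1 then show ?thesis using e e0 by blast
  next
    case 2 then show ?thesis using e e0 by blast
  next
    case 3 then show ?thesis using e e0 by blast
  next
    case 4 then show ?thesis by (intro exI[of _ 0] exI[of _ 1]) simp
  qed
qed

text \<open>In the quotient of the complement of z by z, \<open>fy1\<close> makes y central and
  \<open>fU\<close> makes \<open>B y\<close> divide the three-form. The planes of z, t and of y, s
  are hyperbolic and orthogonal to each other.\<close>

locale adapted_frame = quadratic_lie_algebra +
  fixes z t y s
  assumes fz1: "\<omega> z a b = 0"
    and fy1: "B z a = 0 \<Longrightarrow> B z b = 0 \<Longrightarrow> \<omega> y a b = 0"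
    and fU: "B z a = 0 \<Longrightarrow> B z b = 0 \<Longrightarrow> B z c = 0 \<Longrightarrow> B y a = 0 \<Longrightarrow> B y b = 0 \<Longrightarrow> B y c = 0 \<Longrightarrow>
      \<omega> a b c = 0"
    and Bzt: "B z z = 0" "B z t = 1" "B t t = 0" "B y y = 0" "B y s = 1" "B s s = 0"
      "B z y = 0" "B z s = 0" "B t y = 0" "B t s = 0"
    and rkU: "rank_le 4 {x. B z x = 0 \<and> B t x = 0 \<and> B y x = 0 \<and> B s x = 0}"
begin

definition U where "U = {x. B z x = 0 \<and> B t x = 0 \<and> B y x = 0 \<and> B s x = 0}"

definition u where "u x = x - B z x *s t - B t x *s z - B y x *s s - B s x *s y"

lemma Bf: "B z z = 0" "B z t = 1" "B z y = 0" "B z s = 0" "B t z = 1" "B t t = 0" "B t y = 0" "B t s = 0"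
   "B y z = 0" "B y t = 0" "B y y = 0" "B y s = 1" "B s z = 0" "B s t = 0" "B s y = 1" "B s s = 0"
  using Bzt B_sym[of t z] B_sym[of y z] B_sym[of y t] B_sym[of s z] B_sym[of s t] B_sym[of s y] by simp_all

lemma fz: "\<omega> z a b = 0" "\<omega> a z b = 0" "\<omega> a b z = 0"
  using fz1[of a b] fz1[of b a] \<omega>_rot[of a b z] \<omega>_rot[of a z b] \<omega>_rot[of b a z] by simp_all

lemma fy: "\<omega> y a b = 0" "\<omega> a y b = 0" "\<omega> a b y = 0" if "B z a = 0" "B z b = 0"
  using fy1[OF that] fy1[OF that(2,1)] \<omega>_rot[of a b y] \<omega>_rot[of a y b] \<omega>_rot[of b a y] by simp_all

lemma UD: "x \<in> U \<Longrightarrow> B z x = 0" "x \<in> U \<Longrightarrow> B t x = 0" "x \<in> U \<Longrightarrow> B y x = 0" "x \<in> U \<Longrightarrow> B s x = 0"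
  by (simp_all add: U_def)

lemma u_in_U: "u x \<in> U"
  by (simp add: U_def u_def B_linear Bf)

lemma Bu: "B z (u x) = 0" "B t (u x) = 0" "B y (u x) = 0" "B s (u x) = 0"
  using UD[OF u_in_U] by simp_all

lemma u_U: "x \<in> U \<Longrightarrow> u x = x"
  by (simp add: U_def u_def)

lemma u_ts: "u t = 0" "u s = 0"
  by (simp_all add: u_def Bf)

lemma B_u: "v \<in> U \<Longrightarrow> B v (u x) = B v x"
  using B_sym[of v z] B_sym[of v t] B_sym[of v y] B_sym[of v s] UD[of v] by (simp add: u_def B_linear)

lemma dec: "x = B z x *s t + B t x *s z + B y x *s s + B s x *s y + u x"
  by (simp add: u_def)

lemma subspace_U: "subspace U"
  by (auto simp: U_def subspace_def B_linear)

text \<open>Orientation rules for \<open>simp\<close>: values are rewritten so that t or s stands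
  first; the last rule is \<open>fU\<close>.\<close>

lemma \<omega>_norm:
  "\<omega> (u a) t b = - \<omega> t (u a) b" "\<omega> (u a) (u b) t = \<omega> t (u a) (u b)"
  "\<omega> (u a) s t = \<omega> t (u a) s" "\<omega> s (u a) t = \<omega> t s (u a)" "\<omega> s t (u a) = - \<omega> t s (u a)"
  "\<omega> (u a) s (u b) = - \<omega> s (u a) (u b)" "\<omega> (u a) (u b) s = \<omega> s (u a) (u b)"
  "\<omega> t (u a) s = - \<omega> t s (u a)" "\<omega> (u a) (u b) (u c) = 0"
  by (rule \<omega>_swap12 \<omega>_rot fU \<omega>_swap23 Bu)+

end

locale central_frame = adapted_frame +
  assumes fy0: "\<omega> y a b = 0"
begin

lemma fy': "\<omega> y a b = 0" "\<omega> a y b = 0" "\<omega> a b y = 0"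
  using fy0[of a b] fy0[of b a] \<omega>_rot[of a b y] \<omega>_rot[of a y b] \<omega>_rot[of b a y] by simp_all

lemma \<omega>_t: "\<omega> a b t = \<omega> t (u a) (u b) + B y a * \<omega> t s (u b) - B y b * \<omega> t s (u a)"
  using arg_cong2[OF dec[of a] dec[of b], of "\<lambda>a b. \<omega> a b t"]
  by (simp add: \<omega>_linear fz fy' \<omega>_norm algebra_simps)

lemma \<omega>_s: "\<omega> a b s = \<omega> s (u a) (u b) - B z a * \<omega> t s (u b) + B z b * \<omega> t s (u a)"
  using arg_cong2[OF dec[of a] dec[of b], of "\<lambda>a b. \<omega> a b s"]
  by (simp add: \<omega>_linear fz fy' \<omega>_norm algebra_simps)

lemma \<omega>_u: "\<omega> a b (u c) = B z a * \<omega> t (u b) (u c) - B z b * \<omega> t (u a) (u c)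
    + B y a * \<omega> s (u b) (u c) - B y b * \<omega> s (u a) (u c) + (B z a * B y b - B z b * B y a) * \<omega> t s (u c)"
  using arg_cong2[OF dec[of a] dec[of b], of "\<lambda>a b. \<omega> a b (u c)"]
  by (simp add: \<omega>_linear fz fy' \<omega>_norm algebra_simps)

lemma \<omega>_U: "v \<in> U \<Longrightarrow> \<omega> a b v = B z a * \<omega> t (u b) v - B z b * \<omega> t (u a) v
    + B y a * \<omega> s (u b) v - B y b * \<omega> s (u a) v + (B z a * B y b - B z b * B y a) * \<omega> t s v"
  using \<omega>_u[of a b v] by (simp add: u_U)

lemma \<omega>_expand: "\<omega> a b c = B z c * \<omega> a b t + B y c * \<omega> a b s + \<omega> a b (u c)"
  using arg_cong[OF dec[of c], of "\<omega> a b"] by (simp add: \<omega>_linear fz fy')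

lemma \<omega>_ts: "\<omega> t s x = \<omega> t s (u x)"
  using \<omega>_expand[of t s x] by simp

text \<open>As z and y are closed, d(t ^ z) and d(s ^ y) collect all terms of \<omega> containing z
  or y, but both contain z ^ y ^ [t, s], which therefore has to be subtracted once.\<close>

lemma \<omega>_eq: "\<omega> a b c = wedge_coboundary t z a b c + wedge_coboundary s y a b c - wedge3 z y (bracket t s) a b c"
proof -
  have ts: "B (bracket t s) x = \<omega> t s (u x)" for x
    using \<omega>_ts[of x] by (simp add: \<omega>_def)
  have sw: "\<omega> t (u c) (u a) = - \<omega> t (u a) (u c)" "\<omega> s (u c) (u a) = - \<omega> s (u a) (u c)"
    by (rule \<omega>_swap23)+
  show ?thesis
    unfolding \<omega>_expand[of a b c] \<omega>_u[of a b c]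
    by (simp add: wedge_coboundary_def wedge3_def ts fz fy' \<omega>_t \<omega>_s sw) (simp add: algebra_simps)
qed

text \<open>By \<open>\<omega>_eq\<close>, \<omega> is exact as soon as
  \<open>W (bracket t s)\<close> is; the question becomes for which w the form z ^ y ^ w is
  exact.\<close>

definition W where "W w = wedge3 z y w"

text \<open>The coboundary of v in U has a part containing z, given by the action of t, and a part
  containing y, given by that of s. Multiplying by the closed z or y leaves one of them, so
  \<open>W\<close> is exact on the images of U under s and t.\<close>

lemma G_U_z: "v \<in> U \<Longrightarrow> wedge_coboundary v z a b c = - W (bracket s v) a b c"
  and G_U_y: "v \<in> U \<Longrightarrow> wedge_coboundary v y a b c = W (bracket t v) a b c"
proof -
  assume v: "v \<in> U"
  have tv: "B (bracket t v) x = - \<omega> t (u x) v + B y x * \<omega> t v s" for x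
    using \<omega>_swap23[of t v x] \<omega>_U[OF v, of t x] \<omega>_swap23[of t v s] by (simp add: \<omega>_def[symmetric] Bf fz fy' u_ts)
  have sv: "B (bracket s v) x = - \<omega> s (u x) v + B z x * \<omega> t s v" for x
    using \<omega>_swap23[of s v x] \<omega>_U[OF v, of s x] by (simp add: \<omega>_def[symmetric] Bf fz fy' u_ts algebra_simps)
  show "wedge_coboundary v z a b c = - W (bracket s v) a b c"
    by (simp add: wedge_coboundary_def W_def wedge3_def \<omega>_U[OF v, of a b] \<omega>_U[OF v, of b c] \<omega>_U[OF v, of c a] fz fy' sv) (simp add: algebra_simps)
  show "wedge_coboundary v y a b c = W (bracket t v) a b c"
    by (simp add: wedge_coboundary_def W_def wedge3_def \<omega>_U[OF v, of a b] \<omega>_U[OF v, of b c] \<omega>_U[OF v, of c a] fz fy' tv) (simp add: algebra_simps)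
qed

lemma W_linear: "W (v + w) a b c = W v a b c + W w a b c" "W (k *s w) a b c = k * W w a b c"
  "W (v - w) a b c = W v a b c - W w a b c"
  by (simp_all add: W_def wedge3_def B_linear algebra_simps)

lemma exact_W_bracket: "v \<in> U \<Longrightarrow> exact_form (W (bracket t v))" "v \<in> U \<Longrightarrow> exact_form (W (bracket s v))"
proof -
  assume v: "v \<in> U"
  show "exact_form (W (bracket t v))" by (rule exact_form_cong[OF exact_form_G[of v y]]) (simp add: G_U_y[OF v])
  show "exact_form (W (bracket s v))"
    by (rule exact_form_cong[OF exact_form_scale[OF exact_form_G[of v z], of "-1"]]) (simp add: G_U_z[OF v])
qed

lemma exact_W_zy: "exact_form (W z)" "exact_form (W y)" "r \<in> radical \<Longrightarrow> exact_form (W r)"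
  by (rule exact_form_cong[OF exact_form_zero], simp add: W_def wedge3_def algebra_simps B_radical)+

lemma subspace_exact_W: "subspace {w. exact_form (W w)}"
  unfolding subspace_def
proof (intro conjI ballI allI; simp only: mem_Collect_eq)
  show "exact_form (W 0)" by (rule exact_form_cong[OF exact_form_zero]) (simp add: W_def wedge3_def)
  show "exact_form (W (v + w))" if "exact_form (W v)" "exact_form (W w)" for v w
    using exact_form_cong[OF exact_form_add[OF that]] W_linear(1) by blast
  show "exact_form (W (k *s w))" if "exact_form (W w)" for k w
    using exact_form_cong[OF exact_form_scale[OF that]] W_linear(2) by blast
qed

lemma exact_f_if_W: "exact_form (W (bracket t s)) \<Longrightarrow> exact_form \<omega>"
proof -
  assume W: "exact_form (W (bracket t s))"
  show ?thesis
    by (rule exact_form_cong[OF exact_form_combine[OF exact_form_add[OF exact_form_G[of t z] exact_form_G[of s y]] W, of 1 "-1"]])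
      (simp add: \<omega>_eq W_def)
qed

text \<open>A linear relation between the actions of \<open>t\<close> and \<open>s\<close> on \<open>U\<close> yields a closed divisor of \<open>\<omega>\<close>.\<close>

lemma exact_if_dependent:
  assumes k: "k1 \<noteq> 0 \<or> k2 \<noteq> 0"
    and rel: "\<And>x x'. x \<in> U \<Longrightarrow> x' \<in> U \<Longrightarrow> k1 * \<omega> t x x' + k2 * \<omega> s x x' = 0"
  shows "exact_form \<omega>"
proof -
  \<comment> \<open>Orthogonal to \<open>k1 *s t + k2 *s s\<close>, so that on its kernel only this
    combination of the two actions enters \<omega>.\<close>
  let ?z = "k2 *s z - k1 *s y"
  have Bz: "B ?z x = k2 * B z x - k1 * B y x" for x by (simp add: B_linear)
  have "\<exists>t'. B ?z t' \<noteq> 0"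
  proof (cases "k2 = 0")
    case True
    then have "B ?z s \<noteq> 0" unfolding Bz using k by (simp add: Bf)
    then show ?thesis by blast
  next
    case False
    then have "B ?z t \<noteq> 0" unfolding Bz by (simp add: Bf)
    then show ?thesis by blast
  qed
  then obtain t' where t': "B ?z t' \<noteq> 0" by blast
  have r: "\<exists>r. B z x = k1 * r \<and> B y x = k2 * r" if "B ?z x = 0" for x
  proof (cases "k2 = 0")
    case True
    then have "B y x = 0" using that[unfolded Bz] k by simp
    then show ?thesis using k True by (intro exI[of _ "B z x / k1"]) simp
  next
    case False
    then show ?thesis using that[unfolded Bz] by (intro exI[of _ "B y x / k2"]) (simp add: field_simps)
  qed
  show ?thesis
  proof (rule exact_form_divisible_by_closed[OF _ t'])
    show "\<omega> ?z a b = 0" for a b by (simp add: \<omega>_linear fz fy')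
    fix a b c assume K: "B ?z a = 0" "B ?z b = 0" "B ?z c = 0"
    obtain ra where ra: "B z a = k1 * ra" "B y a = k2 * ra" using r[OF K(1)] by blast
    obtain rb where rb: "B z b = k1 * rb" "B y b = k2 * rb" using r[OF K(2)] by blast
    obtain rc where rc: "B z c = k1 * rc" "B y c = k2 * rc" using r[OF K(3)] by blast
    have "\<omega> a b c = ra * (k1 * \<omega> t (u b) (u c) + k2 * \<omega> s (u b) (u c))
        - rb * (k1 * \<omega> t (u a) (u c) + k2 * \<omega> s (u a) (u c)) + rc * (k1 * \<omega> t (u a) (u b) + k2 * \<omega> s (u a) (u b))"
      unfolding \<omega>_expand[of a b c] \<omega>_u[of a b c] \<omega>_t[of a b] \<omega>_s[of a b] ra rb rc by (simp add: algebra_simps)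
    then show "\<omega> a b c = 0" by (simp add: rel u_in_U)
  qed
qed

text \<open>The bracket of t and s is orthogonal to z and y, so by \<open>fU\<close> it contributes
  nothing on U; Jacobi then says that the actions of t and s on U commute.\<close>

lemma actions_commute:
  assumes x: "x \<in> U" "x' \<in> U"
  shows "\<omega> s (bracket t x) x' + \<omega> s x (bracket t x') = 0"
proof -
  have "\<omega> (bracket t s) x x' = 0"
    by (rule fU) (use UD x in \<open>simp_all add: B_bracket fz fy'\<close>)
  then show ?thesis using \<omega>_derivation[of t s x x'] by simp
qed

lemma relation_on_U:
  assumes "\<And>x. x \<in> U \<Longrightarrow> x - h x \<in> radical" "\<And>x x'. x \<in> U \<Longrightarrow> x' \<in> U \<Longrightarrow> \<omega> w (h x) (h x') = 0"
    "x \<in> U" "x' \<in> U"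
  shows "\<omega> w x x' = 0"
proof -
  have "\<omega> w x x' = \<omega> w (x - h x) x' + \<omega> w (h x) (x' - h x') + \<omega> w (h x) (h x')"
    by (simp add: \<omega>_linear)
  then show ?thesis using assms \<omega>_radical by simp
qed

text \<open>Both actions live on the complement of v in U, of rank at most three. Commuting skew
  maps there have zero cross product, hence are proportional, and \<open>exact_if_dependent\<close>
  applies.\<close>

lemma exact_anisotropic:
  assumes v: "v \<in> U" "B v v \<noteq> 0" and vk: "\<And>x. x \<in> U \<Longrightarrow> \<omega> t x v = 0" "\<And>x. x \<in> U \<Longrightarrow> \<omega> s x v = 0"
  shows "exact_form \<omega>"
proof -
  have vk': "\<omega> t v x = 0" "\<omega> s v x = 0" if "x \<in> U" for x
    using vk[OF that] \<omega>_swap23[of t v x] \<omega>_swap23[of s v x] by simp_all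
  let ?X = "{x \<in> U. B v x = 0}"
  have ndU: "nondegenerate U" "dim U \<le> 4 + dim radical" using rkU by (simp_all add: rank_le_def U_def)
  have "rank_le (Suc 2) ?X" using nondegenerate_perp1(1,2)[OF ndU(1) v] ndU(2) by (simp add: rank_le_def)
  then obtain u1 where u1: "u1 \<in> ?X" "u1 = 0 \<or> B u1 u1 \<noteq> 0" "rank_le 2 {x \<in> ?X. B u1 x = 0}"
    "\<And>x. x \<in> ?X \<Longrightarrow> x - (B u1 x / B u1 u1) *s u1 \<in> {x \<in> ?X. B u1 x = 0}" using rank_le_Suc by blast
  let ?X1 = "{x \<in> ?X. B u1 x = 0}"
  have "rank_le (Suc 1) ?X1" using u1(3) by (simp add: eval_nat_numeral)
  then obtain u2 where u2: "u2 \<in> ?X1" "u2 = 0 \<or> B u2 u2 \<noteq> 0" "rank_le 1 {x \<in> ?X1. B u2 x = 0}"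
    "\<And>x. x \<in> ?X1 \<Longrightarrow> x - (B u2 x / B u2 u2) *s u2 \<in> {x \<in> ?X1. B u2 x = 0}" using rank_le_Suc by blast
  let ?X2 = "{x \<in> ?X1. B u2 x = 0}"
  have "rank_le (Suc 0) ?X2" using u2(3) by simp
  then obtain u3 where u3: "u3 \<in> ?X2" "u3 = 0 \<or> B u3 u3 \<noteq> 0" "rank_le 0 {x \<in> ?X2. B u3 x = 0}"
    "\<And>x. x \<in> ?X2 \<Longrightarrow> x - (B u3 x / B u3 u3) *s u3 \<in> {x \<in> ?X2. B u3 x = 0}" using rank_le_Suc by blast
  have U: "u1 \<in> U" "u2 \<in> U" "u3 \<in> U" using u1 u2 u3 by auto
  have orth: "B v u1 = 0" "B v u2 = 0" "B v u3 = 0" "B u1 u2 = 0" "B u1 u3 = 0" "B u2 u3 = 0"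
    using u1(1) u2(1) u3(1) by simp_all
  have orth': "B u1 v = 0" "B u2 v = 0" "B u3 v = 0" "B u2 u1 = 0" "B u3 u1 = 0" "B u3 u2 = 0"
    using orth B_sym[of u1 v] B_sym[of u2 v] B_sym[of u3 v] B_sym[of u2 u1] B_sym[of u3 u1] B_sym[of u3 u2]
    by simp_all
  define h where "h x = (B v x / B v v) *s v + (B u1 x / B u1 u1) *s u1 + (B u2 x / B u2 u2) *s u2
    + (B u3 x / B u3 u3) *s u3" for x
  have h: "x - h x \<in> radical" if "x \<in> U" for x
  proof -
    let ?x0 = "x - (B v x / B v v) *s v"
    let ?x1 = "?x0 - (B u1 x / B u1 u1) *s u1"
    let ?x2 = "?x1 - (B u2 x / B u2 u2) *s u2"
    have "?x0 \<in> ?X" using nondegenerate_perp1(3)[OF ndU(1) v that] .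
    then have "?x1 \<in> ?X1" using u1(4)[of ?x0] by (simp add: B_linear orth')
    then have "?x2 \<in> ?X2" using u2(4)[of ?x1] by (simp add: B_linear orth orth')
    then have "?x2 - (B u3 x / B u3 u3) *s u3 \<in> {x \<in> ?X2. B u3 x = 0}"
      using u3(4)[of ?x2] by (simp add: B_linear orth orth')
    then have "?x2 - (B u3 x / B u3 u3) *s u3 \<in> radical" by (simp only: rank_le_0[OF u3(3)])
    moreover have "x - h x = ?x2 - (B u3 x / B u3 u3) *s u3" by (simp add: h_def algebra_simps)
    ultimately show ?thesis by (simp only:)
  qed
  have exs: "\<omega> s w x = B u1 w / B u1 u1 * \<omega> s u1 x + B u2 w / B u2 u2 * \<omega> s u2 x + B u3 w / B u3 u3 * \<omega> s u3 x"
    if "B z w = 0" "B y w = 0" "x \<in> U" for w x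
  proof -
    have w: "w = B t w *s z + B s w *s y + u w" using dec[of w] that by simp
    have "\<omega> s w x = \<omega> s (u w) x"
      using arg_cong[OF w, of "\<lambda>w. \<omega> s w x"] by (simp add: \<omega>_linear fz fy')
    also have "\<dots> = \<omega> s (h (u w)) x"
      using \<omega>_radical(2)[OF h[OF u_in_U], of s w x] by (simp add: \<omega>_linear)
    finally show ?thesis using vk'[OF that(3)] by (simp add: h_def \<omega>_linear B_u U)
  qed
  have exs': "\<omega> s x w = B u1 w / B u1 u1 * \<omega> s x u1 + B u2 w / B u2 u2 * \<omega> s x u2 + B u3 w / B u3 u3 * \<omega> s x u3"
    if "B z w = 0" "B y w = 0" "x \<in> U" for w x
    unfolding \<omega>_swap23[of s x w] \<omega>_swap23[of s x u1] \<omega>_swap23[of s x u2] \<omega>_swap23[of s x u3] exs[OF that]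
    by simp
  have com: "B u1 (bracket t x) / B u1 u1 * \<omega> s u1 x' + B u2 (bracket t x) / B u2 u2 * \<omega> s u2 x'
      + B u3 (bracket t x) / B u3 u3 * \<omega> s u3 x' + (B u1 (bracket t x') / B u1 u1 * \<omega> s x u1
      + B u2 (bracket t x') / B u2 u2 * \<omega> s x u2 + B u3 (bracket t x') / B u3 u3 * \<omega> s x u3) = 0"
    if "x \<in> U" "x' \<in> U" for x x'
    using actions_commute[OF that] exs[of "bracket t x" x'] exs'[of "bracket t x'" x] that
    by (simp add: B_bracket fz fy')
  \<comment> \<open>The entry of the commutator at \<open>u1\<close>, \<open>u2\<close> passes only
    through \<open>u3\<close>, which makes it a 2 by 2 minor; for \<open>u3 = 0\<close> both sides
    vanish.\<close>
  have c12: "\<omega> t u1 u3 * \<omega> s u2 u3 = \<omega> t u2 u3 * \<omega> s u1 u3"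
  proof (cases "u3 = 0")
    case False
    have "\<omega> s u3 u2 = - \<omega> s u2 u3" by (rule \<omega>_swap23)
    then show ?thesis using com[OF U(1,2)] u3(2) False by (simp add: B_bracket add_divide_eq_iff)
  qed simp
  have c13: "\<omega> t u1 u2 * \<omega> s u2 u3 = \<omega> t u2 u3 * \<omega> s u1 u2"
  proof (cases "u2 = 0")
    case False
    have "\<omega> t u3 u2 = - \<omega> t u2 u3" by (rule \<omega>_swap23)
    then show ?thesis using com[OF U(1,3)] u2(2) False by (simp add: B_bracket add_divide_eq_iff)
  qed simp
  have c23: "\<omega> t u1 u2 * \<omega> s u1 u3 = \<omega> t u1 u3 * \<omega> s u1 u2"
  proof (cases "u1 = 0")
    case False
    have "\<omega> t u2 u1 = - \<omega> t u1 u2" "\<omega> t u3 u1 = - \<omega> t u1 u3" "\<omega> s u2 u1 = - \<omega> s u1 u2" by (rule \<omega>_swap23)+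
    then show ?thesis using com[OF U(2,3)] u1(2) False by (simp add: B_bracket add_divide_eq_iff)
  qed simp
  have "\<exists>k1 k2. (k1 \<noteq> 0 \<or> k2 \<noteq> 0) \<and> k1 * \<omega> t u1 u2 + k2 * \<omega> s u1 u2 = 0 \<and> k1 * \<omega> t u1 u3 + k2 * \<omega> s u1 u3 = 0
    \<and> k1 * \<omega> t u2 u3 + k2 * \<omega> s u2 u3 = 0"
    by (rule proportional_triples[OF c23 c13 c12])
  then obtain k1 k2 where k: "k1 \<noteq> 0 \<or> k2 \<noteq> 0" and kr: "k1 * \<omega> t u1 u2 + k2 * \<omega> s u1 u2 = 0"
    "k1 * \<omega> t u1 u3 + k2 * \<omega> s u1 u3 = 0" "k1 * \<omega> t u2 u3 + k2 * \<omega> s u2 u3 = 0" by blast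
  define w where "w = k1 *s t + k2 *s s"
  have fw: "\<omega> w x x' = k1 * \<omega> t x x' + k2 * \<omega> s x x'" for x x' by (simp add: w_def \<omega>_linear)
  have w: "\<omega> w u1 u2 = 0" "\<omega> w u1 u3 = 0" "\<omega> w u2 u3 = 0" using kr by (simp_all only: fw)
  have w': "\<omega> w u2 u1 = 0" "\<omega> w u3 u1 = 0" "\<omega> w u3 u2 = 0"
    using w \<omega>_swap23[of w u2 u1] \<omega>_swap23[of w u3 u1] \<omega>_swap23[of w u3 u2] by simp_all
  have wv: "\<omega> w v x = 0" "\<omega> w x v = 0" if "x \<in> U" for x
    using vk[OF that] vk'[OF that] by (simp_all add: fw)
  show ?thesis
  proof (rule exact_if_dependent[OF k])
    fix x x' assume x: "x \<in> U" "x' \<in> U"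
    have "\<omega> w x x' = 0"
    proof (rule relation_on_U[OF h _ x])
      show "\<omega> w (h x) (h x') = 0" for x x' by (simp add: h_def \<omega>_linear w w' wv U v)
    qed
    then show "k1 * \<omega> t x x' + k2 * \<omega> s x x' = 0" by (simp only: fw)
  qed
qed

lemma mem_exact_W:
  "exact_form (W v) \<Longrightarrow> exact_form (W w) \<Longrightarrow> exact_form (W (v + w))"
  "exact_form (W w) \<Longrightarrow> exact_form (W (k *s w))"
  "exact_form (W v) \<Longrightarrow> exact_form (W w) \<Longrightarrow> exact_form (W (v - w))"
  using subspace_exact_W subspace_add subspace_scale subspace_diff by blast+

lemma W_zy: "W z a b c = 0" "W y a b c = 0"
  by (simp_all add: W_def wedge3_def algebra_simps)

lemma exact_W_cancel: "k \<noteq> 0 \<Longrightarrow> exact_form (W (k *s w)) \<Longrightarrow> exact_form (W w)"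
  using mem_exact_W(2)[of "k *s w" "inverse k"] by simp

text \<open>
  Give \<open>t\<close> and \<open>s\<close> weight 1/3, \<open>w\<close> weight 2/3, \<open>m1\<close> and \<open>m2\<close> weight 1, \<open>v\<close> weight 4/3, \<open>z\<close> and
  \<open>y\<close> weight 5/3: up to exact terms all parts of \<open>\<omega>\<close> then have total weight 2, which accounts for
  the factor 3 below.
\<close>

lemma exact_isotropic:
  assumes v: "v \<in> U" "B v v = 0" and vk: "\<And>x. x \<in> U \<Longrightarrow> \<omega> t x v = 0" "\<And>x. x \<in> U \<Longrightarrow> \<omega> s x v = 0"
    and tsv: "\<omega> t s v = 1"
  shows "exact_form \<omega>"
proof -
  have vk': "\<omega> t v x = 0" "\<omega> s v x = 0" if "x \<in> U" for x
    using vk[OF that] \<omega>_swap23[of t v x] \<omega>_swap23[of s v x] by simp_all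
  have rkU': "rank_le (Suc (Suc 2)) U" using rkU by (simp add: U_def eval_nat_numeral)
  then have ndU: "nondegenerate U" by (simp add: rank_le_def)
  have "v \<notin> radical" using tsv \<omega>_radical(3) by fastforce
  obtain w where w: "w \<in> U" "B v w = 1" "B w w = 0"
    by (rule dual_exists[OF ndU v(1) \<open>v \<notin> radical\<close> v(2)])
  have wv: "B w v = 1" using w(2) B_sym[of w v] by simp
  let ?X = "{x \<in> U. B v x = 0 \<and> B w x = 0}"
  have "rank_le 2 ?X" by (rule rank_le_perp2[OF rkU' v w])
  then have "rank_le (Suc 1) ?X" by (simp add: eval_nat_numeral)
  then obtain m1 where m1: "m1 \<in> ?X" "m1 = 0 \<or> B m1 m1 \<noteq> 0" "rank_le 1 {x \<in> ?X. B m1 x = 0}"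
    "\<And>x. x \<in> ?X \<Longrightarrow> x - (B m1 x / B m1 m1) *s m1 \<in> {x \<in> ?X. B m1 x = 0}" using rank_le_Suc by blast
  let ?X1 = "{x \<in> ?X. B m1 x = 0}"
  have "rank_le (Suc 0) ?X1" using m1(3) by simp
  then obtain m2 where m2: "m2 \<in> ?X1" "m2 = 0 \<or> B m2 m2 \<noteq> 0" "rank_le 0 {x \<in> ?X1. B m2 x = 0}"
    "\<And>x. x \<in> ?X1 \<Longrightarrow> x - (B m2 x / B m2 m2) *s m2 \<in> {x \<in> ?X1. B m2 x = 0}" using rank_le_Suc by blast
  have U: "m1 \<in> U" "m2 \<in> U" using m1 m2 by auto
  have orth: "B v m1 = 0" "B v m2 = 0" "B w m1 = 0" "B w m2 = 0" "B m1 m2 = 0"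
    using m1(1) m2(1) by simp_all
  have orth': "B m1 v = 0" "B m2 v = 0" "B m1 w = 0" "B m2 w = 0" "B m2 m1 = 0"
    using orth B_sym[of m1 v] B_sym[of m2 v] B_sym[of m1 w] B_sym[of m2 w] B_sym[of m2 m1] by simp_all
  define h where "h x = B v x *s w + B w x *s v + (B m1 x / B m1 m1) *s m1 + (B m2 x / B m2 m2) *s m2" for x
  have h: "x - h x \<in> radical" if "x \<in> U" for x
  proof -
    let ?x0 = "x - B v x *s w - B w x *s v"
    let ?x1 = "?x0 - (B m1 x / B m1 m1) *s m1"
    have "?x0 \<in> ?X" by (rule nondegenerate_perp2(3)[OF ndU v w that])
    then have "?x1 \<in> ?X1" using m1(4)[of ?x0] by (simp add: B_linear orth')
    then have "?x1 - (B m2 x / B m2 m2) *s m2 \<in> {x \<in> ?X1. B m2 x = 0}"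
      using m2(4)[of ?x1] by (simp add: B_linear orth orth')
    then have "?x1 - (B m2 x / B m2 m2) *s m2 \<in> radical" by (simp only: rank_le_0[OF m2(3)])
    moreover have "x - h x = ?x1 - (B m2 x / B m2 m2) *s m2" by (simp add: h_def algebra_simps)
    ultimately show ?thesis by (simp only:)
  qed
  have exs: "\<omega> s q x = B v q * \<omega> s w x + B m1 q / B m1 m1 * \<omega> s m1 x + B m2 q / B m2 m2 * \<omega> s m2 x"
    if "B z q = 0" "B y q = 0" "x \<in> U" for q x
  proof -
    have q: "q = B t q *s z + B s q *s y + u q" using dec[of q] that by simp
    have "\<omega> s q x = \<omega> s (u q) x"
      using arg_cong[OF q, of "\<lambda>q. \<omega> s q x"] by (simp add: \<omega>_linear fz fy')
    also have "\<dots> = \<omega> s (h (u q)) x"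
      using \<omega>_radical(2)[OF h[OF u_in_U], of s q x] by (simp add: \<omega>_linear)
    finally show ?thesis using vk'[OF that(3)] by (simp add: h_def \<omega>_linear B_u U v w)
  qed
  have com: "B v (bracket t x) * \<omega> s w x' + B m1 (bracket t x) / B m1 m1 * \<omega> s m1 x'
      + B m2 (bracket t x) / B m2 m2 * \<omega> s m2 x' - (B v (bracket t x') * \<omega> s w x
      + B m1 (bracket t x') / B m1 m1 * \<omega> s m1 x + B m2 (bracket t x') / B m2 m2 * \<omega> s m2 x) = 0"
    if x: "x \<in> U" "x' \<in> U" for x x'
  proof -
    have "\<omega> s (bracket t x) x' - \<omega> s (bracket t x') x = 0"
      using actions_commute[OF x] \<omega>_swap23[of s x "bracket t x'"] by simp
    then show ?thesis
      using exs[of "bracket t x" x'] exs[of "bracket t x'" x] x by (simp add: B_bracket fz fy')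
  qed
  \<comment> \<open>A skew map of U killing v consists of a rotation of the plane of
    \<open>m1\<close>, \<open>m2\<close>, with coefficient d for t and r for s, and of a translation
    part, (\<open>a1\<close>, \<open>a2\<close>) and (\<open>b1\<close>, \<open>b2\<close>).\<close>
  define d r a1 a2 b1 b2 where "d = \<omega> t m1 m2" and "r = \<omega> s m1 m2" and "a1 = \<omega> t w m1" and "a2 = \<omega> t w m2"
    and "b1 = \<omega> s w m1" and "b2 = \<omega> s w m2"
  note sc = d_def[symmetric] r_def[symmetric] a1_def[symmetric] a2_def[symmetric] b1_def[symmetric] b2_def[symmetric]
  have sc': "\<omega> t m2 m1 = - d" "\<omega> s m2 m1 = - r" "\<omega> t m1 w = - a1" "\<omega> t m2 w = - a2" "\<omega> s m1 w = - b1" "\<omega> s m2 w = - b2"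
    unfolding d_def r_def a1_def a2_def b1_def b2_def by (rule \<omega>_swap23)+
  have c1: "d * b2 = a2 * r"
  proof (cases "m2 = 0")
    case False
    then show ?thesis using com[OF w(1) U(1)] m2(2) vk U w(1)
      by (simp add: B_bracket sc sc' add_divide_eq_iff diff_divide_eq_iff)
  qed (simp add: b2_def a2_def)
  have c2: "d * b1 = a1 * r"
  proof (cases "m1 = 0")
    case False
    then show ?thesis using com[OF w(1) U(2)] m1(2) vk U w(1)
      by (simp add: B_bracket sc sc' add_divide_eq_iff diff_divide_eq_iff)
  qed (simp add: b1_def a1_def)
  \<comment> \<open>Commutation gave two of the three minors, \<open>c1\<close> and
    \<open>c2\<close>. If the third vanishes too, the actions are dependent; otherwise they are
    independent pure translations, with no rotation part.\<close>
  show ?thesis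
  proof (cases "a1 * b2 = a2 * b1")
    case True
    obtain k1 k2 where k: "k1 \<noteq> 0 \<or> k2 \<noteq> 0" and kr: "k1 * d + k2 * r = 0"
      "k1 * a1 + k2 * b1 = 0" "k1 * a2 + k2 * b2 = 0"
      using proportional_triples[OF c2 c1 True] by blast
    define g where "g = k1 *s t + k2 *s s"
    have fg: "\<omega> g x x' = k1 * \<omega> t x x' + k2 * \<omega> s x x'" for x x' by (simp add: g_def \<omega>_linear)
    have g: "\<omega> g m1 m2 = 0" "\<omega> g w m1 = 0" "\<omega> g w m2 = 0" using kr by (simp_all only: fg sc)
    have g': "\<omega> g m2 m1 = 0" "\<omega> g m1 w = 0" "\<omega> g m2 w = 0"
      using g \<omega>_swap23[of g m2 m1] \<omega>_swap23[of g m1 w] \<omega>_swap23[of g m2 w] by simp_all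
    have gv: "\<omega> g v x = 0" "\<omega> g x v = 0" if "x \<in> U" for x
      using vk[OF that] vk'[OF that] by (simp_all add: fg)
    show ?thesis
    proof (rule exact_if_dependent[OF k])
      fix x x' assume x: "x \<in> U" "x' \<in> U"
      have "\<omega> g x x' = 0"
      proof (rule relation_on_U[OF h _ x])
        show "\<omega> g (h x) (h x') = 0" for x x' by (simp add: h_def \<omega>_linear g g' gv U v w)
      qed
      then show "k1 * \<omega> t x x' + k2 * \<omega> s x x' = 0" by (simp only: fg)
    qed
  next
    case False
    have "d * (a1 * b2) = d * (a2 * b1)" "r * (a1 * b2) = r * (a2 * b1)"
      using c1 c2 by algebra+
    then have dr: "d = 0" "r = 0" using False by simp_all
    have W_h: "W q a b c = W (h q) a b c" if q0: "B z q = 0" "B y q = 0" for q a b c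
    proof -
      have q: "q = B t q *s z + B s q *s y + u q" using dec[of q] q0 by simp
      have hq: "h (u q) = h q" by (simp add: h_def B_u U v w)
      have "W (u q - h (u q)) a b c = 0"
        using h[OF u_in_U[of q]] by (simp add: W_def wedge3_def B_radical)
      then have "W (u q) a b c = W (h q) a b c" by (simp add: W_linear hq)
      moreover have "W q a b c = W (u q) a b c"
        using arg_cong[OF q, of "\<lambda>q. W q a b c"] by (simp add: W_linear W_zy)
      ultimately show ?thesis by simp
    qed
    have W_h_exact: "exact_form (W (h q))" if "exact_form (W q)" "B z q = 0" "B y q = 0" for q
      using exact_form_cong[OF that(1)] W_h[OF that(2,3)] by metis
    have br: "B z (bracket x x') = 0" "B y (bracket x x') = 0" for x x' by (simp_all add: B_bracket fz fy')
    \<comment> \<open>The images of w under t and s are independent combinations of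
      \<open>m1\<close> and \<open>m2\<close>, so both of these give exact forms; the images of
      \<open>m1\<close> and \<open>m2\<close> are multiples of v, one of them nonzero.\<close>
    have E1: "exact_form (W ((a1 / B m1 m1) *s m1 + (a2 / B m2 m2) *s m2))"
      using W_h_exact[OF exact_W_bracket(1)[OF w(1)] br] vk(1)[OF w(1)]
      by (simp add: h_def B_bracket sc)
    have E2: "exact_form (W ((b1 / B m1 m1) *s m1 + (b2 / B m2 m2) *s m2))"
      using W_h_exact[OF exact_W_bracket(2)[OF w(1)] br] vk(2)[OF w(1)]
      by (simp add: h_def B_bracket sc)
    have Wm1: "exact_form (W m1)"
    proof (cases "m1 = 0")
      case True then show ?thesis using exact_W_zy(3)[OF subspace_0[OF subspace_radical]] by simp
    next
      case nm: False
      have "b2 *s ((a1 / B m1 m1) *s m1 + (a2 / B m2 m2) *s m2) - a2 *s ((b1 / B m1 m1) *s m1 + (b2 / B m2 m2) *s m2)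
        = ((a1 * b2 - a2 * b1) / B m1 m1) *s m1"
        by (simp add: scale_right_distrib scale_left_diff_distrib diff_divide_distrib algebra_simps)
      then have "exact_form (W (((a1 * b2 - a2 * b1) / B m1 m1) *s m1))"
        using mem_exact_W(3)[OF mem_exact_W(2)[OF E1, of b2] mem_exact_W(2)[OF E2, of a2]] by simp
      then show ?thesis using exact_W_cancel[of "(a1 * b2 - a2 * b1) / B m1 m1" m1] False m1(2) nm by simp
    qed
    have Wm2: "exact_form (W m2)"
    proof (cases "m2 = 0")
      case True then show ?thesis using exact_W_zy(3)[OF subspace_0[OF subspace_radical]] by simp
    next
      case nm: False
      have "a1 *s ((b1 / B m1 m1) *s m1 + (b2 / B m2 m2) *s m2) - b1 *s ((a1 / B m1 m1) *s m1 + (a2 / B m2 m2) *s m2)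
        = ((a1 * b2 - a2 * b1) / B m2 m2) *s m2"
        by (simp add: scale_right_distrib scale_left_diff_distrib diff_divide_distrib algebra_simps)
      then have "exact_form (W (((a1 * b2 - a2 * b1) / B m2 m2) *s m2))"
        using mem_exact_W(3)[OF mem_exact_W(2)[OF E2, of a1] mem_exact_W(2)[OF E1, of b1]] by simp
      then show ?thesis using exact_W_cancel[of "(a1 * b2 - a2 * b1) / B m2 m2" m2] False m2(2) nm by simp
    qed
    have V1: "exact_form (W ((- a1) *s v))"
      using W_h_exact[OF exact_W_bracket(1)[OF U(1)] br] vk(1)[OF U(1)] dr
      by (simp add: h_def B_bracket sc sc')
    have V2: "exact_form (W ((- a2) *s v))"
      using W_h_exact[OF exact_W_bracket(1)[OF U(2)] br] vk(1)[OF U(2)] dr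
      by (simp add: h_def B_bracket sc sc')
    have "- a1 \<noteq> 0 \<or> - a2 \<noteq> 0" using False by auto
    then have Wv: "exact_form (W v)" using exact_W_cancel V1 V2 by blast
    define kk where "kk = \<omega> t s w"
    define \<alpha> \<beta> where "\<alpha> x = \<omega> t w (u x)" and "\<beta> x = \<omega> s w (u x)" for x
    have hh: "\<omega> g x x' = \<omega> g (h x) (h x')" if "x \<in> U" "x' \<in> U" for g x x'
    proof -
      have "\<omega> g x x' = \<omega> g (x - h x) x' + \<omega> g (h x) (x' - h x') + \<omega> g (h x) (h x')" by (simp add: \<omega>_linear)
      then show ?thesis using \<omega>_radical(2)[OF h[OF that(1)]] \<omega>_radical(3)[OF h[OF that(2)]] by simp
    qed
    have hu: "h (u x) = h x" for x by (simp add: h_def B_u U v w)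
    have hw: "h w = w" using w wv orth' by (simp add: h_def)
    have ftu: "\<omega> t (u x) (u x') = B v x * \<alpha> x' - B v x' * \<alpha> x" for x x'
      using hh[OF u_in_U u_in_U, of t x x'] hh[OF w(1) u_in_U, of t x] hh[OF w(1) u_in_U, of t x'] vk vk'
      by (simp add: hu hw \<alpha>_def) (simp add: h_def \<omega>_linear sc sc' dr vk vk' U v w algebra_simps)
    have fsu: "\<omega> s (u x) (u x') = B v x * \<beta> x' - B v x' * \<beta> x" for x x'
      using hh[OF u_in_U u_in_U, of s x x'] hh[OF w(1) u_in_U, of s x] hh[OF w(1) u_in_U, of s x'] vk vk'
      by (simp add: hu hw \<beta>_def) (simp add: h_def \<omega>_linear sc sc' dr vk vk' U v w algebra_simps)
    have fw: "\<omega> t (u x) w = - \<alpha> x" "\<omega> s (u x) w = - \<beta> x" for x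
      unfolding \<alpha>_def \<beta>_def by (rule \<omega>_swap23)+
    have ts: "B (bracket t s) x = \<omega> t s (u x)" for x using \<omega>_ts[of x] by (simp add: \<omega>_def)
    have Gwv: "wedge_coboundary w v a b c = \<omega> a b c - W (bracket t s) a b c + kk * W v a b c - W w a b c" for a b c
      unfolding wedge_coboundary_def W_def wedge3_def ts
        \<omega>_expand[of a b c] \<omega>_u[of a b c] \<omega>_t[of a b] \<omega>_s[of a b]
        \<omega>_U[OF w(1), of a b] \<omega>_U[OF w(1), of b c] \<omega>_U[OF w(1), of c a]
        \<omega>_U[OF v(1), of a b] \<omega>_U[OF v(1), of b c] \<omega>_U[OF v(1), of c a]
      by (simp add: ftu fsu fw vk u_in_U tsv kk_def) (simp add: algebra_simps)
    have hts: "h (bracket t s) = w + kk *s v + (\<omega> t s m1 / B m1 m1) *s m1 + (\<omega> t s m2 / B m2 m2) *s m2"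
      using tsv by (simp add: h_def B_bracket kk_def)
    \<comment> \<open>By \<open>\<omega>_eq\<close> and \<open>Gwv\<close>, d(t ^ z) + d(s ^ y) -
      d(w ^ v) equals \<open>W\<close> of twice [t, s] plus w minus \<open>kk *s v\<close>. The
      w-component of [t, s] is 1, so w occurs three times, and \<open>?m\<close> is the
      rest.\<close>
    let ?m = "kk *s v + (2 * \<omega> t s m1 / B m1 m1) *s m1 + (2 * \<omega> t s m2 / B m2 m2) *s m2"
    have "exact_form (W ?m)" by (intro mem_exact_W Wv Wm1 Wm2)
    then have "exact_form (\<lambda>a b c. 1 * ((wedge_coboundary t z a b c + wedge_coboundary s y a b c) + (-1) * wedge_coboundary w v a b c) + (-1) * W ?m a b c)"
      by (intro exact_form_add exact_form_scale exact_form_G)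
    then have "exact_form (\<lambda>a b c. 3 * W w a b c)"
    proof (rule exact_form_cong)
      fix a b c
      have "W (bracket t s) a b c = W w a b c + kk * W v a b c + \<omega> t s m1 / B m1 m1 * W m1 a b c
          + \<omega> t s m2 / B m2 m2 * W m2 a b c"
        unfolding W_h[OF br] hts by (simp add: W_linear)
      moreover have "\<omega> a b c = wedge_coboundary t z a b c + wedge_coboundary s y a b c - W (bracket t s) a b c" by (simp add: \<omega>_eq W_def)
      ultimately show "3 * W w a b c = 1 * ((wedge_coboundary t z a b c + wedge_coboundary s y a b c) + (-1) * wedge_coboundary w v a b c) + (-1) * W ?m a b c"
        by (simp add: Gwv W_linear algebra_simps)
    qed
    then have "exact_form (W w)" by (rule exact_form_cancel[rotated]) simp
    then have "exact_form (W (h (bracket t s)))" unfolding hts by (intro mem_exact_W Wv Wm1 Wm2)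
    then have "exact_form (W (bracket t s))" by (rule exact_form_cong) (rule W_h[OF br])
    then show ?thesis by (rule exact_f_if_W)
  qed
qed

lemma central_frame_exact: "exact_form \<omega>"
proof -
  \<comment> \<open>Generators on which \<open>W\<close> is known to be exact. If [t, s] lies
    outside their span, a separating functional is represented by a vector v of U that both actions
    kill and that pairs to 1 with [t, s].\<close>
  let ?S = "{z, y} \<union> radical \<union> {bracket t x | x. x \<in> U} \<union> {bracket s x | x. x \<in> U}"
  show ?thesis
  proof (cases "bracket t s \<in> span ?S")
    case True
    have "?S \<subseteq> {w. exact_form (W w)}" using exact_W_zy exact_W_bracket by auto
    then have "span ?S \<subseteq> {w. exact_form (W w)}" by (rule span_minimal[OF _ subspace_exact_W])
    then show ?thesis using True exact_f_if_W by blast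
  next
    case False
    then obtain \<phi> where \<phi>: "\<And>x y. \<phi> (x + y) = \<phi> x + \<phi> y" "\<And>c x. \<phi> (c *s x) = c * \<phi> x"
      "\<And>x. x \<in> span ?S \<Longrightarrow> \<phi> x = 0" "\<phi> (bracket t s) = 1"
    proof (rule separating_functional[of "bracket t s" ?S])
      fix \<phi> assume "\<And>x y. \<phi> (x + y) = \<phi> x + \<phi> y" "\<And>c x. \<phi> (c *s x) = c * \<phi> x"
        "\<And>x. x \<in> span ?S \<Longrightarrow> \<phi> x = 0" "\<phi> (bracket t s) = 1"
      then show thesis by (rule that)
    qed
    have "\<exists>d\<in>UNIV. \<forall>x\<in>UNIV. B d x = \<phi> x"
    proof (rule represent_functional[OF subspace_UNIV \<phi>(1,2)])
      fix x assume "\<And>y. y \<in> UNIV \<Longrightarrow> B x y = 0"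
      then have "x \<in> radical" by (simp add: radical_iff)
      then show "\<phi> x = 0" by (intro \<phi>(3) span_base) simp
    qed
    then obtain d where d: "\<And>x. B d x = \<phi> x" by blast
    have dS: "B d x = 0" if "x \<in> ?S" for x using \<phi>(3)[OF span_base[OF that]] d by simp
    define v where "v = u d"
    have Bv: "B v x = B d x" if "B z x = 0" "B y x = 0" for x
      using that dS[of z] dS[of y] B_sym[of d z] B_sym[of d y] by (simp add: v_def u_def B_linear)
    have v: "v \<in> U" by (simp add: v_def u_in_U)
    have vk: "\<omega> t x v = 0" "\<omega> s x v = 0" if "x \<in> U" for x
    proof -
      have "B v (bracket t x) = 0" using Bv[of "bracket t x"] dS[of "bracket t x"] that
        by (auto simp: B_bracket fz fy')
      then show "\<omega> t x v = 0" by (simp add: B_bracket)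
      have "B v (bracket s x) = 0" using Bv[of "bracket s x"] dS[of "bracket s x"] that
        by (auto simp: B_bracket fz fy')
      then show "\<omega> s x v = 0" by (simp add: B_bracket)
    qed
    have tsv: "\<omega> t s v = 1" using Bv[of "bracket t s"] d[of "bracket t s"] \<phi>(4) by (simp add: B_bracket fz fy')
    show ?thesis
    proof (cases "B v v = 0")
      case True
      show ?thesis by (rule exact_isotropic[OF v True vk tsv])
    next
      case False
      show ?thesis by (rule exact_anisotropic[OF v False vk])
    qed
  qed
qed

end

section \<open>Decomposable restrictions\<close>

text \<open>Here y need not be central. By \<open>fs\<close> the contraction of \<omega> with s is a
  ^ b on U; orthogonality of a and b is a normalization provided by
  \<open>orthogonal_decomposition\<close>.\<close>

locale decomposable_frame = adapted_frame +
  fixes a b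
  assumes aU: "a \<in> U" and bU: "b \<in> U" and Bab: "B a b = 0"
    and fs: "x \<in> U \<Longrightarrow> x' \<in> U \<Longrightarrow> \<omega> s x x' = B a x * B b x' - B a x' * B b x"
begin

lemma Ba: "B a z = 0" "B a t = 0" "B a y = 0" "B a s = 0" "B z a = 0" "B t a = 0" "B y a = 0" "B s a = 0"
  using UD[OF aU] B_sym[of a] by simp_all

lemma Bb: "B b z = 0" "B b t = 0" "B b y = 0" "B b s = 0" "B z b = 0" "B t b = 0" "B y b = 0" "B s b = 0"
    "B b a = 0" "B a b = 0"
  using UD[OF bU] B_sym[of b] Bab by simp_all

lemma \<omega>_K1:
  assumes "B z p = 0" "B z q = 0" "B z r = 0"
  shows "\<omega> p q r = wedge3 y a b p q r"
proof -
  have *: "p = B t p *s z + B y p *s s + B s p *s y + u p" if "B z p = 0" for p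
    using dec[of p] that by simp
  have n: "\<omega> (u p) s (u q) = - \<omega> s (u p) (u q)" "\<omega> (u p) (u q) s = \<omega> s (u p) (u q)" "\<omega> (u p) (u q) (u r) = 0" for p q r
    by (simp_all add: \<omega>_norm)
  have "\<omega> p q r = \<omega> (B t p *s z + B y p *s s + B s p *s y + u p) (B t q *s z + B y q *s s + B s q *s y + u q)
      (B t r *s z + B y r *s s + B s r *s y + u r)"
    using *[OF assms(1)] *[OF assms(2)] *[OF assms(3)] by metis
  also have "\<dots> = wedge3 y a b p q r"
    by (simp add: \<omega>_linear fz fy Bf Bu n) (simp add: fs u_in_U B_u aU bU wedge3_def algebra_simps)
  finally show ?thesis .
qed

text \<open>As z is closed, d(t ^ z) accounts for the terms of \<omega> containing z; the rest is
  the restriction to the complement of z, pulled back along the projection k.\<close>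

lemma \<omega>_decompose: "\<omega> p q r = wedge_coboundary t z p q r + wedge3 y a b p q r"
proof -
  define k where "k x = x - B z x *s t" for x
  have "\<omega> (k p) (k q) (k r) = wedge3 y a b (k p) (k q) (k r)"
    by (rule \<omega>_K1) (simp_all add: k_def B_linear Bf)
  also have "\<dots> = wedge3 y a b p q r" by (simp add: k_def wedge3_def B_linear Bf Ba Bb)
  finally have 1: "\<omega> (k p) (k q) (k r) = wedge3 y a b p q r" .
  have t1: "\<omega> t x y = \<omega> x y t" "\<omega> x t y = - \<omega> x y t" for x y
    by (rule \<omega>_rot[symmetric], rule \<omega>_swap23)
  have "\<omega> r p t = - \<omega> p r t" by (rule \<omega>_swap12)
  then show ?thesis using 1 by (simp add: k_def \<omega>_linear wedge_coboundary_def fz t1 algebra_simps)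
qed

text \<open>A structure equation: the coboundary of \<open>B v\<close> is the contraction of y ^ a ^
  b with v minus z ^ [t, v].\<close>

lemma \<omega>_last:
  assumes v: "B z v = 0"
  shows "\<omega> p q v = wedge3 y a b p q v - (B z p * B (bracket t v) q - B z q * B (bracket t v) p)"
proof -
  define k where "k x = x - B z x *s t" for x
  have "\<omega> (k p) (k q) v = wedge3 y a b (k p) (k q) v"
    by (rule \<omega>_K1) (simp_all add: k_def B_linear Bf v)
  also have "\<dots> = wedge3 y a b p q v" by (simp add: k_def wedge3_def B_linear Bf Ba Bb)
  finally have 1: "\<omega> (k p) (k q) v = wedge3 y a b p q v" .
  have 2: "B (bracket t v) x = - \<omega> t x v" "\<omega> x t v = - \<omega> t x v" for x
    unfolding \<omega>_def[symmetric] by (rule \<omega>_swap23, rule \<omega>_swap12)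
  show ?thesis using 1 by (simp add: k_def \<omega>_linear 2 algebra_simps)
qed

lemma G_K1:
  assumes v: "B z v = 0" "B z v' = 0"
  shows "wedge_coboundary v v' p q r = (wedge3 y a b p q v * B v' r + wedge3 y a b q r v * B v' p + wedge3 y a b r p v * B v' q)
    - (wedge3 y a b p q v' * B v r + wedge3 y a b q r v' * B v p + wedge3 y a b r p v' * B v q)
    - wedge3 z (bracket t v) v' p q r + wedge3 z (bracket t v') v p q r"
  unfolding wedge_coboundary_def \<omega>_last[OF v(1)] \<omega>_last[OF v(2)] by (simp add: wedge3_def algebra_simps)

lemma exact_if_wd: "exact_form (wedge3 y a b) \<Longrightarrow> exact_form \<omega>"
  by (rule exact_form_cong[OF exact_form_add[OF exact_form_G[of t z]]]) (auto simp: \<omega>_decompose)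

lemma derivation_wd:
  assumes "B z h1 = 0" "B z h2 = 0" "B z h3 = 0"
  shows "wedge3 y a b (bracket t h1) h2 h3 + wedge3 y a b h1 (bracket t h2) h3 + wedge3 y a b h1 h2 (bracket t h3) = 0"
proof -
  have "B z (bracket t h) = 0" for h by (simp add: B_bracket fz)
  then show ?thesis using \<omega>_derivation[of t h1 h2 h3] assms by (simp add: \<omega>_K1)
qed

lemma B_br: "B v (bracket t h) = - \<omega> t v h"
  unfolding B_bracket by (rule \<omega>_swap23)

end

locale dual_decomposable_frame = decomposable_frame +
  fixes sa sb
  assumes saU: "sa \<in> U" and sbU: "sb \<in> U"
    and dual: "B a sa = 1" "B b sa = 0" "B a sb = 0" "B b sb = 1"
begin

lemma Bs: "B z sa = 0" "B t sa = 0" "B y sa = 0" "B s sa = 0" "B z sb = 0" "B t sb = 0" "B y sb = 0" "B s sb = 0"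
  "B sa z = 0" "B sa t = 0" "B sa y = 0" "B sa s = 0" "B sb z = 0" "B sb t = 0" "B sb y = 0" "B sb s = 0"
  "B sa a = 1" "B sa b = 0" "B sb a = 0" "B sb b = 1"
  using UD[OF saU] UD[OF sbU] dual B_sym[of sa] B_sym[of sb] by simp_all

lemmas Ball = Bf Ba Bb Bs dual

text \<open>By \<open>derivation_wd\<close>, t preserves y ^ a ^ b; the scalar by which it acts on
  this form is, up to sign, its trace on the span of y, a, b.\<close>

lemma trace_zero: "\<omega> t y s + \<omega> t a sa + \<omega> t b sb = 0"
proof -
  have "\<omega> t y s + \<omega> t a sa + \<omega> t b sb
      = - (wedge3 y a b (bracket t s) sa sb + wedge3 y a b s (bracket t sa) sb + wedge3 y a b s sa (bracket t sb))"
    by (simp add: wedge3_def Ball B_br)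
  also have "\<dots> = 0" using derivation_wd[of s sa sb] by (simp add: Ball)
  finally show ?thesis .
qed

text \<open>Preserving a decomposable three-form forces t to preserve the span of its factors. It is
  tested on a vector k that all the factors kill.\<close>

lemma action:
  assumes "v = y \<or> v = a \<or> v = b"
  shows "\<omega> t v x = \<omega> t v s * B y x + \<omega> t v sa * B a x + \<omega> t v sb * B b x"
proof -
  define k where "k = x - B z x *s t - B y x *s s - B a x *s sa - B b x *s sb"
  have k: "B z k = 0" "B y k = 0" "B a k = 0" "B b k = 0"
    by (simp_all add: k_def B_linear Ball)
  have "\<omega> t v k = 0"
    using assms
  proof (elim disjE)
    assume "v = y"
    then show ?thesis using derivation_wd[of k sa sb] k by (simp add: wedge3_def Ball B_br)
  next
    assume "v = a"
    then show ?thesis using derivation_wd[of s k sb] k by (simp add: wedge3_def Ball B_br)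
  next
    assume "v = b"
    then show ?thesis using derivation_wd[of s sa k] k by (simp add: wedge3_def Ball B_br)
  qed
  then show ?thesis by (simp add: k_def \<omega>_linear algebra_simps)
qed

lemma action_zero:
  assumes "v = y \<or> v = a \<or> v = b" "B y x = 0" "B a x = 0" "B b x = 0"
  shows "\<omega> t v x = 0" "\<omega> t x v = 0"
  using action[OF assms(1), of x] assms(2-4) \<omega>_swap23[of t x v] by simp_all

text \<open>On the span of y, a, b the radical of \<open>B\<close> is the line of y, so the skew
  action of t keeps y an eigenvector. The diagonal entries at a and b vanish by skewness, and the
  zero trace then kills the eigenvalue.\<close>

lemma anisotropic_y_central:
  assumes "B a a \<noteq> 0" "B b b \<noteq> 0" "sa = inverse (B a a) *s a" "sb = inverse (B b b) *s b"
  shows "\<omega> t y x = 0"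
proof -
  have "\<omega> t a sa = 0" "\<omega> t b sb = 0" by (simp_all add: assms(3,4) \<omega>_linear)
  then have 1: "\<omega> t y s = 0" using trace_zero by simp
  have "\<omega> t y sa = inverse (B a a) * \<omega> t y a" by (simp add: assms(3) \<omega>_linear)
  then have 2: "\<omega> t y sa = 0" using action_zero(2)[of a y] by (simp add: Ball)
  have "\<omega> t y sb = inverse (B b b) * \<omega> t y b" by (simp add: assms(4) \<omega>_linear)
  then have 3: "\<omega> t y sb = 0" using action_zero(2)[of b y] by (simp add: Ball)
  show ?thesis using action[of y x] 1 2 3 by simp
qed

lemma wd_tz: "wedge3 z (bracket t z) v p q r = 0"
proof -
  have "B (bracket t z) x = 0" for x by (simp add: \<omega>_def[symmetric] fz)
  then show ?thesis by (simp add: wedge3_def)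
qed

text \<open>Multiplication by the closed z kills the term z ^ [t, s] of the coboundary of s and
  keeps a ^ b. The duals \<open>sa\<close> and \<open>sb\<close> of the other two factors work in
  the same way below.\<close>

lemma exact_wd_z_ab: "exact_form (wedge3 z a b)"
proof (rule exact_form_cong[OF exact_form_G[of s z]])
  show "wedge3 z a b p q r = wedge_coboundary s z p q r" for p q r
    by (subst G_K1) (simp_all add: Ball wd_tz, simp add: wedge3_def Ball algebra_simps)
qed

lemma exact_wd_z_yb: "exact_form (wedge3 z y b)"
proof (rule exact_form_cong[OF exact_form_scale[OF exact_form_G[of sa z], of "-1"]])
  show "wedge3 z y b p q r = - 1 * wedge_coboundary sa z p q r" for p q r
    by (subst G_K1) (simp_all add: Ball wd_tz, simp add: wedge3_def Ball algebra_simps)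
qed

lemma exact_wd_z_ya: "exact_form (wedge3 z y a)"
proof (rule exact_form_cong[OF exact_form_G[of sb z]])
  show "wedge3 z y a p q r = wedge_coboundary sb z p q r" for p q r
    by (subst G_K1) (simp_all add: Ball wd_tz, simp add: wedge3_def Ball algebra_simps)
qed

text \<open>
  The grading has weights 0 on \<open>t\<close>, 1/2 on \<open>s\<close> and \<open>sa\<close>, 1 on \<open>b\<close> and \<open>c\<close>, 3/2 on \<open>y\<close> and \<open>a\<close>, and 2
  on \<open>z\<close>.  The determinant condition is needed only to remove the terms involving \<open>c\<close>.
\<close>

lemma exact_rank_one:
  assumes aa: "B a a = 0" and bb: "B b b \<noteq> 0" and sb: "sb = inverse (B b b) *s b" and ss: "B sa sa = 0"
    and c: "c \<in> U" "B a c = 0" "B b c = 0" "B sa c = 0"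
    and span: "\<And>x. x \<in> U \<Longrightarrow>
      x - (B a x *s sa + B sa x *s a + (B b x / B b b) *s b + (B c x / B c c) *s c) \<in> radical"
    and det: "\<omega> t y s * \<omega> t a sa \<noteq> \<omega> t y sa * \<omega> t a s"
  shows "exact_form \<omega>"
proof -
  have cB: "B z c = 0" "B t c = 0" "B y c = 0" "B s c = 0" "B c z = 0" "B c t = 0" "B c y = 0" "B c s = 0"
    "B c a = 0" "B c b = 0" "B c sa = 0"
    using UD[OF c(1)] B_sym[of c] c by simp_all
  have ex: "\<omega> t v x = B y x * \<omega> t v s + B s x * \<omega> t v y + B a x * \<omega> t v sa + B sa x * \<omega> t v a
      + B b x / B b b * \<omega> t v b + B c x / B c c * \<omega> t v c" for v x
  proof -
    have "\<omega> t v x = B y x * \<omega> t v s + B s x * \<omega> t v y + \<omega> t v (u x)"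
      using arg_cong[OF dec[of x], of "\<omega> t v"] by (simp add: \<omega>_linear fz)
    moreover have "\<omega> t v (u x) = B a x * \<omega> t v sa + B sa x * \<omega> t v a
      + B b x / B b b * \<omega> t v b + B c x / B c c * \<omega> t v c"
      using \<omega>_radical(3)[OF span[OF u_in_U[of x]], of t v] by (simp add: \<omega>_linear B_u aU bU saU c)
    ultimately show ?thesis by simp
  qed
  define A11 A12 A21 A22 where "A11 = \<omega> t y s" and "A12 = \<omega> t y sa" and "A21 = \<omega> t a s" and "A22 = \<omega> t a sa"
  have fyb: "\<omega> t y b = 0" "\<omega> t a b = 0"
    using action_zero(2)[of b y] action_zero(2)[of b a] aa by (simp_all add: Ball)
  then have "\<omega> t y sb = 0" "\<omega> t a sb = 0" by (simp_all add: sb \<omega>_linear)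
  then have ty: "B (bracket t y) x = A11 * B y x + A12 * B a x" and ta: "B (bracket t a) x = A21 * B y x + A22 * B a x" for x
    using action[of y x] action[of a x] by (simp_all add: \<omega>_def[symmetric] A11_def A12_def A21_def A22_def)
  have tr: "A22 = - A11"
  proof -
    have "\<omega> t b sb = 0" by (simp add: sb \<omega>_linear)
    then show ?thesis using trace_zero by (simp add: A11_def A22_def eq_neg_iff_add_eq_0 add.commute)
  qed
  have sw: "\<omega> t s y = - A11" "\<omega> t s a = - A21" "\<omega> t sa y = - A12" "\<omega> t sa a = - A22"
    unfolding A11_def A12_def A21_def A22_def by (rule \<omega>_swap23)+
  define g1 g2 g3 g4 where "g1 = \<omega> t s b / B b b" and "g2 = \<omega> t s c / B c c"
    and "g3 = \<omega> t sa b / B b b" and "g4 = \<omega> t sa c / B c c"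
  have tc: "B (bracket t c) x = \<omega> t c s * B y x + \<omega> t c sa * B a x" for x
    using ex[of c x] action_zero(2)[of y c] action_zero(2)[of a c] action_zero(2)[of b c] cB c
    by (simp add: \<omega>_def[symmetric] algebra_simps)
  have ts: "B (bracket t s) x = - A11 * B s x + \<omega> t s sa * B a x - A21 * B sa x + g1 * B b x + g2 * B c x" for x
    using ex[of s x] by (simp add: \<omega>_def[symmetric] sw g1_def g2_def algebra_simps)
  have tsa: "B (bracket t sa) x = \<omega> t sa s * B y x - A12 * B s x - A22 * B sa x + g3 * B b x + g4 * B c x" for x
    using ex[of sa x] by (simp add: \<omega>_def[symmetric] sw g3_def g4_def algebra_simps)
  \<comment> \<open>The matrix of t on y and a appears: d(c ^ y) and d(c ^ a) are its rows applied
    to z ^ y ^ c and z ^ a ^ c, up to multiples of the exact z ^ y ^ a. Its determinant is nonzero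
    by \<open>det\<close>.\<close>
  have Gy: "exact_form (\<lambda>p q r. A11 * wedge3 z y c p q r + A12 * wedge3 z a c p q r)"
  proof (rule exact_form_cong[OF exact_form_combine[OF exact_form_G[of c y] exact_wd_z_ya, of 1 "- \<omega> t c sa"]])
    show "A11 * wedge3 z y c p q r + A12 * wedge3 z a c p q r = 1 * wedge_coboundary c y p q r + (- \<omega> t c sa) * wedge3 z y a p q r" for p q r
      by (subst G_K1) (simp_all add: Ball cB, simp add: wedge3_def ty tc Ball cB c algebra_simps)
  qed
  have Ga: "exact_form (\<lambda>p q r. A21 * wedge3 z y c p q r + A22 * wedge3 z a c p q r)"
  proof (rule exact_form_cong[OF exact_form_combine[OF exact_form_G[of c a] exact_wd_z_ya, of 1 "\<omega> t c s"]])
    show "A21 * wedge3 z y c p q r + A22 * wedge3 z a c p q r = 1 * wedge_coboundary c a p q r + \<omega> t c s * wedge3 z y a p q r" for p q r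
      by (subst G_K1) (simp_all add: Ball cB, simp add: wedge3_def ta tc Ball cB c aa algebra_simps)
  qed
  have nz: "A11 * A22 - A12 * A21 \<noteq> 0" using det by (simp add: A11_def A12_def A21_def A22_def)
  have yc: "exact_form (wedge3 z y c)"
    by (rule exact_form_cancel[OF nz], rule exact_form_cong[OF exact_form_combine[OF Gy Ga, of A22 "- A12"]]) (simp add: algebra_simps)
  have ac: "exact_form (wedge3 z a c)"
    by (rule exact_form_cancel[OF nz], rule exact_form_cong[OF exact_form_combine[OF Gy Ga, of "- A21" A11]]) (simp add: algebra_simps)
  \<comment> \<open>The pairs s ^ y and \<open>sa\<close> ^ a contribute one y ^ a ^ b each.
    Skewness of t cancels the entries of its matrix on y and a against those on s and
    \<open>sa\<close>; what remains are the exact forms found above.\<close>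
  let ?E = "\<lambda>p q r. (1 * wedge_coboundary s y p q r + 1 * wedge_coboundary sa a p q r)
    + 1 * (1 * ((- \<omega> t s sa + \<omega> t sa s) * wedge3 z y a p q r + (- g1) * wedge3 z y b p q r)
    + 1 * ((- g2) * wedge3 z y c p q r
    + 1 * ((- g3) * wedge3 z a b p q r + (- g4) * wedge3 z a c p q r)))"
  have "exact_form ?E"
    by (intro exact_form_add exact_form_scale exact_form_G exact_wd_z_ya exact_wd_z_ab exact_wd_z_yb yc ac)
  then have "exact_form (\<lambda>p q r. 2 * wedge3 y a b p q r)"
  proof (rule exact_form_cong)
    fix p q r
    have 1: "wedge_coboundary s y p q r = wedge3 y a b p q r - wedge3 z (bracket t s) y p q r + wedge3 z (bracket t y) s p q r"
      by (subst G_K1) (simp_all add: Ball, simp add: wedge3_def Ball algebra_simps)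
    have 2: "wedge_coboundary sa a p q r = wedge3 y a b p q r - wedge3 z (bracket t sa) a p q r + wedge3 z (bracket t a) sa p q r"
      by (subst G_K1) (simp_all add: Ball, simp add: wedge3_def Ball aa algebra_simps)
    show "2 * wedge3 y a b p q r = ?E p q r"
      unfolding 1 2 by (simp add: wedge3_def ty ta ts tsa tr) (simp add: algebra_simps)
  qed
  then have "exact_form (wedge3 y a b)" by (rule exact_form_cancel[rotated]) simp
  then show ?thesis by (rule exact_if_wd)
qed

text \<open>
  The grading has weights 0 on \<open>t\<close>, 2/3 on \<open>s\<close>, \<open>sa\<close> and \<open>sb\<close>, 4/3 on \<open>y\<close>, \<open>a\<close> and \<open>b\<close>, and 2 on \<open>z\<close>.
\<close>

lemma exact_rank_zero:
  assumes iso: "B a a = 0" "B b b = 0" and ss: "B sa sa = 0" "B sb sb = 0" "B sa sb = 0"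
    and span: "\<And>x. x \<in> U \<Longrightarrow> x - (B a x *s sa + B sa x *s a + B b x *s sb + B sb x *s b) \<in> radical"
  shows "exact_form \<omega>"
proof -
  have ex: "\<omega> t v x = B y x * \<omega> t v s + B s x * \<omega> t v y + B a x * \<omega> t v sa + B sa x * \<omega> t v a
      + B b x * \<omega> t v sb + B sb x * \<omega> t v b" for v x
  proof -
    have "\<omega> t v x = B y x * \<omega> t v s + B s x * \<omega> t v y + \<omega> t v (u x)"
      using arg_cong[OF dec[of x], of "\<omega> t v"] by (simp add: \<omega>_linear fz)
    moreover have "\<omega> t v (u x) = B a x * \<omega> t v sa + B sa x * \<omega> t v a + B b x * \<omega> t v sb + B sb x * \<omega> t v b"
      using \<omega>_radical(3)[OF span[OF u_in_U[of x]], of t v] by (simp add: \<omega>_linear B_u aU bU saU sbU)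
    ultimately show ?thesis by simp
  qed
  define A where "A i j = \<omega> t i j" for i j
  have tv: "B (bracket t y) x = A y s * B y x + A y sa * B a x + A y sb * B b x"
    "B (bracket t a) x = A a s * B y x + A a sa * B a x + A a sb * B b x"
    "B (bracket t b) x = A b s * B y x + A b sa * B a x + A b sb * B b x" for x
    using action[of y x] action[of a x] action[of b x] by (simp_all add: \<omega>_def[symmetric] A_def)
  have sw: "\<omega> t s y = - A y s" "\<omega> t s a = - A a s" "\<omega> t s b = - A b s"
    "\<omega> t sa y = - A y sa" "\<omega> t sa a = - A a sa" "\<omega> t sa b = - A b sa"
    "\<omega> t sb y = - A y sb" "\<omega> t sb a = - A a sb" "\<omega> t sb b = - A b sb"
    unfolding A_def by (rule \<omega>_swap23)+
  have ts: "B (bracket t s) x = - A y s * B s x + \<omega> t s sa * B a x - A a s * B sa x + \<omega> t s sb * B b x - A b s * B sb x"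
    "B (bracket t sa) x = \<omega> t sa s * B y x - A y sa * B s x - A a sa * B sa x + \<omega> t sa sb * B b x - A b sa * B sb x"
    "B (bracket t sb) x = \<omega> t sb s * B y x - A y sb * B s x + \<omega> t sb sa * B a x - A a sb * B sa x - A b sb * B sb x" for x
    using ex[of s x] ex[of sa x] ex[of sb x] by (simp_all add: \<omega>_def[symmetric] sw algebra_simps)
  \<comment> \<open>Three dual pairs, hence the coefficient 3. The entries of t among s,
    \<open>sa\<close> and \<open>sb\<close> do not cancel; each arises from two pairs and multiplies
    an exact form.\<close>
  let ?E = "\<lambda>p q r. (1 * wedge_coboundary s y p q r + 1 * (1 * wedge_coboundary sa a p q r + 1 * wedge_coboundary sb b p q r))
    + 1 * ((- \<omega> t s sa + \<omega> t sa s) * wedge3 z y a p q r + 1 * ((- \<omega> t s sb + \<omega> t sb s) * wedge3 z y b p q r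
    + (- \<omega> t sa sb + \<omega> t sb sa) * wedge3 z a b p q r))"
  have "exact_form ?E"
    by (intro exact_form_add exact_form_scale exact_form_G exact_wd_z_ya exact_wd_z_ab exact_wd_z_yb)
  then have "exact_form (\<lambda>p q r. 3 * wedge3 y a b p q r)"
  proof (rule exact_form_cong)
    fix p q r
    have 1: "wedge_coboundary s y p q r = wedge3 y a b p q r - wedge3 z (bracket t s) y p q r + wedge3 z (bracket t y) s p q r"
      by (subst G_K1) (simp_all add: Ball, simp add: wedge3_def Ball algebra_simps)
    have 2: "wedge_coboundary sa a p q r = wedge3 y a b p q r - wedge3 z (bracket t sa) a p q r + wedge3 z (bracket t a) sa p q r"
      by (subst G_K1) (simp_all add: Ball, simp add: wedge3_def Ball iso algebra_simps)
    have 3: "wedge_coboundary sb b p q r = wedge3 y a b p q r - wedge3 z (bracket t sb) b p q r + wedge3 z (bracket t b) sb p q r"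
      by (subst G_K1) (simp_all add: Ball, simp add: wedge3_def Ball iso algebra_simps)
    show "3 * wedge3 y a b p q r = ?E p q r"
      unfolding 1 2 3 by (simp add: wedge3_def tv ts) (simp add: algebra_simps)
  qed
  then have "exact_form (wedge3 y a b)" by (rule exact_form_cancel[rotated]) simp
  then show ?thesis by (rule exact_if_wd)
qed

end

section \<open>Pfaffian and decomposability of the two-form of s on U\<close>

context adapted_frame
begin

text \<open>Diagonalization by \<open>rank_le_Suc\<close>, four times. Some of the vectors may be
  zero, and then their terms in the expansion are zero.\<close>

lemma orthogonal_frame_U:
  obtains u1 u2 u3 u4 where "u1 \<in> U" "u2 \<in> U" "u3 \<in> U" "u4 \<in> U"
    "B u1 u2 = 0" "B u1 u3 = 0" "B u1 u4 = 0" "B u2 u3 = 0" "B u2 u4 = 0" "B u3 u4 = 0"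
    "\<And>x. x \<in> U \<Longrightarrow> x - ((B u1 x / B u1 u1) *s u1 + (B u2 x / B u2 u2) *s u2
      + (B u3 x / B u3 u3) *s u3 + (B u4 x / B u4 u4) *s u4) \<in> radical"
proof -
  have "rank_le (Suc 3) U" using rkU by (simp add: U_def eval_nat_numeral)
  then obtain u1 where u1: "u1 \<in> U" "rank_le 3 {x \<in> U. B u1 x = 0}"
    "\<And>x. x \<in> U \<Longrightarrow> x - (B u1 x / B u1 u1) *s u1 \<in> {x \<in> U. B u1 x = 0}" using rank_le_Suc by blast
  let ?X1 = "{x \<in> U. B u1 x = 0}"
  have "rank_le (Suc 2) ?X1" using u1(2) by (simp add: eval_nat_numeral)
  then obtain u2 where u2: "u2 \<in> ?X1" "rank_le 2 {x \<in> ?X1. B u2 x = 0}"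
    "\<And>x. x \<in> ?X1 \<Longrightarrow> x - (B u2 x / B u2 u2) *s u2 \<in> {x \<in> ?X1. B u2 x = 0}" using rank_le_Suc by blast
  let ?X2 = "{x \<in> ?X1. B u2 x = 0}"
  have "rank_le (Suc 1) ?X2" using u2(2) by (simp add: eval_nat_numeral)
  then obtain u3 where u3: "u3 \<in> ?X2" "rank_le 1 {x \<in> ?X2. B u3 x = 0}"
    "\<And>x. x \<in> ?X2 \<Longrightarrow> x - (B u3 x / B u3 u3) *s u3 \<in> {x \<in> ?X2. B u3 x = 0}" using rank_le_Suc by blast
  let ?X3 = "{x \<in> ?X2. B u3 x = 0}"
  have "rank_le (Suc 0) ?X3" using u3(2) by simp
  then obtain u4 where u4: "u4 \<in> ?X3" "rank_le 0 {x \<in> ?X3. B u4 x = 0}"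
    "\<And>x. x \<in> ?X3 \<Longrightarrow> x - (B u4 x / B u4 u4) *s u4 \<in> {x \<in> ?X3. B u4 x = 0}" using rank_le_Suc by blast
  have orth: "B u1 u2 = 0" "B u1 u3 = 0" "B u1 u4 = 0" "B u2 u3 = 0" "B u2 u4 = 0" "B u3 u4 = 0"
    using u2(1) u3(1) u4(1) by simp_all
  have orth': "B u2 u1 = 0" "B u3 u1 = 0" "B u4 u1 = 0" "B u3 u2 = 0" "B u4 u2 = 0" "B u4 u3 = 0"
    using orth B_sym[of u2 u1] B_sym[of u3 u1] B_sym[of u4 u1] B_sym[of u3 u2] B_sym[of u4 u2] B_sym[of u4 u3]
    by simp_all
  show ?thesis
  proof (rule that[OF _ _ _ _ orth])
    show "u1 \<in> U" "u2 \<in> U" "u3 \<in> U" "u4 \<in> U" using u1 u2 u3 u4 by auto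
    fix x assume "x \<in> U"
    let ?x1 = "x - (B u1 x / B u1 u1) *s u1"
    let ?x2 = "?x1 - (B u2 x / B u2 u2) *s u2"
    let ?x3 = "?x2 - (B u3 x / B u3 u3) *s u3"
    have "?x1 \<in> ?X1" by (rule u1(3)[OF \<open>x \<in> U\<close>])
    then have "?x2 \<in> ?X2" using u2(3)[of ?x1] by (simp add: B_linear orth')
    then have "?x3 \<in> ?X3" using u3(3)[of ?x2] by (simp add: B_linear orth orth')
    then have "?x3 - (B u4 x / B u4 u4) *s u4 \<in> {x \<in> ?X3. B u4 x = 0}"
      using u4(3)[of ?x3] by (simp add: B_linear orth orth')
    then have "?x3 - (B u4 x / B u4 u4) *s u4 \<in> radical" by (simp only: rank_le_0[OF u4(2)])
    moreover have "x - ((B u1 x / B u1 u1) *s u1 + (B u2 x / B u2 u2) *s u2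
      + (B u3 x / B u3 u3) *s u3 + (B u4 x / B u4 u4) *s u4) = ?x3 - (B u4 x / B u4 u4) *s u4"
      by (simp add: algebra_simps)
    ultimately show "x - ((B u1 x / B u1 u1) *s u1 + (B u2 x / B u2 u2) *s u2
      + (B u3 x / B u3 u3) *s u3 + (B u4 x / B u4 u4) *s u4) \<in> radical" by (simp only:)
  qed
qed

lemma \<omega>_K1_first:
  assumes "B z w = 0" "x \<in> U" "x' \<in> U"
  shows "\<omega> w x x' = B y w * \<omega> s x x'"
proof -
  have w: "w = B t w *s z + B y w *s s + B s w *s y + u w" using dec[of w] assms(1) by simp
  have "\<omega> (u w) x x' = 0" using \<omega>_norm(9)[of w x x'] assms(2,3) by (simp add: u_U)
  then show ?thesis
    using arg_cong[OF w, of "\<lambda>w. \<omega> w x x'"] UD[OF assms(2)] UD[OF assms(3)] by (simp add: \<omega>_linear fz fy)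
qed

text \<open>As \<omega> vanishes on U, its invariance under t sees only the s-components of the
  brackets. In terms of forms on U, the product of [t, y] with \<open>\<omega> s\<close> is
  zero.\<close>

lemma derivation_U:
  assumes "x1 \<in> U" "x2 \<in> U" "x3 \<in> U"
  shows "\<omega> t x1 y * \<omega> s x2 x3 - \<omega> t x2 y * \<omega> s x1 x3 + \<omega> t x3 y * \<omega> s x1 x2 = 0"
proof -
  have B0: "B z (bracket t x) = 0" "B y (bracket t x) = \<omega> t x y" for x by (simp_all add: B_bracket fz)
  have "\<omega> x1 (bracket t x2) x3 = - \<omega> (bracket t x2) x1 x3" by (rule \<omega>_swap12)
  moreover have "\<omega> x1 x2 (bracket t x3) = \<omega> (bracket t x3) x1 x2" by (rule \<omega>_rot)
  ultimately show ?thesis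
    using \<omega>_derivation[of t x1 x2 x3] assms by (simp add: \<omega>_K1_first B0)
qed

text \<open>
  The two-form \<open>\<omega> s\<close> on \<open>U\<close> is multiplied by a scalar under the skew endomorphism induced by \<open>t\<close>,
  which in characteristic zero is incompatible with a nonzero Pfaffian.
\<close>

lemma pfaffian_zero:
  assumes nc: "\<omega> t y x0 \<noteq> 0"
    and U: "u1 \<in> U" "u2 \<in> U" "u3 \<in> U" "u4 \<in> U"
    and span: "\<And>x. x \<in> U \<Longrightarrow> x - ((B u1 x / B u1 u1) *s u1 + (B u2 x / B u2 u2) *s u2
      + (B u3 x / B u3 u3) *s u3 + (B u4 x / B u4 u4) *s u4) \<in> radical"
  shows "\<omega> s u1 u2 * \<omega> s u3 u4 - \<omega> s u1 u3 * \<omega> s u2 u4 + \<omega> s u1 u4 * \<omega> s u2 u3 = 0"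
proof -
  define r12 r13 r14 r23 r24 r34 where "r12 = \<omega> s u1 u2" and "r13 = \<omega> s u1 u3" and "r14 = \<omega> s u1 u4"
    and "r23 = \<omega> s u2 u3" and "r24 = \<omega> s u2 u4" and "r34 = \<omega> s u3 u4"
  note rd = r12_def[symmetric] r13_def[symmetric] r14_def[symmetric] r23_def[symmetric] r24_def[symmetric]
    r34_def[symmetric]
  have r': "\<omega> s u2 u1 = - r12" "\<omega> s u3 u1 = - r13" "\<omega> s u4 u1 = - r14" "\<omega> s u3 u2 = - r23" "\<omega> s u4 u2 = - r24"
    "\<omega> s u4 u3 = - r34"
    unfolding r12_def r13_def r14_def r23_def r24_def r34_def by (rule \<omega>_swap23)+
  define v1 v2 v3 v4 where "v1 = \<omega> t u1 y" and "v2 = \<omega> t u2 y" and "v3 = \<omega> t u3 y" and "v4 = \<omega> t u4 y"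
  have e: "v1 * r23 - v2 * r13 + v3 * r12 = 0" "v1 * r24 - v2 * r14 + v4 * r12 = 0"
    "v1 * r34 - v3 * r14 + v4 * r13 = 0" "v2 * r34 - v3 * r24 + v4 * r23 = 0"
    using derivation_U[OF U(1) U(2) U(3)] derivation_U[OF U(1) U(2) U(4)]
      derivation_U[OF U(1) U(3) U(4)] derivation_U[OF U(2) U(3) U(4)]
    by (simp_all only: rd v1_def v2_def v3_def v4_def)
  let ?P = "r12 * r34 - r13 * r24 + r14 * r23"
  \<comment> \<open>If [t, y] has a nonzero restriction to U, it divides \<open>\<omega> s\<close>,
    whose Pfaffian is then zero.\<close>
  have "v1 * ?P = 0" "v2 * ?P = 0" "v3 * ?P = 0" "v4 * ?P = 0"
    using e by algebra+
  \<comment> \<open>Otherwise [t, y] is a multiple of y modulo \<open>radical\<close>, and by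
    \<open>nc\<close> the factor, \<open>l\<close> up to sign, is nonzero.\<close>
  moreover have "?P = 0" if v0: "v1 = 0" "v2 = 0" "v3 = 0" "v4 = 0"
  proof -
    define l where "l = \<omega> t s y"
    have tu: "\<omega> t x y = 0" if "x \<in> U" for x
    proof -
      have "\<omega> t (x - ((B u1 x / B u1 u1) *s u1 + (B u2 x / B u2 u2) *s u2
      + (B u3 x / B u3 u3) *s u3 + (B u4 x / B u4 u4) *s u4)) y = 0" by (rule \<omega>_radical(2)[OF span[OF that]])
      then show ?thesis using v0 by (simp add: \<omega>_linear v1_def v2_def v3_def v4_def)
    qed
    have l0: "l \<noteq> 0"
    proof
      assume "l = 0"
      have "\<omega> t x0 y = 0"
        using arg_cong[OF dec[of x0], of "\<lambda>x. \<omega> t x y"] tu[OF u_in_U] \<open>l = 0\<close> by (simp add: \<omega>_linear fz l_def)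
      then show False using nc \<omega>_swap23[of t y x0] by simp
    qed
    have fsw: "\<omega> s w x' = B u1 w / B u1 u1 * \<omega> s u1 x' + B u2 w / B u2 u2 * \<omega> s u2 x'
      + B u3 w / B u3 u3 * \<omega> s u3 x' + B u4 w / B u4 u4 * \<omega> s u4 x'" if "B z w = 0" "x' \<in> U" for w x'
    proof -
      have w: "w = B t w *s z + B y w *s s + B s w *s y + u w" using dec[of w] that(1) by simp
      have "\<omega> s w x' = \<omega> s (u w) x'"
        using arg_cong[OF w, of "\<lambda>w. \<omega> s w x'"] UD[OF that(2)] by (simp add: \<omega>_linear fz fy Bf)
      then show ?thesis using \<omega>_radical(2)[OF span[OF u_in_U[of w]], of s x'] by (simp add: \<omega>_linear B_u U)
    qed
    define d12 d13 d14 d23 d24 d34 where "d12 = \<omega> t u1 u2" and "d13 = \<omega> t u1 u3" and "d14 = \<omega> t u1 u4"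
      and "d23 = \<omega> t u2 u3" and "d24 = \<omega> t u2 u4" and "d34 = \<omega> t u3 u4"
    note dd = d12_def[symmetric] d13_def[symmetric] d14_def[symmetric] d23_def[symmetric] d24_def[symmetric]
      d34_def[symmetric]
    have d': "\<omega> t u2 u1 = - d12" "\<omega> t u3 u1 = - d13" "\<omega> t u4 u1 = - d14" "\<omega> t u3 u2 = - d23" "\<omega> t u4 u2 = - d24"
      "\<omega> t u4 u3 = - d34"
      unfolding d12_def d13_def d14_def d23_def d24_def d34_def by (rule \<omega>_swap23)+
    define n1 n2 n3 n4 where "n1 = inverse (B u1 u1)" and "n2 = inverse (B u2 u2)" and "n3 = inverse (B u3 u3)"
      and "n4 = inverse (B u4 u4)"
    \<comment> \<open>Invariance of \<omega> at s, x, \<open>x'\<close>: the two-form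
      \<open>\<omega> s\<close> on U is an eigenvector of t with eigenvalue
      \<open>- l\<close>.\<close>
    have rel: "l * \<omega> s x x' + (\<omega> t x u1 * n1 * \<omega> s u1 x' + \<omega> t x u2 * n2 * \<omega> s u2 x' + \<omega> t x u3 * n3 * \<omega> s u3 x'
        + \<omega> t x u4 * n4 * \<omega> s u4 x') - (\<omega> t x' u1 * n1 * \<omega> s u1 x + \<omega> t x' u2 * n2 * \<omega> s u2 x
        + \<omega> t x' u3 * n3 * \<omega> s u3 x + \<omega> t x' u4 * n4 * \<omega> s u4 x) = 0" if "x \<in> U" "x' \<in> U" for x x'
    proof -
      have "\<omega> (bracket t s) x x' = l * \<omega> s x x'"
        using \<omega>_K1_first[OF _ that, of "bracket t s"] by (simp add: B_bracket fz l_def)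
      moreover have "\<omega> s x (bracket t x') = - \<omega> s (bracket t x') x" by (rule \<omega>_swap23)
      ultimately have 1: "l * \<omega> s x x' + \<omega> s (bracket t x) x' - \<omega> s (bracket t x') x = 0"
        using \<omega>_derivation[of t s x x'] by simp
      have 2: "\<omega> s (bracket t w) w' = \<omega> t w u1 * n1 * \<omega> s u1 w' + \<omega> t w u2 * n2 * \<omega> s u2 w'
        + \<omega> t w u3 * n3 * \<omega> s u3 w' + \<omega> t w u4 * n4 * \<omega> s u4 w'" if "w' \<in> U" for w w'
        using fsw[of "bracket t w" w'] that
        by (simp add: B_bracket fz n1_def n2_def n3_def n4_def divide_inverse)
      show ?thesis using 1 unfolding 2[OF that(1)] 2[OF that(2)] .
    qed
    \<comment> \<open>The six relations paired with the complementary entries of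
      \<open>\<omega> s\<close>: the terms with \<open>l\<close> give twice the Pfaffian, and those
      from t cancel because a skew map has trace zero.\<close>
    have "2 * (l * ?P) = r34 * (l * r12 + (d13 * n3 * (- r23) + d14 * n4 * (- r24)) - (d23 * n3 * (- r13) + d24 * n4 * (- r14)))
      + r12 * (l * r34 + (- d13 * n1 * r14 - d23 * n2 * r24) - (- d14 * n1 * r13 - d24 * n2 * r23))
      - r24 * (l * r13 + (d12 * n2 * r23 + d14 * n4 * (- r34)) - (- d23 * n2 * (- r12) + d34 * n4 * (- r14)))
      - r13 * (l * r24 + (- d12 * n1 * r14 + d23 * n3 * r34) - (- d14 * n1 * r12 - d34 * n3 * (- r23)))
      + r23 * (l * r14 + (d12 * n2 * r24 + d13 * n3 * r34) - (- d24 * n2 * (- r12) - d34 * n3 * (- r13)))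
      + r14 * (l * r23 + (- d12 * n1 * r13 + d24 * n4 * (- r34)) - (- d13 * n1 * r12 + d34 * n4 * (- r24)))"
      by (simp add: algebra_simps)
    also have "\<dots> = 0"
      using rel[OF U(1) U(2)] rel[OF U(3) U(4)] rel[OF U(1) U(3)] rel[OF U(2) U(4)] rel[OF U(1) U(4)] rel[OF U(2) U(3)]
      by (simp add: rd r' dd d')
    finally show ?thesis using l0 by simp
  qed
  ultimately have "?P = 0" by auto
  then show ?thesis by (simp only: r12_def r13_def r14_def r23_def r24_def r34_def)
qed

text \<open>A Pluecker relation: with zero Pfaffian, \<open>\<omega> s p q\<close> times the
  two-form is the product of its contractions with p and q, which \<open>?a\<close> and
  \<open>?b\<close> represent through \<open>B\<close>.\<close>

lemma decomposable_if_pfaffian_zero: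
  assumes U: "p \<in> U" "q \<in> U" "p' \<in> U" "q' \<in> U" and nz: "\<omega> s p q \<noteq> 0"
    and pf: "\<omega> s p q * \<omega> s p' q' - \<omega> s p p' * \<omega> s q q' + \<omega> s p q' * \<omega> s q p' = 0"
    and span: "\<And>x. x \<in> U \<Longrightarrow> x - (g1 x *s p + g2 x *s q + g3 x *s p' + g4 x *s q') \<in> radical"
  shows "\<exists>a\<in>U. \<exists>b\<in>U. \<forall>x\<in>U. \<forall>x'\<in>U. \<omega> s x x' = B a x * B b x' - B a x' * B b x"
proof -
  let ?a = "u (bracket s p)" and ?b = "inverse (\<omega> s p q) *s u (bracket s q)"
  have "\<omega> s x x' = B ?a x * B ?b x' - B ?a x' * B ?b x" if x: "x \<in> U" "x' \<in> U" for x x'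
  proof -
  have Bu': "B (u (bracket s v)) w = \<omega> s v w" if "w \<in> U" for v w
    using B_u[OF that, of "bracket s v"] B_sym[of "u (bracket s v)" w] by (simp add: B_bracket)
  define h where "h x = g1 x *s p + g2 x *s q + g3 x *s p' + g4 x *s q'" for x
  have h: "\<omega> s v w = \<omega> s (h v) (h w)" "\<omega> s k w = \<omega> s k (h w)" if "v \<in> U" "w \<in> U" for v w k
  proof -
    have R: "v - h v \<in> radical" "w - h w \<in> radical" using span that by (simp_all add: h_def)
    show "\<omega> s k w = \<omega> s k (h w)" using \<omega>_radical(3)[OF R(2), of s k] by (simp add: \<omega>_linear)
    have "\<omega> s v w = \<omega> s (h v) w" using \<omega>_radical(2)[OF R(1), of s w] by (simp add: \<omega>_linear)
    also have "\<dots> = \<omega> s (h v) (h w)" using \<omega>_radical(3)[OF R(2), of s "h v"] by (simp add: \<omega>_linear)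
    finally show "\<omega> s v w = \<omega> s (h v) (h w)" .
  qed
  define r12 r13 r14 r23 r24 r34 where "r12 = \<omega> s p q" and "r13 = \<omega> s p p'" and "r14 = \<omega> s p q'"
    and "r23 = \<omega> s q p'" and "r24 = \<omega> s q q'" and "r34 = \<omega> s p' q'"
  note rd = r12_def[symmetric] r13_def[symmetric] r14_def[symmetric] r23_def[symmetric] r24_def[symmetric]
    r34_def[symmetric]
  have r': "\<omega> s q p = - r12" "\<omega> s p' p = - r13" "\<omega> s q' p = - r14" "\<omega> s p' q = - r23" "\<omega> s q' q = - r24"
    "\<omega> s q' p' = - r34"
    unfolding r12_def r13_def r14_def r23_def r24_def r34_def by (rule \<omega>_swap23)+
  have "r12 * \<omega> s x x' - (\<omega> s p x * \<omega> s q x' - \<omega> s p x' * \<omega> s q x)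
      = (g3 x * g4 x' - g4 x * g3 x') * (r12 * r34 - r13 * r24 + r14 * r23)"
    unfolding h(1)[OF x] h(2)[OF x, of p] h(2)[OF x, of q] h(2)[OF x(2) x(1), of p] h(2)[OF x(2) x(1), of q]
    by (simp add: h_def \<omega>_linear r' rd) (simp add: algebra_simps)
  also have "\<dots> = 0" using pf by (simp only: rd) simp
  finally have "r12 * \<omega> s x x' = \<omega> s p x * \<omega> s q x' - \<omega> s p x' * \<omega> s q x" by simp
  then show ?thesis using nz x by (simp add: Bu' B_linear rd field_simps)
  qed
  then show ?thesis
    by (intro bexI[of _ ?a] bexI[of _ ?b] ballI) (simp_all add: u_in_U subspace_scale[OF subspace_U])
qed

text \<open>A basis change of determinant 1 keeps a ^ b. If one vector is anisotropic, Gram-Schmidt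
  is such a change; if both are isotropic, a + b and half of b - a are orthogonal.\<close>

lemma orthogonal_decomposition:
  assumes ab: "a \<in> U" "b \<in> U"
  shows "\<exists>a'\<in>U. \<exists>b'\<in>U. B a' b' = 0 \<and> (\<forall>x x'. B a' x * B b' x' - B a' x' * B b' x = B a x * B b x' - B a x' * B b x)"
proof -
  note sub = subspace_add[OF subspace_U] subspace_diff[OF subspace_U] subspace_scale[OF subspace_U] ab
  show ?thesis
  proof (cases "B a a = 0")
    case False
    show ?thesis
      using False by (intro bexI[of _ a] bexI[of _ "b - (B a b / B a a) *s a"] sub)
        (simp add: B_linear algebra_simps)
  next
    case aa: True
    show ?thesis
    proof (cases "B b b = 0")
      case False
      show ?thesis
        using False by (intro bexI[of _ "a - (B a b / B b b) *s b"] bexI[of _ b] sub)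
          (simp add: B_linear algebra_simps)
    next
      case bb: True
      have "B (a + b) ((1 / 2) *s (b - a)) = 0" using aa bb B_sym[of b a] by (simp add: B_linear)
      then show ?thesis
        by (intro bexI[of _ "a + b"] bexI[of _ "(1 / 2) *s (b - a)"] sub)
          (simp add: B_linear field_simps)
    qed
  qed
qed

lemma decomposable_exists:
  assumes nc: "\<omega> t y x0 \<noteq> 0"
  shows "\<exists>a\<in>U. \<exists>b\<in>U. B a b = 0 \<and> (\<forall>x\<in>U. \<forall>x'\<in>U. \<omega> s x x' = B a x * B b x' - B a x' * B b x)"
proof -
  have "\<exists>a\<in>U. \<exists>b\<in>U. \<forall>x\<in>U. \<forall>x'\<in>U. \<omega> s x x' = B a x * B b x' - B a x' * B b x" (is ?D)
  proof -
    obtain u1 u2 u3 u4 where U: "u1 \<in> U" "u2 \<in> U" "u3 \<in> U" "u4 \<in> U"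
      and span: "\<And>x. x \<in> U \<Longrightarrow> x - ((B u1 x / B u1 u1) *s u1 + (B u2 x / B u2 u2) *s u2
        + (B u3 x / B u3 u3) *s u3 + (B u4 x / B u4 u4) *s u4) \<in> radical"
      using orthogonal_frame_U by metis
    have pf: "\<omega> s u1 u2 * \<omega> s u3 u4 - \<omega> s u1 u3 * \<omega> s u2 u4 + \<omega> s u1 u4 * \<omega> s u2 u3 = 0"
      by (rule pfaffian_zero[OF nc U span])
    have r': "\<omega> s u2 u1 = - \<omega> s u1 u2" "\<omega> s u3 u1 = - \<omega> s u1 u3" "\<omega> s u4 u1 = - \<omega> s u1 u4" "\<omega> s u3 u2 = - \<omega> s u2 u3"
      "\<omega> s u4 u2 = - \<omega> s u2 u4" "\<omega> s u4 u3 = - \<omega> s u3 u4"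
      by (rule \<omega>_swap23)+
    define g1 g2 g3 g4 where "g1 x = B u1 x / B u1 u1" and "g2 x = B u2 x / B u2 u2" and "g3 x = B u3 x / B u3 u3"
      and "g4 x = B u4 x / B u4 u4" for x
    note gd = g1_def[symmetric] g2_def[symmetric] g3_def[symmetric] g4_def[symmetric]
    have span: "x - (g1 x *s u1 + g2 x *s u2 + g3 x *s u3 + g4 x *s u4) \<in> radical" if "x \<in> U" for x
      using span[OF that] by (simp only: gd)
    show ?D
    proof (cases "\<omega> s u1 u2 = 0 \<and> \<omega> s u1 u3 = 0 \<and> \<omega> s u1 u4 = 0 \<and> \<omega> s u2 u3 = 0 \<and> \<omega> s u2 u4 = 0 \<and> \<omega> s u3 u4 = 0")
      case True
      have "\<omega> s x x' = 0" if x: "x \<in> U" "x' \<in> U" for x x'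
      proof -
        define h where "h x = g1 x *s u1 + g2 x *s u2 + g3 x *s u3 + g4 x *s u4" for x
        have R: "x - h x \<in> radical" "x' - h x' \<in> radical" using span x by (simp_all add: h_def)
        have "\<omega> s x x' = \<omega> s (x - h x) x' + \<omega> s (h x) (x' - h x') + \<omega> s (h x) (h x')" by (simp add: \<omega>_linear)
        also have "\<dots> = \<omega> s (h x) (h x')" using \<omega>_radical(2)[OF R(1)] \<omega>_radical(3)[OF R(2)] by simp
        also have "\<dots> = 0" using True by (simp add: h_def \<omega>_linear r')
        finally show ?thesis .
      qed
      then show ?D using subspace_0[OF subspace_U] by (intro bexI[of _ 0]) auto
    next
      case False
      \<comment> \<open>Any nonzero entry can be the pivot; permuting the frame changes the Pfaffian
        at most by a sign.\<close>
      then consider "\<omega> s u1 u2 \<noteq> 0" | "\<omega> s u1 u3 \<noteq> 0" | "\<omega> s u1 u4 \<noteq> 0" | "\<omega> s u2 u3 \<noteq> 0" | "\<omega> s u2 u4 \<noteq> 0"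
        | "\<omega> s u3 u4 \<noteq> 0" by blast
      then show ?D
      proof cases
        case 1 show ?D
          by (rule decomposable_if_pfaffian_zero[OF U 1 pf span])
      next
        case 2 show ?D
          by (rule decomposable_if_pfaffian_zero[OF U(1,3,2,4) 2, of g1 g3 g2 g4])
            (use pf span r' in \<open>(simp add: algebra_simps)+\<close>)
      next
        case 3 show ?D
          by (rule decomposable_if_pfaffian_zero[OF U(1,4,2,3) 3, of g1 g4 g2 g3])
            (use pf span r' in \<open>(simp add: algebra_simps)+\<close>)
      next
        case 4 show ?D
          by (rule decomposable_if_pfaffian_zero[OF U(2,3,1,4) 4, of g2 g3 g1 g4])
            (use pf span r' in \<open>(simp add: algebra_simps)+\<close>)
      next
        case 5 show ?D
          by (rule decomposable_if_pfaffian_zero[OF U(2,4,1,3) 5, of g2 g4 g1 g3])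
            (use pf span r' in \<open>(simp add: algebra_simps)+\<close>)
      next
        case 6 show ?D
          by (rule decomposable_if_pfaffian_zero[OF U(3,4,1,2) 6, of g3 g4 g1 g2])
            (use pf span r' in \<open>(simp add: algebra_simps)+\<close>)
      qed
    qed
  qed
  then obtain a b where ab: "a \<in> U" "b \<in> U" "\<forall>x\<in>U. \<forall>x'\<in>U. \<omega> s x x' = B a x * B b x' - B a x' * B b x" by blast
  obtain a' b' where ab': "a' \<in> U" "b' \<in> U" "B a' b' = 0"
    "\<forall>x x'. B a' x * B b' x' - B a' x' * B b' x = B a x * B b x' - B a x' * B b x"
    using orthogonal_decomposition[OF ab(1,2)] by blast
  have "\<forall>x\<in>U. \<forall>x'\<in>U. \<omega> s x x' = B a' x * B b' x' - B a' x' * B b' x"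
    using ab(3) ab'(4) by simp
  then show ?thesis using ab' by blast
qed

lemma y_central_if: "(\<And>x. \<omega> t y x = 0) \<Longrightarrow> \<omega> y p q = 0"
proof -
  assume ty: "\<And>x. \<omega> t y x = 0"
  define k where "k x = x - B z x *s t" for x
  have "B z (k x) = 0" for x by (simp add: k_def B_linear Bf)
  then have "\<omega> y (k p) (k q) = 0" by (intro fy1)
  moreover have "\<omega> y x t = 0" "\<omega> y t x = 0" for x using ty[of x] \<omega>_rot[of y x t] \<omega>_swap12[of y t x] by simp_all
  ultimately show ?thesis by (simp add: k_def \<omega>_linear)
qed

end

context decomposable_frame
begin

lemma exact_anisotropic_pair:
  assumes "B a a \<noteq> 0" "B b b \<noteq> 0"
  shows "\<omega> t y x = 0"
proof -
  interpret D: dual_decomposable_frame scale bracket Basis B z t y s a b "inverse (B a a) *s a" "inverse (B b b) *s b"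
    by unfold_locales (use assms aU bU in \<open>simp_all add: subspace_scale[OF subspace_U] B_linear Bb\<close>)
  show ?thesis by (rule D.anisotropic_y_central[OF assms]) simp_all
qed

text \<open>Under t, y and a are mapped into their own span. An invertible 2 by 2 matrix is what
  \<open>exact_rank_one\<close> needs; a kernel vector of a singular one commutes with t and can
  take the place of y.\<close>

lemma rank_one_case:
  assumes aa: "B a a = 0" and bb: "B b b \<noteq> 0" and aR: "a \<notin> radical"
  shows "exact_form \<omega> \<or> (\<exists>k1 k2. (k1 \<noteq> 0 \<or> k2 \<noteq> 0) \<and> (\<forall>x. \<omega> t (k1 *s y + k2 *s a) x = 0) \<and> k1 *s y + k2 *s a \<notin> radical)"
proof -
  let ?X = "{x \<in> U. B b x = 0}"
  have ndU: "nondegenerate U" "dim U \<le> 4 + dim radical" using rkU by (simp_all add: rank_le_def U_def)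
  have rkX: "rank_le (Suc (Suc 1)) ?X" using nondegenerate_perp1(1,2)[OF ndU(1) bU bb] ndU(2) by (simp add: rank_le_def)
  then have ndX: "nondegenerate ?X" by (simp add: rank_le_def)
  have aX: "a \<in> ?X" using aU by (simp add: Bb)
  obtain sa where sa: "sa \<in> ?X" "B a sa = 1" "B sa sa = 0" by (rule dual_exists[OF ndX aX aR aa])
  let ?X' = "{x \<in> ?X. B a x = 0 \<and> B sa x = 0}"
  have "rank_le (Suc 0) ?X'" using rank_le_perp2[OF rkX aX aa sa] by simp
  then obtain c where c: "c \<in> ?X'" "rank_le 0 {x \<in> ?X'. B c x = 0}"
    "\<And>x. x \<in> ?X' \<Longrightarrow> x - (B c x / B c c) *s c \<in> {x \<in> ?X'. B c x = 0}" using rank_le_Suc by blast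
  have sab: "B sa b = 0" "B sa a = 1" using sa B_sym[of sa b] B_sym[of sa a] by simp_all
  have cb: "B c b = 0" "B c a = 0" "B c sa = 0" using c(1) B_sym[of c b] B_sym[of c a] B_sym[of c sa] by simp_all
  have span: "x - (B a x *s sa + B sa x *s a + (B b x / B b b) *s b + (B c x / B c c) *s c) \<in> radical"
    if "x \<in> U" for x
  proof -
    let ?x1 = "x - (B b x / B b b) *s b"
    let ?x2 = "?x1 - B a ?x1 *s sa - B sa ?x1 *s a"
    have x1: "B a ?x1 = B a x" "B sa ?x1 = B sa x" by (simp_all add: B_linear Bb sab)
    have "?x1 \<in> ?X" by (rule nondegenerate_perp1(3)[OF ndU(1) bU bb that])
    then have "?x2 \<in> ?X'" by (rule nondegenerate_perp2(3)[OF ndX aX aa sa])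
    moreover have "B c ?x2 = B c x" by (simp add: B_linear cb)
    ultimately have "?x2 - (B c x / B c c) *s c \<in> {x \<in> ?X'. B c x = 0}" using c(3)[of ?x2] by (simp only:)
    then have "?x2 - (B c x / B c c) *s c \<in> radical" by (simp only: rank_le_0[OF c(2)])
    moreover have "x - (B a x *s sa + B sa x *s a + (B b x / B b b) *s b + (B c x / B c c) *s c)
        = ?x2 - (B c x / B c c) *s c" unfolding x1 by (simp add: algebra_simps)
    ultimately show ?thesis by (simp only:)
  qed
  have saU: "sa \<in> U" using sa by simp
  interpret D: dual_decomposable_frame scale bracket Basis B z t y s a b sa "inverse (B b b) *s b"
    by unfold_locales (use bb saU sa bU in \<open>simp_all add: subspace_scale[OF subspace_U] B_linear Bb\<close>)
  show ?thesis
  proof (cases "\<omega> t y s * \<omega> t a sa = \<omega> t y sa * \<omega> t a s")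
    case False
    have "exact_form \<omega>"
      by (rule D.exact_rank_one[OF aa bb refl sa(3) _ _ _ _ span False]) (use c in auto)
    then show ?thesis ..
  next
    case True
    have yb: "\<omega> t y b = 0" "\<omega> t a b = 0"
      using D.action_zero(2)[of b y] D.action_zero(2)[of b a] aa by (simp_all add: D.Ball)
    obtain k1 k2 where k: "k1 \<noteq> 0 \<or> k2 \<noteq> 0" "k1 * \<omega> t y s + k2 * \<omega> t a s = 0" "k1 * \<omega> t y sa + k2 * \<omega> t a sa = 0"
      using proportional_triples[of "\<omega> t y s" "\<omega> t a sa" "\<omega> t y sa" "\<omega> t a s" 0 0] True by auto
    have "\<omega> t (k1 *s y + k2 *s a) x = 0" for x
    proof -
      have "\<omega> t (k1 *s y + k2 *s a) x = (k1 * \<omega> t y s + k2 * \<omega> t a s) * B y x + (k1 * \<omega> t y sa + k2 * \<omega> t a sa) * B a x"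
        using D.action[of y x] D.action[of a x] yb by (simp add: \<omega>_linear algebra_simps)
      then show ?thesis using k by simp
    qed
    moreover have "k1 *s y + k2 *s a \<notin> radical"
    proof
      assume "k1 *s y + k2 *s a \<in> radical"
      then have "B (k1 *s y + k2 *s a) s = 0" "B (k1 *s y + k2 *s a) sa = 0" by (simp_all only: B_radical)
      then show False using k(1) by (simp add: B_linear D.Ball)
    qed
    ultimately show ?thesis using k(1) by blast
  qed
qed

lemma rank_zero_case:
  assumes iso: "B a a = 0" "B b b = 0" and r: "x0 \<in> U" "x1 \<in> U" "\<omega> s x0 x1 \<noteq> 0"
  shows "exact_form \<omega>"
proof -
  define r where "r = \<omega> s x0 x1"
  have r': "r = B a x0 * B b x1 - B a x1 * B b x0" "r \<noteq> 0" using fs r by (simp_all add: r_def)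
  \<comment> \<open>Cramer's rule for the vectors in the span of \<open>x0\<close> and
    \<open>x1\<close> dual to a and b, with determinant r.\<close>
  define sa0 where "sa0 = inverse r *s (B b x1 *s x0 - B b x0 *s x1)"
  define sb0 where "sb0 = inverse r *s (B a x0 *s x1 - B a x1 *s x0)"
  have "B a sa0 = inverse r * r" "B b sb0 = inverse r * r"
    unfolding sa0_def sb0_def B_linear by (simp_all add: r'(1) algebra_simps)
  then have d0: "B a sa0 = 1" "B b sa0 = 0" "B a sb0 = 0" "B b sb0 = 1"
    using r'(2) by (simp_all add: sa0_def sb0_def B_linear)
  note sub = subspace_add[OF subspace_U] subspace_diff[OF subspace_U] subspace_scale[OF subspace_U] r(1,2) aU bU
  have s0U: "sa0 \<in> U" "sb0 \<in> U" unfolding sa0_def sb0_def by (intro sub)+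
  have d0': "B sa0 a = 1" "B sa0 b = 0" "B sb0 a = 0" "B sb0 b = 1"
    using d0 B_sym[of sa0 a] B_sym[of sa0 b] B_sym[of sb0 a] B_sym[of sb0 b] by simp_all
  \<comment> \<open>Since a and b span an isotropic plane, corrections inside it make
    \<open>sa\<close> and \<open>sb\<close> span one too and keep the pairings with a and b.\<close>
  define sa where "sa = sa0 - (B sa0 sa0 / 2) *s a"
  define sb where "sb = sb0 - (B sb0 sb0 / 2) *s b - B sa0 sb0 *s a"
  have sU: "sa \<in> U" "sb \<in> U" unfolding sa_def sb_def by (intro sub s0U)+
  have d: "B a sa = 1" "B b sa = 0" "B a sb = 0" "B b sb = 1" "B sa sa = 0" "B sb sb = 0" "B sa sb = 0"
    using B_sym[of sb0 sa0] by (simp_all add: sa_def sb_def B_linear d0 d0' Bb iso)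
  have d': "B sa a = 1" "B sa b = 0" "B sb a = 0" "B sb b = 1" "B sb sa = 0"
    using d B_sym[of sa a] B_sym[of sa b] B_sym[of sb a] B_sym[of sb b] B_sym[of sb sa] by simp_all
  interpret D: dual_decomposable_frame scale bracket Basis B z t y s a b sa sb
    by unfold_locales (use sU d in simp_all)
  have rkU': "rank_le (Suc (Suc 2)) U" using rkU by (simp add: U_def eval_nat_numeral)
  then have ndU: "nondegenerate U" by (simp add: rank_le_def)
  let ?X = "{x \<in> U. B a x = 0 \<and> B sa x = 0}"
  have "rank_le 2 ?X" by (rule rank_le_perp2[OF rkU' aU iso(1) sU(1) d(1) d(5)])
  then have rkX: "rank_le (Suc (Suc 0)) ?X" by (simp add: eval_nat_numeral)
  then have ndX: "nondegenerate ?X" by (simp add: rank_le_def)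
  have bX: "b \<in> ?X" "sb \<in> ?X" using bU sU Bb d d' by simp_all
  let ?X' = "{x \<in> ?X. B b x = 0 \<and> B sb x = 0}"
  have rkX': "rank_le 0 ?X'" by (rule rank_le_perp2[OF rkX bX(1) iso(2) bX(2) d(4) d(6)])
  have span: "x - (B a x *s sa + B sa x *s a + B b x *s sb + B sb x *s b) \<in> radical" if "x \<in> U" for x
  proof -
    let ?x1 = "x - B a x *s sa - B sa x *s a"
    let ?x2 = "?x1 - B b ?x1 *s sb - B sb ?x1 *s b"
    have x1: "B b ?x1 = B b x" "B sb ?x1 = B sb x" by (simp_all add: B_linear Bb d d')
    have "?x1 \<in> ?X" by (rule nondegenerate_perp2(3)[OF ndU aU iso(1) sU(1) d(1) d(5) that])
    then have "?x2 \<in> ?X'" by (rule nondegenerate_perp2(3)[OF ndX bX(1) iso(2) bX(2) d(4) d(6)])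
    then have "?x2 \<in> radical" by (simp only: rank_le_0[OF rkX'])
    moreover have "x - (B a x *s sa + B sa x *s a + B b x *s sb + B sb x *s b) = ?x2"
      unfolding x1 by (simp add: algebra_simps)
    ultimately show ?thesis by (simp only:)
  qed
  show ?thesis by (rule D.exact_rank_zero[OF iso d(5,6,7) span])
qed

end

section \<open>Exactness of the invariant three-form\<close>

context quadratic_lie_algebra
begin

text \<open>Isotropic vectors of \<open>z\<^sup>\<perp>\<close> whose functional divides the restriction of \<open>\<omega>\<close> to \<open>z\<^sup>\<perp>\<close>.\<close>

definition dividing :: "'a \<Rightarrow> 'a \<Rightarrow> 'a \<Rightarrow> bool" where
  "dividing z t y \<longleftrightarrow> B z y = 0 \<and> B t y = 0 \<and> y \<notin> radical \<and> B y y = 0 \<and>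
    (\<forall>a b. B z a = 0 \<longrightarrow> B z b = 0 \<longrightarrow> \<omega> y a b = 0) \<and>
    (\<forall>a b c. B z a = 0 \<longrightarrow> B z b = 0 \<longrightarrow> B z c = 0 \<longrightarrow> B y a = 0 \<longrightarrow> B y b = 0 \<longrightarrow> B y c = 0 \<longrightarrow>
      \<omega> a b c = 0)"

lemma adapted_frame_exists:
  assumes fz: "\<And>a b. \<omega> z a b = 0" and zz: "B z z = 0" and zt: "B z t = 1" and tt: "B t t = 0"
    and rkH: "rank_le 6 {x. B z x = 0 \<and> B t x = 0}" and y: "dividing z t y"
  obtains s where "adapted_frame scale bracket Basis B z t y s"
proof -
  let ?H = "{x. B z x = 0 \<and> B t x = 0}"
  have y': "B z y = 0" "B t y = 0" "y \<notin> radical" "B y y = 0" "y \<in> ?H" using y by (simp_all add: dividing_def)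
  have ndH: "nondegenerate ?H" using rkH by (simp add: rank_le_def)
  obtain s where s: "s \<in> ?H" "B y s = 1" "B s s = 0" by (rule dual_exists[OF ndH y'(5,3,4)])
  have "rank_le (Suc (Suc 4)) ?H" using rkH by (simp add: eval_nat_numeral)
  then have "rank_le 4 {x \<in> ?H. B y x = 0 \<and> B s x = 0}" by (rule rank_le_perp2[OF _ y'(5,4) s])
  then have "rank_le 4 {x. B z x = 0 \<and> B t x = 0 \<and> B y x = 0 \<and> B s x = 0}" by simp
  then have "adapted_frame scale bracket Basis B z t y s"
    using fz zz zt tt y' s y by unfold_locales (simp_all add: dividing_def)
  then show ?thesis by (rule that)
qed

lemma invariant_form_exact:
  assumes solv: "solvable" and dim: "dim (UNIV :: 'a set) \<le> 8"
  shows "exact_form \<omega>"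
proof (cases "\<exists>x y w. \<omega> x y w \<noteq> 0")
  case False
  then show ?thesis using exact_form_cong[OF exact_form_zero] by metis
next
  case nz0: True
  then have nz0': "\<exists>x\<in>UNIV. \<exists>y\<in>UNIV. \<exists>w\<in>UNIV. \<omega> x y w \<noteq> 0" by simp
  have rad: "\<omega> r x y = 0" if "\<And>k. k \<in> UNIV \<Longrightarrow> B r k = 0" for r x y
    using \<omega>_radical(1)[of r x y] that by (simp add: radical_iff)
  obtain z k where z: "B z k \<noteq> 0" "B z z = 0" "\<And>a b. \<omega> z a b = 0"
  proof (rule central_isotropic_exists[OF solv subspace_UNIV UNIV_I rad nz0'])
    fix y k assume "B y k \<noteq> 0" "B y y = 0" "\<And>a b. a \<in> UNIV \<Longrightarrow> b \<in> UNIV \<Longrightarrow> \<omega> y a b = 0"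
    then show thesis by (intro that[of y k]) simp_all
  qed
  have zR: "z \<notin> radical" using z(1) B_radical by blast
  obtain t where t: "B z t = 1" "B t t = 0" by (rule dual_exists[OF nondegenerate_UNIV UNIV_I zR z(2)])
  show ?thesis
  proof (cases "\<exists>a b c. B z a = 0 \<and> B z b = 0 \<and> B z c = 0 \<and> \<omega> a b c \<noteq> 0")
    case False
    show ?thesis by (rule exact_form_divisible_by_closed[of z t]) (use z t False in auto)
  next
    case nz: True
    have "rank_le (Suc (Suc 6)) UNIV" using dim nondegenerate_UNIV by (simp add: rank_le_def)
    from rank_le_perp2[OF this UNIV_I z(2) UNIV_I t] have rkH: "rank_le 6 {x. B z x = 0 \<and> B t x = 0}" by simp
    have central: "exact_form \<omega>" if y: "dividing z t y" and fy0: "\<And>a b. \<omega> y a b = 0" for y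
    proof -
      obtain s where "adapted_frame scale bracket Basis B z t y s"
        by (rule adapted_frame_exists[OF z(3) z(2) t rkH y])
      then interpret A: adapted_frame scale bracket Basis B z t y s .
      interpret C: central_frame scale bracket Basis B z t y s by unfold_locales (rule fy0)
      show ?thesis by (rule C.central_frame_exact)
    qed
    obtain y where y: "dividing z t y"
      using dividing_vector_exists[OF solv z(3) z(2) t rkH nz] unfolding dividing_def by blast
    obtain s where "adapted_frame scale bracket Basis B z t y s"
      by (rule adapted_frame_exists[OF z(3) z(2) t rkH y])
    then interpret A: adapted_frame scale bracket Basis B z t y s .
    show ?thesis
    proof (cases "\<forall>x. \<omega> t y x = 0")
      case True
      then show ?thesis using central[OF y] A.y_central_if by blast
    next
      case False
      then obtain xx where nc: "\<omega> t y xx \<noteq> 0" by blast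
      obtain a b where ab: "a \<in> A.U" "b \<in> A.U" "B a b = 0"
        "\<forall>x\<in>A.U. \<forall>x'\<in>A.U. \<omega> s x x' = B a x * B b x' - B a x' * B b x"
        using A.decomposable_exists[OF nc] by blast
      \<comment> \<open>If \<open>\<omega> s\<close> were zero on U, the frame with a = b = 0 would
        make \<omega> vanish on the complement of z, against \<open>nz\<close>.\<close>
      have "\<exists>x0\<in>A.U. \<exists>x1\<in>A.U. \<omega> s x0 x1 \<noteq> 0"
      proof (rule ccontr)
        assume "\<not> ?thesis"
        then interpret Z: decomposable_frame scale bracket Basis B z t y s 0 0
          by unfold_locales (auto intro: subspace_0[OF A.subspace_U])
        show False using nz Z.\<omega>_K1 by (auto simp: wedge3_def)
      qed
      then obtain x0 x1 where x: "x0 \<in> A.U" "x1 \<in> A.U" "\<omega> s x0 x1 \<noteq> 0" by blast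
      have rank1: "exact_form \<omega>" if frame: "decomposable_frame scale bracket Basis B z t y s a b"
        and iso: "B a a = 0" "B b b \<noteq> 0" for a b
      proof -
        interpret D: decomposable_frame scale bracket Basis B z t y s a b by (rule frame)
        have "a \<notin> radical" using D.fs[OF x(1,2)] x(3) B_radical by auto
        show ?thesis
        proof (rule ccontr)
          assume "\<not> exact_form \<omega>"
          then obtain k1 k2 where k: "k1 \<noteq> 0 \<or> k2 \<noteq> 0" and 0: "\<forall>x. \<omega> t (k1 *s y + k2 *s a) x = 0"
            and nR: "k1 *s y + k2 *s a \<notin> radical"
            using D.rank_one_case[OF iso \<open>a \<notin> radical\<close>] by blast
          \<comment> \<open>As a nonzero combination of y and a, \<open>y'\<close> still divides y ^
            a ^ b; commuting with t, it is central, so the central case applies with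
            \<open>y'\<close> in place of y.\<close>
          define y' where "y' = k1 *s y + k2 *s a"
          have By: "B y' x = k1 * B y x + k2 * B a x" for x by (simp add: y'_def B_linear)
          have bas: "B z y' = 0" "B t y' = 0" "B y y' = 0" "B a y' = 0" "B b y' = 0"
            by (simp_all add: y'_def B_linear D.Ba D.Bb iso A.Bf)
          have y': "dividing z t y'"
            unfolding dividing_def
          proof (intro conjI allI impI)
            show "y' \<notin> radical" using nR by (simp add: y'_def)
            show "B y' y' = 0" unfolding By by (simp add: bas)
            show "\<omega> y' p q = 0" if "B z p = 0" "B z q = 0" for p q
              using D.\<omega>_K1[of y' p q] that bas by (simp add: wedge3_def)
            show "\<omega> p q r = 0" if K: "B z p = 0" "B z q = 0" "B z r = 0" and P: "B y' p = 0" "B y' q = 0" "B y' r = 0"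
              for p q r
            proof -
              have "k1 * wedge3 y a b p q r = wedge3 y' a b p q r" "k2 * wedge3 y a b p q r = wedge3 y y' b p q r"
                by (simp_all add: wedge3_def By algebra_simps)
              then have "k1 * wedge3 y a b p q r = 0" "k2 * wedge3 y a b p q r = 0"
                using P by (simp_all add: wedge3_def)
              then show ?thesis using D.\<omega>_K1[OF K] k by auto
            qed
          qed (use bas in auto)
          obtain s' where "adapted_frame scale bracket Basis B z t y' s'"
            by (rule adapted_frame_exists[OF z(3) z(2) t rkH y'])
          then interpret A': adapted_frame scale bracket Basis B z t y' s' .
          have "exact_form \<omega>"
            by (rule central[OF y']) (rule A'.y_central_if, use 0 in \<open>simp add: y'_def\<close>)
          then show False using \<open>\<not> exact_form \<omega>\<close> by contradiction
        qed
      qed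
      have frame: "decomposable_frame scale bracket Basis B z t y s a b"
        by unfold_locales (use ab in auto)
      then interpret D: decomposable_frame scale bracket Basis B z t y s a b .
      consider "B a a = 0" "B b b = 0" | "B a a = 0" "B b b \<noteq> 0" | "B a a \<noteq> 0" "B b b = 0"
        | "B a a \<noteq> 0" "B b b \<noteq> 0" by blast
      then show ?thesis
      proof cases
        case 1 then show ?thesis by (rule D.rank_zero_case[OF _ _ x])
      next
        case 2 then show ?thesis by (rule rank1[OF frame])
      next
        case 3
        \<comment> \<open>Exchanges the roles of a and b; the sign keeps the product a ^ b.\<close>
        have "decomposable_frame scale bracket Basis B z t y s b (- a)"
          by unfold_locales (use ab in \<open>auto simp: subspace_neg[OF A.subspace_U] B_linear D.Bb\<close>)
        then show ?thesis by (rule rank1) (use 3 in \<open>simp_all add: B_linear\<close>)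
      next
        case 4 then show ?thesis using D.exact_anisotropic_pair nc by simp
      qed
    qed
  qed
qed

end

section \<open>From functionals to the Killing module\<close>

lemma linear_extension_superset:
  assumes "finite A" "Poly_Mapping.keys p \<subseteq> A"
  shows "linear_extension g p = (\<Sum>w\<in>A. free_scale (Poly_Mapping.lookup p w) (g w))"
  unfolding linear_extension_def
  by (rule sum.mono_neutral_left) (use assms in \<open>auto simp: in_keys_iff\<close>)

lemma linear_extension_add: "linear_extension g (p + q) = linear_extension g p + linear_extension g q"
proof -
  let ?A = "Poly_Mapping.keys p \<union> Poly_Mapping.keys q"
  have "Poly_Mapping.keys (p + q) \<subseteq> ?A" by (rule Poly_Mapping.keys_add)
  then show ?thesis
    by (simp add: linear_extension_superset[of ?A] lookup_add free.scale_left_distrib sum.distrib)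
qed

lemma linear_extension_scale: "linear_extension g (free_scale c p) = free_scale c (linear_extension g p)"
proof -
  have "Poly_Mapping.keys (free_scale c p) \<subseteq> Poly_Mapping.keys p" by (auto simp: in_keys_iff)
  then show ?thesis
    by (simp add: linear_extension_superset[of "Poly_Mapping.keys p"] free.scale_sum_right)
qed

lemma linear_extension_word [simp]: "linear_extension g (word w) = g w"
  by (simp add: linear_extension_def word_def)

lemma linear_extension_minus: "linear_extension g (- p) = - linear_extension g p"
  using linear_extension_scale[of g "-1" p] by simp

lemma linear_extension_zero [simp]: "linear_extension g 0 = 0"
  by (simp add: linear_extension_def)

lemma linear_extension_words: "linear_extension word p = p"
proof (rule poly_mapping_eqI)
  fix v
  have "Poly_Mapping.lookup (linear_extension word p) v
      = (\<Sum>w\<in>Poly_Mapping.keys p. if w = v then Poly_Mapping.lookup p w else 0)"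
    unfolding linear_extension_def lookup_sum word_def
    by (rule sum.cong) (auto simp: lookup_single when_def)
  also have "\<dots> = Poly_Mapping.lookup p v" by (simp add: in_keys_iff)
  finally show "Poly_Mapping.lookup (linear_extension word p) v = Poly_Mapping.lookup p v" .
qed

definition linear_functional :: "(('w \<Rightarrow>\<^sub>0 'k::field) \<Rightarrow> 'k) \<Rightarrow> bool" where
  "linear_functional \<phi> \<longleftrightarrow> (\<forall>p q. \<phi> (p + q) = \<phi> p + \<phi> q) \<and> (\<forall>c p. \<phi> (free_scale c p) = c * \<phi> p)"

context
  fixes \<phi> :: "('w \<Rightarrow>\<^sub>0 'k::field) \<Rightarrow> 'k"
  assumes \<phi>: "linear_functional \<phi>"
begin

lemma functional_add: "\<phi> (p + q) = \<phi> p + \<phi> q"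
  and functional_scale: "\<phi> (free_scale c p) = c * \<phi> p"
  using \<phi> by (simp_all add: linear_functional_def)

lemma functional_zero [simp]: "\<phi> 0 = 0"
  using functional_scale[of 0 0] by simp

lemma functional_minus: "\<phi> (- p) = - \<phi> p"
  using functional_scale[of "-1" p] by simp

lemma functional_diff: "\<phi> (p - q) = \<phi> p - \<phi> q"
  by (simp only: diff_conv_add_uminus functional_add functional_minus)

lemma functional_sum: "\<phi> (sum g A) = (\<Sum>a\<in>A. \<phi> (g a))"
  by (induction A rule: infinite_finite_induct) (simp_all add: functional_add)

lemma functional_linear_extension:
  "\<phi> (linear_extension g p) = (\<Sum>w\<in>Poly_Mapping.keys p. Poly_Mapping.lookup p w * \<phi> (g w))"
  by (simp add: linear_extension_def functional_sum functional_scale)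

lemma functional_expand: "\<phi> p = (\<Sum>w\<in>Poly_Mapping.keys p. Poly_Mapping.lookup p w * \<phi> (word w))"
  using functional_linear_extension[of word p] by (simp add: linear_extension_words)

lemma functional_zero_on_span: "(\<And>s. s \<in> S \<Longrightarrow> \<phi> s = 0) \<Longrightarrow> p \<in> free.span S \<Longrightarrow> \<phi> p = 0"
proof -
  assume S: "\<And>s. s \<in> S \<Longrightarrow> \<phi> s = 0" and p: "p \<in> free.span S"
  have "free.subspace {p. \<phi> p = 0}"
    by (auto simp: free.subspace_def functional_add functional_scale)
  then have "free.span S \<subseteq> {p. \<phi> p = 0}" by (intro free.span_minimal) (use S in auto)
  then show ?thesis using p by blast
qed

end

lemma functional_comp:
  "linear_functional \<phi> \<Longrightarrow> linear_functional (\<lambda>p. \<phi> (linear_extension g p))"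
  unfolding linear_functional_def by (simp add: linear_extension_add linear_extension_scale)

text \<open>The free space on \<open>unit\<close> is a line, so reading off the coefficient of a
  linear extension into it gives a scalar-valued extension.\<close>

lemma functional_exists:
  obtains \<chi> :: "('w \<Rightarrow>\<^sub>0 'k::field) \<Rightarrow> 'k" where "linear_functional \<chi>" "\<And>w. \<chi> (word w) = g w"
proof
  let ?e = "\<lambda>p. Poly_Mapping.lookup (linear_extension (\<lambda>w. free_scale (g w) (word ())) p) ()"
  show "linear_functional ?e"
    by (simp add: linear_functional_def linear_extension_add linear_extension_scale lookup_add)
  have "Poly_Mapping.lookup (word () :: unit \<Rightarrow>\<^sub>0 'k) () = 1" by (simp add: word_def lookup_single)
  then show "?e (word w) = g w" for w by simp
qed

text \<open>Makes it possible to prove membership in the spaces of relations dually, by identities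
  between forms instead of explicit linear combinations of words.\<close>

lemma in_span_if_functionals:
  fixes p :: "'w \<Rightarrow>\<^sub>0 'k::field"
  assumes "\<And>\<phi>. linear_functional \<phi> \<Longrightarrow> (\<And>s. s \<in> S \<Longrightarrow> \<phi> s = 0) \<Longrightarrow> \<phi> p = 0"
  shows "p \<in> free.span S"
proof (rule ccontr)
  assume p: "p \<notin> free.span S"
  show False
  proof (rule vector_space.separating_functional[OF free.vector_space_axioms p])
    fix \<phi> :: "('w \<Rightarrow>\<^sub>0 'k) \<Rightarrow> 'k"
    assume \<phi>: "\<And>x y. \<phi> (x + y) = \<phi> x + \<phi> y" "\<And>c x. \<phi> (free_scale c x) = c * \<phi> x"
      and 0: "\<And>x. x \<in> free.span S \<Longrightarrow> \<phi> x = 0" and 1: "\<phi> p = 1"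
    have "\<phi> p = 0"
    proof (rule assms)
      show "linear_functional \<phi>" unfolding linear_functional_def using \<phi> by blast
      show "\<phi> s = 0" if "s \<in> S" for s by (rule 0) (rule free.span_base[OF that])
    qed
    then show False using 1 by simp
  qed
qed

section \<open>Cosets and induced maps\<close>

lemma induced_map_eq:
  assumes "c \<noteq> {}" "\<And>x. x \<in> c \<Longrightarrow> g x = v" shows "induced_map g c = v"
proof -
  have "g ` c = {v}" using assms by auto
  then show ?thesis by (simp add: induced_map_def)
qed

context
  fixes W :: "('w \<Rightarrow>\<^sub>0 'k::field) set"
  assumes W: "free.subspace W"
begin

lemma mem_coset: "q \<in> p +o W \<longleftrightarrow> q - p \<in> W"
proof
  assume "q \<in> p +o W"
  then obtain r where "r \<in> W" "q = p + r" by (auto simp: elt_set_plus_def)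
  then show "q - p \<in> W" by simp
next
  assume "q - p \<in> W"
  then have "p + (q - p) \<in> p +o W" by (rule set_plus_intro2)
  then show "q \<in> p +o W" by simp
qed

lemma coset_eq: "p +o W = q +o W \<longleftrightarrow> p - q \<in> W"
proof
  assume "p +o W = q +o W"
  moreover have "p \<in> p +o W" using W by (simp add: mem_coset free.subspace_0)
  ultimately show "p - q \<in> W" by (simp add: mem_coset)
next
  assume pq: "p - q \<in> W"
  show "p +o W = q +o W"
  proof (rule set_eqI)
    fix x
    have "x - q = (x - p) + (p - q)" "x - p = (x - q) - (p - q)" by simp_all
    then have "x - p \<in> W \<longleftrightarrow> x - q \<in> W"
      using free.subspace_add[OF W _ pq] free.subspace_diff[OF W _ pq] by metis
    then show "x \<in> p +o W \<longleftrightarrow> x \<in> q +o W" by (simp only: mem_coset)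
  qed
qed

lemma coset_zero: "0 +o W = W"
  by (auto simp: elt_set_plus_def)

lemma coset_add: "(p +o W) + (q +o W) = (p + q) +o W"
proof
  show "(p +o W) + (q +o W) \<subseteq> (p + q) +o W"
  proof
    fix x assume "x \<in> (p +o W) + (q +o W)"
    then obtain a b where ab: "x = a + b" "a - p \<in> W" "b - q \<in> W"
      unfolding set_plus_def mem_coset[symmetric] by blast
    have e: "x - (p + q) = (a - p) + (b - q)" by (simp add: ab(1))
    have "x - (p + q) \<in> W" unfolding e by (rule free.subspace_add[OF W ab(2,3)])
    then show "x \<in> (p + q) +o W" by (simp only: mem_coset)
  qed
  show "(p + q) +o W \<subseteq> (p +o W) + (q +o W)"
  proof
    fix x assume "x \<in> (p + q) +o W"
    moreover have "(x - q) - p = x - (p + q)" by simp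
    ultimately have "(x - q) - p \<in> W" unfolding mem_coset by (simp only:)
    then have "x - q \<in> p +o W" by (simp only: mem_coset)
    moreover have "q \<in> q +o W" using W by (simp add: mem_coset free.subspace_0)
    ultimately have "(x - q) + q \<in> (p +o W) + (q +o W)" by (rule set_plus_intro)
    then show "x \<in> (p +o W) + (q +o W)" by simp
  qed
qed

end

context lie_algebra
begin

definition multilinear :: "nat \<Rightarrow> ('a list \<Rightarrow> 'k) \<Rightarrow> bool" where
  "multilinear n g \<longleftrightarrow>
    (\<forall>w i x y. length w = n \<longrightarrow> i < n \<longrightarrow> g (w[i := x + y]) = g (w[i := x]) + g (w[i := y])) \<and>
    (\<forall>w i c x. length w = n \<longrightarrow> i < n \<longrightarrow> g (w[i := c *s x]) = c * g (w[i := x]))"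

definition alternating :: "nat \<Rightarrow> ('a list \<Rightarrow> 'k) \<Rightarrow> bool" where
  "alternating n g \<longleftrightarrow> (\<forall>w i j. length w = n \<longrightarrow> i < j \<longrightarrow> j < n \<longrightarrow> w ! i = w ! j \<longrightarrow> g w = 0)"

lemma zero_on_multilinearity_iff:
  assumes \<phi>: "linear_functional \<phi>"
  shows "(\<forall>p\<in>multilinearity n. \<phi> p = 0) \<longleftrightarrow> multilinear n (\<lambda>w. \<phi> (word w))"
proof
  assume 0: "\<forall>p\<in>multilinearity n. \<phi> p = 0"
  show "multilinear n (\<lambda>w. \<phi> (word w))"
    unfolding multilinear_def
  proof (intro conjI allI impI)
    fix w :: "'a list" and i x y assume "length w = n" "i < n"
    then have "\<phi> (word (w[i := x + y]) - word (w[i := x]) - word (w[i := y])) = 0"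
      using 0 unfolding multilinearity_def by blast
    then show "\<phi> (word (w[i := x + y])) = \<phi> (word (w[i := x])) + \<phi> (word (w[i := y]))"
      unfolding functional_diff[OF \<phi>] by (simp add: algebra_simps)
  next
    fix w :: "'a list" and i c x assume "length w = n" "i < n"
    then have "\<phi> (word (w[i := c *s x]) - free_scale c (word (w[i := x]))) = 0"
      using 0 unfolding multilinearity_def by blast
    then show "\<phi> (word (w[i := c *s x])) = c * \<phi> (word (w[i := x]))"
      by (simp add: functional_diff[OF \<phi>] functional_scale[OF \<phi>])
  qed
next
  assume "multilinear n (\<lambda>w. \<phi> (word w))"
  then show "\<forall>p\<in>multilinearity n. \<phi> p = 0"
    by (auto simp: multilinearity_def multilinear_def functional_diff[OF \<phi>] functional_scale[OF \<phi>])
qed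

text \<open>The universal property of the exterior power in dual form, read off on the generators of
  the relations.\<close>

lemma zero_on_exterior_iff:
  assumes \<phi>: "linear_functional \<phi>"
  shows "(\<forall>p\<in>exterior_relations n. \<phi> p = 0) \<longleftrightarrow>
    multilinear n (\<lambda>w. \<phi> (word w)) \<and> alternating n (\<lambda>w. \<phi> (word w))"
proof -
  let ?A = "{word w | w. length w = n \<and> (\<exists>i j. i < j \<and> j < n \<and> w ! i = w ! j)} :: ('a list \<Rightarrow>\<^sub>0 'k) set"
  have 1: "(\<forall>p\<in>?A. \<phi> p = 0) \<longleftrightarrow> alternating n (\<lambda>w. \<phi> (word w))"
    unfolding alternating_def by (auto simp del: split_paired_All)
  have "(\<forall>p\<in>exterior_relations n. \<phi> p = 0) \<longleftrightarrow> (\<forall>p\<in>multilinearity n \<union> ?A. \<phi> p = 0)"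
    unfolding exterior_relations_def
  proof
    assume 0: "\<forall>p\<in>free.span (multilinearity n \<union> ?A). \<phi> p = 0"
    show "\<forall>p\<in>multilinearity n \<union> ?A. \<phi> p = 0" by (rule ballI, rule bspec[OF 0], rule free.span_base)
  next
    assume 0: "\<forall>p\<in>multilinearity n \<union> ?A. \<phi> p = 0"
    show "\<forall>p\<in>free.span (multilinearity n \<union> ?A). \<phi> p = 0"
      by (rule ballI, rule functional_zero_on_span[OF \<phi> bspec[OF 0]])
  qed
  then show ?thesis unfolding ball_Un zero_on_multilinearity_iff[OF \<phi>] 1 .
qed

lemma subspace_relations:
  "free.subspace (exterior_relations n)" "free.subspace symmetric_relations" "free.subspace (tensor_relations n)"
  by (simp_all add: exterior_relations_def symmetric_relations_def tensor_relations_def)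

text \<open>Tested on functionals that kill the target relations: these are alternating m-forms, and
  their pullbacks along g are alternating n-forms, which kill p.\<close>

lemma map_into_exterior:
  assumes "\<And>\<phi>. linear_functional \<phi> \<Longrightarrow> multilinear m (\<lambda>w. \<phi> (word w)) \<Longrightarrow> alternating m (\<lambda>w. \<phi> (word w)) \<Longrightarrow>
      multilinear n (\<lambda>w. \<phi> (g w)) \<and> alternating n (\<lambda>w. \<phi> (g w))"
    and p: "p \<in> exterior_relations n"
  shows "linear_extension g p \<in> exterior_relations m"
  unfolding exterior_relations_def
proof (rule in_span_if_functionals)
  fix \<phi> :: "('a list \<Rightarrow>\<^sub>0 'k) \<Rightarrow> 'k"
  assume \<phi>: "linear_functional \<phi>" and 0: "\<And>s. s \<in> multilinearity m \<union>
     {word w | w. length w = m \<and> (\<exists>i j. i < j \<and> j < m \<and> w ! i = w ! j)} \<Longrightarrow> \<phi> s = 0"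
  have "\<forall>p\<in>exterior_relations m. \<phi> p = 0"
    unfolding exterior_relations_def by (rule ballI, rule functional_zero_on_span[OF \<phi> 0])
  then have "multilinear n (\<lambda>w. \<phi> (g w)) \<and> alternating n (\<lambda>w. \<phi> (g w))"
    by (intro assms(1)[OF \<phi>]) (simp_all only: zero_on_exterior_iff[OF \<phi>])
  then have "\<forall>p\<in>exterior_relations n. \<phi> (linear_extension g p) = 0"
    unfolding zero_on_exterior_iff[OF functional_comp[OF \<phi>, of g]] linear_extension_word .
  then show "\<phi> (linear_extension g p) = 0" using p by (rule bspec)
qed

section \<open>Boundary operators in degrees three and four\<close>

lemma word_boundary_3:
  "word_boundary [x, y, v] = word [bracket x v, y] - word [bracket x y, v] - word [bracket y v, x]"
proof -
  have *: "{(i, j). i < j \<and> j < length [x, y, v]} = {(0, 1), (0, 2), (1, 2 :: nat)}"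
    by (auto simp: less_Suc_eq numeral_eq_Suc)
  show ?thesis unfolding word_boundary_def * by (simp add: nths_Cons numeral_eq_Suc)
qed

lemma word_boundary_4:
  "word_boundary [a, b, c, d] = word [bracket a c, b, d] - word [bracket a b, c, d] - word [bracket a d, b, c]
    - word [bracket b c, a, d] + word [bracket b d, a, c] - word [bracket c d, a, b]"
proof -
  have *: "{(i, j). i < j \<and> j < length [a, b, c, d]} = {(0, 1), (0, 2), (0, 3), (1, 2), (1, 3), (2, 3 :: nat)}"
    by (auto simp: less_Suc_eq numeral_eq_Suc)
  show ?thesis unfolding word_boundary_def * by (simp add: nths_Cons numeral_eq_Suc)
qed

lemma multilinear_2_iff:
  "multilinear 2 g \<longleftrightarrow>
    (\<forall>x x' y. g [x + x', y] = g [x, y] + g [x', y]) \<and> (\<forall>x y y'. g [x, y + y'] = g [x, y] + g [x, y']) \<and>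
    (\<forall>c x y. g [c *s x, y] = c * g [x, y]) \<and> (\<forall>c x y. g [x, c *s y] = c * g [x, y])" (is "?L \<longleftrightarrow> ?R")
proof
  assume L: ?L
  have add: "g ([x, y][i := u + v]) = g ([x, y][i := u]) + g ([x, y][i := v])" if "i < 2" for x y i u v
    by (rule L[unfolded multilinear_def, THEN conjunct1, rule_format]) (use that in simp_all)
  have scale: "g ([x, y][i := c *s u]) = c * g ([x, y][i := u])" if "i < 2" for x y i c u
    by (rule L[unfolded multilinear_def, THEN conjunct2, rule_format]) (use that in simp_all)
  show ?R using add[of 0] add[of 1] scale[of 0] scale[of 1] by simp
next
  assume R: ?R
  show ?L unfolding multilinear_def
    by (intro conjI allI impI; use R in \<open>(auto simp: numeral_eq_Suc length_Suc_conv less_Suc_eq)\<close>)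
qed

lemma multilinear_3_iff:
  "multilinear 3 g \<longleftrightarrow>
    (\<forall>x x' y w. g [x + x', y, w] = g [x, y, w] + g [x', y, w]) \<and>
    (\<forall>x y y' w. g [x, y + y', w] = g [x, y, w] + g [x, y', w]) \<and>
    (\<forall>x y w w'. g [x, y, w + w'] = g [x, y, w] + g [x, y, w']) \<and>
    (\<forall>c x y w. g [c *s x, y, w] = c * g [x, y, w]) \<and> (\<forall>c x y w. g [x, c *s y, w] = c * g [x, y, w]) \<and>
    (\<forall>c x y w. g [x, y, c *s w] = c * g [x, y, w])" (is "?L \<longleftrightarrow> ?R")
proof
  assume L: ?L
  have add: "g ([x, y, w][i := u + v]) = g ([x, y, w][i := u]) + g ([x, y, w][i := v])" if "i < 3" for x y w i u v
    by (rule L[unfolded multilinear_def, THEN conjunct1, rule_format]) (use that in simp_all)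
  have scale: "g ([x, y, w][i := c *s u]) = c * g ([x, y, w][i := u])" if "i < 3" for x y w i c u
    by (rule L[unfolded multilinear_def, THEN conjunct2, rule_format]) (use that in simp_all)
  show ?R using add[of 0] add[of 1] add[of 2] scale[of 0] scale[of 1] scale[of 2] by (simp add: numeral_eq_Suc)
next
  assume R: ?R
  show ?L unfolding multilinear_def
    by (intro conjI allI impI; use R in \<open>(auto simp: numeral_eq_Suc length_Suc_conv less_Suc_eq)\<close>)
qed

lemma alternating_2_iff: "alternating 2 g \<longleftrightarrow> (\<forall>x. g [x, x] = 0)"
proof
  assume L: "alternating 2 g"
  show "\<forall>x. g [x, x] = 0"
  proof
    fix x show "g [x, x] = 0"
      using L[unfolded alternating_def, rule_format, of "[x, x]" 0 1] by simp
  qed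
qed (auto simp: alternating_def numeral_eq_Suc length_Suc_conv less_Suc_eq)

lemma alternating_3_iff:
  "alternating 3 g \<longleftrightarrow> (\<forall>x y. g [x, x, y] = 0) \<and> (\<forall>x y. g [x, y, x] = 0) \<and> (\<forall>x y. g [y, x, x] = 0)"
proof
  assume L: "alternating 3 g"
  show "(\<forall>x y. g [x, x, y] = 0) \<and> (\<forall>x y. g [x, y, x] = 0) \<and> (\<forall>x y. g [y, x, x] = 0)"
  proof (intro conjI allI)
    fix x y
    show "g [x, x, y] = 0" using L[unfolded alternating_def, rule_format, of "[x, x, y]" 0 1] by simp
    show "g [x, y, x] = 0" using L[unfolded alternating_def, rule_format, of "[x, y, x]" 0 2] by simp
    show "g [y, x, x] = 0" using L[unfolded alternating_def, rule_format, of "[y, x, x]" 1 2] by simp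
  qed
qed (auto simp: alternating_def numeral_eq_Suc length_Suc_conv less_Suc_eq)

lemma boundary_3_relations:
  "p \<in> exterior_relations 3 \<Longrightarrow> linear_extension word_boundary p \<in> exterior_relations 2"
proof (rule map_into_exterior)
  fix \<phi> :: "('a list \<Rightarrow>\<^sub>0 'k) \<Rightarrow> 'k"
  assume \<phi>: "linear_functional \<phi>" and ml: "multilinear 2 (\<lambda>w. \<phi> (word w))"
    and alt: "alternating 2 (\<lambda>w. \<phi> (word w))"
  define g where "g x y = \<phi> (word [x, y])" for x y
  have g: "g (x + x') y = g x y + g x' y" "g x (y + y') = g x y + g x y'" "g (c *s x) y = c * g x y"
    "g x (c *s y) = c * g x y" "g x x = 0" for x x' y y' c
    using ml alt by (simp_all add: g_def multilinear_2_iff alternating_2_iff)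
  have gm: "g (- x) y = - g x y" "g 0 y = 0" for x y using g(3)[of "-1" x y] g(3)[of 0 x y] by simp_all
  have b: "\<phi> (word_boundary [x, y, w]) = g (bracket x w) y - g (bracket x y) w - g (bracket y w) x" for x y w
    by (simp add: word_boundary_3 functional_diff[OF \<phi>] g_def)
  have "multilinear 3 (\<lambda>w. \<phi> (word_boundary w))"
    unfolding multilinear_3_iff b
    by (simp add: g bracket_add_left bracket_add_right bracket_scale_left bracket_scale_right algebra_simps)
  moreover have "alternating 3 (\<lambda>w. \<phi> (word_boundary w))"
    unfolding alternating_3_iff b
  proof (intro conjI allI)
    fix x y
    have "bracket y x = - bracket x y" by (rule bracket_swap)
    then show "g (bracket x x) y - g (bracket x y) x - g (bracket y x) x = 0"
      by (simp add: bracket_self g gm)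
  qed (simp_all add: bracket_self g gm)
  ultimately show "multilinear 3 (\<lambda>w. \<phi> (word_boundary w)) \<and> alternating 3 (\<lambda>w. \<phi> (word_boundary w))" ..
qed

lemma multilinear_4I:
  assumes "\<And>x x' y v w. g [x + x', y, v, w] = g [x, y, v, w] + g [x', y, v, w]"
    "\<And>x y y' v w. g [x, y + y', v, w] = g [x, y, v, w] + g [x, y', v, w]"
    "\<And>x y v v' w. g [x, y, v + v', w] = g [x, y, v, w] + g [x, y, v', w]"
    "\<And>x y v w w'. g [x, y, v, w + w'] = g [x, y, v, w] + g [x, y, v, w']"
    "\<And>c x y v w. g [c *s x, y, v, w] = c * g [x, y, v, w]"
    "\<And>c x y v w. g [x, c *s y, v, w] = c * g [x, y, v, w]"
    "\<And>c x y v w. g [x, y, c *s v, w] = c * g [x, y, v, w]"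
    "\<And>c x y v w. g [x, y, v, c *s w] = c * g [x, y, v, w]"
  shows "multilinear 4 g"
  unfolding multilinear_def
  by (intro conjI allI impI; use assms in \<open>(auto simp: numeral_eq_Suc length_Suc_conv less_Suc_eq)\<close>)

lemma alternating_4I:
  assumes "\<And>x y v. g [x, x, y, v] = 0" "\<And>x y v. g [x, y, x, v] = 0" "\<And>x y v. g [x, y, v, x] = 0"
    "\<And>x y v. g [y, x, x, v] = 0" "\<And>x y v. g [y, x, v, x] = 0" "\<And>x y v. g [y, v, x, x] = 0"
  shows "alternating 4 g"
  unfolding alternating_def
  using assms by (auto simp: numeral_eq_Suc length_Suc_conv less_Suc_eq)

lemma boundary_4_relations:
  "p \<in> exterior_relations 4 \<Longrightarrow> linear_extension word_boundary p \<in> exterior_relations 3"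
proof (rule map_into_exterior)
  fix \<phi> :: "('a list \<Rightarrow>\<^sub>0 'k) \<Rightarrow> 'k"
  assume \<phi>: "linear_functional \<phi>" and ml: "multilinear 3 (\<lambda>w. \<phi> (word w))"
    and alt: "alternating 3 (\<lambda>w. \<phi> (word w))"
  define g where "g x y w = \<phi> (word [x, y, w])" for x y w
  have g: "g (x + x') y w = g x y w + g x' y w" "g x (y + y') w = g x y w + g x y' w"
    "g x y (w + w') = g x y w + g x y w'"
    "g (c *s x) y w = c * g x y w" "g x (c *s y) w = c * g x y w" "g x y (c *s w) = c * g x y w"
    "g x x y = 0" "g x y x = 0" "g y x x = 0" for x x' y y' w w' c
    using ml alt by (simp_all add: g_def multilinear_3_iff alternating_3_iff)
  have gm: "g (- x) y w = - g x y w" "g 0 y w = 0" for x y w using g(4)[of "-1" x y w] g(4)[of 0 x y w] by simp_all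
  have sw: "g x w y = - g x y w" for x y w
    using g(9)[of x "y + w"] unfolding g(2,3) by (simp add: g(9) eq_neg_iff_add_eq_0 add.commute)
  have b: "\<phi> (word_boundary [a, b, c, d]) = g (bracket a c) b d - g (bracket a b) c d - g (bracket a d) b c
    - g (bracket b c) a d + g (bracket b d) a c - g (bracket c d) a b" for a b c d
    by (simp add: word_boundary_4 functional_diff[OF \<phi>] functional_add[OF \<phi>] g_def)
  have "multilinear 4 (\<lambda>w. \<phi> (word_boundary w))"
    by (rule multilinear_4I; unfold b)
      (simp_all add: g bracket_add_left bracket_add_right bracket_scale_left bracket_scale_right algebra_simps)
  moreover have "alternating 4 (\<lambda>w. \<phi> (word_boundary w))"
  proof (rule alternating_4I; unfold b)
    fix x y v
    have br: "bracket y x = - bracket x y" "bracket v x = - bracket x v" "bracket v y = - bracket y v"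
      by (rule bracket_swap)+
    have sw': "g u y x = - g u x y" "g u v x = - g u x v" "g u v y = - g u y v" for u by (rule sw)+
    show "g (bracket x y) x v - g (bracket x x) y v - g (bracket x v) x y - g (bracket x y) x v
      + g (bracket x v) x y - g (bracket y v) x x = 0" by (simp add: bracket_self g gm)
    show "g (bracket x x) y v - g (bracket x y) x v - g (bracket x v) y x - g (bracket y x) x v
      + g (bracket y v) x x - g (bracket x v) x y = 0" by (simp add: bracket_self g gm br sw')
    show "g (bracket x v) y x - g (bracket x y) v x - g (bracket x x) y v - g (bracket y v) x x
      + g (bracket y x) x v - g (bracket v x) x y = 0" by (simp add: bracket_self g gm br sw')
    show "g (bracket y x) x v - g (bracket y x) x v - g (bracket y v) x x - g (bracket x x) y v
      + g (bracket x v) y x - g (bracket x v) y x = 0" by (simp add: bracket_self g gm br sw')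
    show "g (bracket y v) x x - g (bracket y x) v x - g (bracket y x) x v - g (bracket x v) y x
      + g (bracket x x) y v - g (bracket v x) y x = 0" by (simp add: bracket_self g gm br sw')
    show "g (bracket y x) v x - g (bracket y v) x x - g (bracket y x) v x - g (bracket v x) y x
      + g (bracket v x) y x - g (bracket x x) y v = 0" by (simp add: bracket_self g gm br sw')
  qed
  ultimately show "multilinear 4 (\<lambda>w. \<phi> (word_boundary w)) \<and> alternating 4 (\<lambda>w. \<phi> (word_boundary w))" ..
qed

lemma coset_nonempty: "free.subspace W \<Longrightarrow> p \<in> p +o W"
  using mem_coset[of W p p] by (simp add: free.subspace_0)

lemma boundary_coset:
  assumes "\<And>p. p \<in> exterior_relations n \<Longrightarrow> linear_extension word_boundary p \<in> exterior_relations (n - 1)"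
  shows "boundary n (p +o exterior_relations n) = linear_extension word_boundary p +o exterior_relations (n - 1)"
  unfolding boundary_def
proof (rule induced_map_eq)
  show "p +o exterior_relations n \<noteq> {}" using coset_nonempty[OF subspace_relations(1)] by blast
  fix x assume "x \<in> p +o exterior_relations n"
  then have "x - p \<in> exterior_relations n" by (simp only: mem_coset[OF subspace_relations(1)])
  then have "linear_extension word_boundary (x - p) \<in> exterior_relations (n - 1)" by (rule assms)
  moreover have "linear_extension word_boundary (x - p) = linear_extension word_boundary x - linear_extension word_boundary p"
    by (simp only: diff_conv_add_uminus linear_extension_add linear_extension_minus)
  ultimately show "linear_extension word_boundary x +o exterior_relations (n - 1)
      = linear_extension word_boundary p +o exterior_relations (n - 1)"
    by (simp only: coset_eq[OF subspace_relations(1)])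
qed

section \<open>The Killing module\<close>

abbreviation associator_word :: "'a list \<Rightarrow> ('a list \<Rightarrow>\<^sub>0 'k)" where
  "associator_word w \<equiv> word [bracket (w ! 0) (w ! 1), w ! 2] - word [w ! 0, bracket (w ! 1) (w ! 2)]"

abbreviation koszul_word :: "'a list \<Rightarrow> ('a list \<Rightarrow>\<^sub>0 'k)" where
  "koszul_word w \<equiv> word [w ! 0, bracket (w ! 1) (w ! 2)]"

lemma associator_relations:
  assumes p: "p \<in> tensor_relations 3"
  shows "linear_extension associator_word p \<in> symmetric_relations"
  unfolding symmetric_relations_def
proof (rule in_span_if_functionals)
  fix \<phi> :: "('a list \<Rightarrow>\<^sub>0 'k) \<Rightarrow> 'k"
  assume \<phi>: "linear_functional \<phi>" and 0: "\<And>s. s \<in> multilinearity 2 \<union>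
     {word [x, y] - word [y, x] | x y. True} \<Longrightarrow> \<phi> s = 0"
  have "\<forall>s\<in>multilinearity 2. \<phi> s = 0" using 0 by simp
  then have ml: "multilinear 2 (\<lambda>w. \<phi> (word w))" by (simp only: zero_on_multilinearity_iff[OF \<phi>])
  have "multilinear 3 (\<lambda>w. \<phi> (associator_word w))"
    using ml unfolding multilinear_2_iff multilinear_3_iff functional_diff[OF \<phi>]
    by (simp add: bracket_add_left bracket_add_right bracket_scale_left bracket_scale_right algebra_simps)
  then have "\<forall>s\<in>multilinearity 3. \<phi> (linear_extension associator_word s) = 0"
    unfolding zero_on_multilinearity_iff[OF functional_comp[OF \<phi>, of associator_word]] linear_extension_word .
  then show "\<phi> (linear_extension associator_word p) = 0"
    by (intro functional_zero_on_span[OF functional_comp[OF \<phi>, of associator_word] _ p[unfolded tensor_relations_def]])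
      blast
qed

lemma associator_map_coset:
  "associator_map (p +o tensor_relations 3) = linear_extension associator_word p +o symmetric_relations"
  unfolding associator_map_def
proof (rule induced_map_eq)
  show "p +o tensor_relations 3 \<noteq> {}" using coset_nonempty[OF subspace_relations(3)] by blast
  fix x assume "x \<in> p +o tensor_relations 3"
  then have "x - p \<in> tensor_relations 3" by (simp only: mem_coset[OF subspace_relations(3)])
  then have "linear_extension associator_word (x - p) \<in> symmetric_relations" by (rule associator_relations)
  moreover have "linear_extension associator_word (x - p) = linear_extension associator_word x - linear_extension associator_word p"
    by (simp only: diff_conv_add_uminus linear_extension_add linear_extension_minus)
  ultimately show "linear_extension associator_word x +o symmetric_relations
      = linear_extension associator_word p +o symmetric_relations"
    by (simp only: coset_eq[OF subspace_relations(2)])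
qed

lemma killing_relations_eq:
  "killing_relations = (\<lambda>q. linear_extension associator_word q +o symmetric_relations) ` free_words 3"
  unfolding killing_relations_def tensor_power_def quotient_space_def image_image associator_map_coset ..

lemma free_words_subspace: "free.subspace (free_words n :: ('a list \<Rightarrow>\<^sub>0 'k) set)"
  unfolding free.subspace_def
proof (intro conjI ballI allI)
  show "0 \<in> free_words n" by (simp add: free_words_def)
  show "p + q \<in> free_words n" if "p \<in> free_words n" "q \<in> free_words n" for p q :: "'a list \<Rightarrow>\<^sub>0 'k"
    using that Poly_Mapping.keys_add[of p q] unfolding free_words_def by blast
  show "free_scale c p \<in> free_words n" if "p \<in> free_words n" for c and p :: "'a list \<Rightarrow>\<^sub>0 'k"
    using that unfolding free_words_def by (auto simp: in_keys_iff)
qed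

text \<open>As the image of a subspace, \<open>killing_relations\<close> is a group of cosets, and
  translation by one of its elements permutes it.\<close>

lemma killing_coset:
  assumes q: "q \<in> free_words 3"
  shows "(linear_extension associator_word q +o symmetric_relations) +o killing_relations = killing_relations"
    (is "?A q +o _ = _")
proof -
  let ?F = "\<lambda>q. linear_extension associator_word q +o symmetric_relations"
  have add: "?F q + ?F q' = ?F (q + q')" for q q'
    by (simp only: coset_add[OF subspace_relations(2)] linear_extension_add)
  show ?thesis
    unfolding killing_relations_eq elt_set_plus_def[of "?F q"]
  proof (intro equalityI subsetI)
    fix X assume "X \<in> {c. \<exists>b\<in>?F ` free_words 3. c = ?F q + b}"
    then obtain q' where "q' \<in> free_words 3" "X = ?F q + ?F q'" by blast
    then have "X = ?F (q + q')" by (simp only: add)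
    then show "X \<in> ?F ` free_words 3"
      using free.subspace_add[OF free_words_subspace q \<open>q' \<in> free_words 3\<close>] by (rule image_eqI)
  next
    fix X assume "X \<in> ?F ` free_words 3"
    then obtain q' where q': "q' \<in> free_words 3" "X = ?F q'" by blast
    have "X = ?F q + ?F (q' - q)" unfolding add q'(2) by simp
    then show "X \<in> {c. \<exists>b\<in>?F ` free_words 3. c = ?F q + b}"
      using free.subspace_diff[OF free_words_subspace q'(1) q] by blast
  qed
qed

lemma killing_zero_eq: "killing_zero = killing_relations"
  using killing_coset[of 0] coset_zero[OF subspace_relations(2)] free.subspace_0[OF free_words_subspace]
  by (simp add: killing_zero_def)

text \<open>Lifted to the free space, the zero class becomes \<open>?S\<close>, the symmetric
  relations plus the values of the associator. It contains the span of \<open>?G\<close>, in which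
  membership is tested by functionals.\<close>

lemma killing_class_zero:
  assumes "\<And>\<phi>. linear_functional \<phi> \<Longrightarrow> (\<And>s. s \<in> symmetric_relations \<Longrightarrow> \<phi> s = 0) \<Longrightarrow>
    (\<And>x y v. \<phi> (word [bracket x y, v]) = \<phi> (word [x, bracket y v])) \<Longrightarrow> \<phi> p = 0"
  shows "(p +o symmetric_relations) +o killing_relations = killing_zero"
proof -
  let ?S = "{s + q | s q. s \<in> symmetric_relations \<and> q \<in> linear_extension associator_word ` free_words 3}"
  have "free.subspace (linear_extension associator_word ` free_words 3)"
    using free_words_subspace[of 3] unfolding free.subspace_def
    by (auto simp: linear_extension_add[symmetric] linear_extension_scale[symmetric] intro!: image_eqI[of 0 _ 0])
  then have sS: "free.subspace ?S" using free.subspace_sums[OF subspace_relations(2)] by blast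
  let ?G = "symmetric_relations \<union> {associator_word w | w. length w = 3}"
  have "p \<in> free.span ?G"
  proof (rule in_span_if_functionals)
    fix \<phi> :: "('a list \<Rightarrow>\<^sub>0 'k) \<Rightarrow> 'k"
    assume \<phi>: "linear_functional \<phi>" and 0: "\<And>s. s \<in> ?G \<Longrightarrow> \<phi> s = 0"
    show "\<phi> p = 0"
    proof (rule assms[OF \<phi>])
      show "\<phi> s = 0" if "s \<in> symmetric_relations" for s using 0 that by blast
      show "\<phi> (word [bracket x y, v]) = \<phi> (word [x, bracket y v])" for x y v
      proof -
        have "length [x, y, v] = 3" by simp
        then have "associator_word [x, y, v] \<in> ?G" by blast
        then have "\<phi> (associator_word [x, y, v]) = 0" by (rule 0)
        then show ?thesis by (simp add: functional_diff[OF \<phi>])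
      qed
    qed
  qed
  moreover have "free.span ?G \<subseteq> ?S"
  proof (rule free.span_minimal[OF _ sS])
    show "?G \<subseteq> ?S"
    proof
      fix x assume "x \<in> ?G"
      then consider "x \<in> symmetric_relations" | w where "length w = 3" "x = associator_word w" by blast
      then show "x \<in> ?S"
      proof cases
        case 1
        have "x = x + linear_extension associator_word 0" by simp
        then show ?thesis using 1 free.subspace_0[OF free_words_subspace[of 3]] by blast
      next
        case 2
        have "x = 0 + linear_extension associator_word (word w)" using 2 by simp
        moreover have "word w \<in> free_words 3" using 2 by (simp add: free_words_def word_def)
        ultimately show ?thesis using free.subspace_0[OF subspace_relations(2)] by blast
      qed
    qed
  qed
  ultimately obtain s q where sq: "p = s + linear_extension associator_word q" "s \<in> symmetric_relations" "q \<in> free_words 3"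
    by blast
  have "p +o symmetric_relations = linear_extension associator_word q +o symmetric_relations"
    unfolding coset_eq[OF subspace_relations(2)] using sq by simp
  then show ?thesis by (simp only: killing_coset[OF sq(3)] killing_zero_eq)
qed

end

section \<open>Vanishing of the Koszul map on cycles\<close>

context quadratic_lie_algebra
begin

text \<open>Invariance turns every term into a product under \<open>B\<close> of two brackets; the
  six terms agree in pairs, and Jacobi in the form of \<open>\<omega>_derivation\<close> finishes.
  This is vanishing of \<omega> on 3-boundaries.\<close>

lemma \<omega>_closed:
  "\<omega> (bracket a c) b d - \<omega> (bracket a b) c d - \<omega> (bracket a d) b c - \<omega> (bracket b c) a d
    + \<omega> (bracket b d) a c - \<omega> (bracket c d) a b = 0"
proof -
  have eq: "\<omega> (bracket p q) v w = B (bracket p q) (bracket v w)" for p q v w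
    unfolding \<omega>_def by (rule B_inv)
  have "\<omega> b (bracket a c) d = - \<omega> (bracket a c) b d" by (rule \<omega>_swap12)
  moreover have "\<omega> b c (bracket a d) = B (bracket b c) (bracket a d)" by (simp only: \<omega>_def)
  ultimately have "B (bracket a b) (bracket c d) - B (bracket a c) (bracket b d) + B (bracket b c) (bracket a d) = 0"
    using \<omega>_derivation[of a b c d] by (simp add: eq)
  then show ?thesis
    unfolding eq B_sym[of "bracket a d"] B_sym[of "bracket b d"] B_sym[of "bracket c d"] by (simp add: algebra_simps)
qed

text \<open>The argument is a general representative of a homology class. Closedness of \<omega>
  disposes of q and alternation of r. For the cycle p, the primitive \<alpha> gives
  \<open>\<psi> p\<close> as minus the value of \<chi> on the boundary of p, and \<chi> kills the
  exterior relations.\<close>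

lemma koszul_functional_zero:
  assumes \<phi>: "linear_functional \<phi>" and \<phi>B: "\<And>x y. \<phi> (word [x, y]) = B x y" and ex: "exact_form \<omega>"
    and p: "p \<in> free_words 3" "linear_extension word_boundary p \<in> exterior_relations 2"
    and q: "q \<in> free_words 4" and r: "r \<in> exterior_relations 3"
  shows "\<phi> (linear_extension koszul_word (p + linear_extension word_boundary q + r)) = 0"
proof -
  define \<psi> where "\<psi> p = \<phi> (linear_extension koszul_word p)" for p
  have \<psi>: "linear_functional \<psi>" unfolding \<psi>_def by (rule functional_comp[OF \<phi>])
  have \<psi>\<omega>: "\<psi> (word [x, y, v]) = \<omega> x y v" for x y v
    by (simp add: \<psi>_def \<phi>B \<omega>_def B_inv)
  have "multilinear 3 (\<lambda>w. \<psi> (word w)) \<and> alternating 3 (\<lambda>w. \<psi> (word w))"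
    by (simp add: multilinear_3_iff alternating_3_iff \<psi>\<omega> \<omega>_linear)
  then have \<psi>r: "\<psi> r = 0" using zero_on_exterior_iff[OF \<psi>] r by blast
  have "\<psi> (word_boundary w) = 0" if len: "length w = 4" for w
  proof -
    obtain a b c d where w: "w = [a, b, c, d]" using len by (auto simp: numeral_eq_Suc length_Suc_conv)
    show ?thesis
      unfolding w word_boundary_4 functional_diff[OF \<psi>] functional_add[OF \<psi>] \<psi>\<omega> by (rule \<omega>_closed)
  qed
  then have \<psi>q: "\<psi> (linear_extension word_boundary q) = 0"
    using q unfolding functional_linear_extension[OF \<psi>] free_words_def by (auto intro!: sum.neutral)
  obtain \<alpha> where a1: "\<And>x x' y. \<alpha> (x + x') y = \<alpha> x y + \<alpha> x' y" and a2: "\<And>c x y. \<alpha> (c *s x) y = c * \<alpha> x y"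
    and a3: "\<And>x y. \<alpha> y x = - \<alpha> x y"
    and a4: "\<And>x y w. \<omega> x y w = \<alpha> (bracket x y) w + \<alpha> (bracket y w) x + \<alpha> (bracket w x) y"
    using ex unfolding exact_form_def by blast
  have a5: "\<alpha> x (y + y') = \<alpha> x y + \<alpha> x y'" for x y y'
  proof -
    have "\<alpha> x v = - \<alpha> v x" for v by (rule a3)
    then show ?thesis by (simp only: a1) simp
  qed
  have a6: "\<alpha> x (c *s y) = c * \<alpha> x y" for x y c
    using a3[of "c *s y" x] a3[of y x] a2[of c y x] by simp
  have a7: "\<alpha> x x = 0" for x
    using a3[of x x] by simp
  obtain \<chi> :: "('a list \<Rightarrow>\<^sub>0 'k) \<Rightarrow> 'k" where \<chi>: "linear_functional \<chi>"
    and \<chi>w: "\<And>w. \<chi> (word w) = \<alpha> (w ! 0) (w ! 1)"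
    using functional_exists[where g = "\<lambda>w. \<alpha> (w ! 0) (w ! 1)"] by metis
  have "multilinear 2 (\<lambda>w. \<chi> (word w)) \<and> alternating 2 (\<lambda>w. \<chi> (word w))"
    by (simp add: multilinear_2_iff alternating_2_iff \<chi>w a1 a2 a5 a6 a7)
  then have \<chi>0: "\<chi> (linear_extension word_boundary p) = 0" using zero_on_exterior_iff[OF \<chi>] p(2) by blast
  have "\<psi> (word w) = - \<chi> (word_boundary w)" if len: "length w = 3" for w
  proof -
    obtain x y v where w: "w = [x, y, v]" using len by (auto simp: numeral_eq_Suc length_Suc_conv)
    have "\<alpha> (bracket v x) y = - \<alpha> (bracket x v) y"
      using a2[of "-1" "bracket x v" y] bracket_swap[of v x] by simp
    then show ?thesis
      unfolding w word_boundary_3 functional_diff[OF \<chi>] \<psi>\<omega> \<chi>w a4 by simp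
  qed
  then have "\<psi> p = (\<Sum>w\<in>Poly_Mapping.keys p. - (Poly_Mapping.lookup p w * \<chi> (word_boundary w)))"
    using p(1) unfolding functional_expand[OF \<psi>, of p] free_words_def by (intro sum.cong) auto
  also have "\<dots> = - \<chi> (linear_extension word_boundary p)"
    unfolding functional_linear_extension[OF \<chi>] by (rule sum_negf)
  finally have "\<psi> p = 0" using \<chi>0 by simp
  then have "\<psi> (p + linear_extension word_boundary q + r) = 0"
    using \<psi>q \<psi>r by (simp add: functional_add[OF \<psi>])
  then show ?thesis by (simp only: \<psi>_def)
qed

end

theorem theorem7p2:
  fixes scale :: "'k::field_char_0 \<Rightarrow> 'a::ab_group_add \<Rightarrow> 'a"
    and bracket :: "'a \<Rightarrow> 'a \<Rightarrow> 'a"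
    and Basis :: "'a set"
  assumes "lie_algebra scale bracket"
    and "finite_dimensional_vector_space scale Basis"
    and "vector_space.dim scale (UNIV :: 'a set) \<le> 8"
    and "lie_algebra.solvable scale bracket"
  shows "\<forall>h \<in> lie_algebra.homology scale bracket 3.
           lie_algebra.reduced_koszul_map scale bracket h = lie_algebra.killing_zero scale bracket"
proof
  interpret lie_algebra scale bracket by (rule assms(1))
  interpret finite_dimensional_vector_space scale Basis by (rule assms(2))
  fix h assume "h \<in> homology 3"
  then obtain c where c: "c \<in> cycles 3" and h: "h = c +o boundaries 3"
    unfolding homology_def quotient_space_def by blast
  from c obtain p where p: "p \<in> free_words 3" "c = p +o exterior_relations 3"
    "boundary 3 c = exterior_relations 2"
    unfolding cycles_def exterior_power_def quotient_space_def by auto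
  have b3: "boundary 3 (p +o exterior_relations 3) = linear_extension word_boundary p +o exterior_relations 2" for p
    using boundary_coset[of 3 p] boundary_3_relations by simp
  have b4: "boundary 4 (q +o exterior_relations 4) = linear_extension word_boundary q +o exterior_relations 3" for q
    using boundary_coset[of 4 q] boundary_4_relations by simp
  have "linear_extension word_boundary p +o exterior_relations 2 = 0 +o exterior_relations 2"
    using p(2,3) b3 coset_zero[OF subspace_relations(1)] by simp
  then have dp: "linear_extension word_boundary p \<in> exterior_relations 2"
    unfolding coset_eq[OF subspace_relations(1)] by simp
  have bs: "boundaries 3 = (\<lambda>q. linear_extension word_boundary q +o exterior_relations 3) ` free_words 4"
    unfolding boundaries_def exterior_power_def quotient_space_def image_image by (simp add: b4)
  show "reduced_koszul_map h = killing_zero"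
    unfolding reduced_koszul_map_def
  proof (rule induced_map_eq)
    have "(0 :: 'a list \<Rightarrow>\<^sub>0 'k) \<in> free_words 4" by (simp add: free_words_def)
    then show "h \<noteq> {}" unfolding h bs elt_set_plus_def by blast
    \<comment> \<open>The induced maps are nested, so all representatives have to be checked:
      \<open>c'\<close> runs over the cycles homologous to c, and below x runs over the elements of
      the coset \<open>c'\<close>.\<close>
    fix c' assume "c' \<in> h"
    then obtain b where b: "b \<in> boundaries 3" "c' = c + b" unfolding h elt_set_plus_def[of c] by blast
    then obtain q where q: "q \<in> free_words 4"
      "c' = (p +o exterior_relations 3) + (linear_extension word_boundary q +o exterior_relations 3)"
      unfolding bs p(2) by blast
    have c': "c' = (p + linear_extension word_boundary q) +o exterior_relations 3"
      unfolding q(2) by (rule coset_add[OF subspace_relations(1)])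
    show "koszul_map c' = killing_zero"
      unfolding koszul_map_def
    proof (rule induced_map_eq)
      show "c' \<noteq> {}" unfolding c' using coset_nonempty[OF subspace_relations(1)] by blast
      fix x assume "x \<in> c'"
      then have "x - (p + linear_extension word_boundary q) \<in> exterior_relations 3"
        unfolding c' by (simp only: mem_coset[OF subspace_relations(1)])
      then obtain r where r: "r \<in> exterior_relations 3" "x = p + linear_extension word_boundary q + r"
        by (metis add_diff_cancel_left' diff_add_cancel add.commute)
      show "(linear_extension koszul_word x +o symmetric_relations) +o killing_relations = killing_zero"
      proof (rule killing_class_zero)
        fix \<phi> :: "('a list \<Rightarrow>\<^sub>0 'k) \<Rightarrow> 'k"
        assume \<phi>: "linear_functional \<phi>" and sym: "\<And>s. s \<in> symmetric_relations \<Longrightarrow> \<phi> s = 0"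
          and inv: "\<And>x y v. \<phi> (word [bracket x y, v]) = \<phi> (word [x, bracket y v])"
        have sym': "\<phi> s = 0" if "s \<in> multilinearity 2 \<union> {word [x, y] - word [y, x] | x y. True}" for s
          using free.span_base[OF that] by (intro sym) (simp only: symmetric_relations_def)
        have "\<forall>s\<in>multilinearity 2. \<phi> s = 0" using sym' by simp
        then have ml: "multilinear 2 (\<lambda>w. \<phi> (word w))" by (simp only: zero_on_multilinearity_iff[OF \<phi>])
        have "\<phi> (word [x, y] - word [y, x]) = 0" for x y by (rule sym') blast
        then have comm: "\<phi> (word [x, y]) = \<phi> (word [y, x])" for x y by (simp add: functional_diff[OF \<phi>])
        define B where "B x y = \<phi> (word [x, y])" for x y
        interpret Q: quadratic_lie_algebra scale bracket Basis B
        proof unfold_locales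
          show "B (x + y) w = B x w + B y w" "B (scale c x) w = c * B x w" for x y w c
            using ml by (simp_all add: B_def multilinear_2_iff)
          show "B x y = B y x" for x y unfolding B_def by (rule comm)
          show "B (bracket x y) w = B x (bracket y w)" for x y w unfolding B_def by (rule inv)
        qed
        have "Q.exact_form Q.\<omega>" by (rule Q.invariant_form_exact[OF assms(4,3)])
        then show "\<phi> (linear_extension koszul_word x) = 0"
          unfolding r(2) by (intro Q.koszul_functional_zero[OF \<phi> _ _ p(1) dp q(1) r(1)]) (simp add: B_def)
      qed
    qed
  qed
qed

end
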